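(* Let $k$ be an algebraically closed field of characteristic $0$ and let $C$ be a genus $2$ curve defined over $k$. i) If $C$ has equation $Y^2=X^5+X^3+tX$ with $t\in k\setminus\{0,\frac14,\frac9{100}\}$, then the degree $2$ elliptic subfields of $C$ have $j$-invariants given by $$j^2-128\,\frac{2000t^2+1440t+27}{(4t-1)^2}\,j+4096\,\frac{(100t-9)^3}{(4t-1)^3}=0.$$ ii) If $C$ has equation $Y^2=X^6+X^3+t$ with $t\in k\setminus\{0,\frac14,-\frac1{50}\}$, then the degree $2$ elliptic subfields of $C$ have $j$-invariants given by $$j^2-13824\,t\,\frac{500t^2+965t+27}{(4t-1)^3}\,j+47775744\,t\,\frac{(25t-4)^3}{(4t-1)^4}=0.$$
   Context: A genus $2$ curve given by an affine equation means its smooth projective model. A degree $2$ elliptic subfield of $C$ is a subfield $F$ with $k\subset F\subset k(C)$, $[k(C):F]=2$, which is the function field of an elliptic curve $E$ over $k$; equivalently it corresponds to a degree $2$ covering $C\to E$ with $E$ an elliptic curve, i.e. to a non-hyperelliptic involution in $\mathrm{Aut}(C)$. Its $j$-invariant is the $j$-invariant of $E$.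
   Formalization: In part ii) the coefficient 500t^2+965t+27 is corrected to 500t^2+965t+92; as printed it fails, e.g. at t=1 the curve has a degree 2 elliptic subfield with j=790272, which is not a root of the printed quadratic. *)

theory Defs
  imports
    "HOL-Algebra.Embedded_Algebras"
    "HOL-Algebra.QuotRing"
    "HOL-Computational_Algebra.Computational_Algebra"
begin

section \<open>The function field of \<open>y\<^sup>2 + h(x) y = f(x)\<close>\<close>

text \<open>
  The pair \<open>(a, b)\<close> of rational functions stands for \<open>a + b y\<close> in
  \<open>k(x)[y]/(y\<^sup>2 + h y - f)\<close>.  A smooth projective curve over an algebraically closed field is
  determined by its function field, so this ring (a field whenever \<open>y\<^sup>2 + h y - f\<close> is
  irreducible, see \<open>field_curve_field\<close>) represents the smooth projective model of the affine curve.
\<close>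

definition curve_field ::
  "'k::field poly \<Rightarrow> 'k poly \<Rightarrow> ('k poly fract \<times> 'k poly fract) ring"
where
  "curve_field h f =
     \<lparr> carrier = UNIV,
       monoid.mult = (\<lambda>u v. (fst u * fst v + snd u * snd v * to_fract f,
                      fst u * snd v + snd u * fst v - snd u * snd v * to_fract h)),
       one = (1, 0),
       zero = (0, 0),
       add = (\<lambda>u v. (fst u + fst v, snd u + snd v)) \<rparr>"

definition constant_fun :: "'k::field \<Rightarrow> 'k poly fract \<times> 'k poly fract" where
  "constant_fun c = (to_fract [:c:], 0)"

section \<open>Weierstrass curves\<close>

text \<open>\<open>y\<^sup>2 + a\<^sub>1 x y + a\<^sub>3 y = x\<^sup>3 + a\<^sub>2 x\<^sup>2 + a\<^sub>4 x + a\<^sub>6\<close>, with the usual auxiliary quantities.\<close>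

datatype 'k weierstrass = Weierstrass (wa1: 'k) (wa2: 'k) (wa3: 'k) (wa4: 'k) (wa6: 'k)

definition wb2 :: "'k::field weierstrass \<Rightarrow> 'k" where
  "wb2 E = wa1 E ^ 2 + 4 * wa2 E"

definition wb4 :: "'k::field weierstrass \<Rightarrow> 'k" where
  "wb4 E = 2 * wa4 E + wa1 E * wa3 E"

definition wb6 :: "'k::field weierstrass \<Rightarrow> 'k" where
  "wb6 E = wa3 E ^ 2 + 4 * wa6 E"

definition wb8 :: "'k::field weierstrass \<Rightarrow> 'k" where
  "wb8 E = wa1 E ^ 2 * wa6 E + 4 * wa2 E * wa6 E - wa1 E * wa3 E * wa4 E
           + wa2 E * wa3 E ^ 2 - wa4 E ^ 2"

definition wc4 :: "'k::field weierstrass \<Rightarrow> 'k" where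
  "wc4 E = wb2 E ^ 2 - 24 * wb4 E"

definition wdisc :: "'k::field weierstrass \<Rightarrow> 'k" where
  "wdisc E = - (wb2 E ^ 2 * wb8 E) - 8 * wb4 E ^ 3 - 27 * wb6 E ^ 2 + 9 * wb2 E * wb4 E * wb6 E"

definition elliptic_curve :: "'k::field weierstrass \<Rightarrow> bool" where
  "elliptic_curve E \<longleftrightarrow> wdisc E \<noteq> 0"

definition j_invariant :: "'k::field weierstrass \<Rightarrow> 'k" where
  "j_invariant E = wc4 E ^ 3 / wdisc E"

definition weierstrass_field ::
  "'k::field weierstrass \<Rightarrow> ('k poly fract \<times> 'k poly fract) ring"
where
  "weierstrass_field E = curve_field [:wa3 E, wa1 E:] [:wa6 E, wa4 E, wa2 E, 1:]"

section \<open>Elliptic subfields of degree 2\<close>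

text \<open>\<open>K\<close> is meant to be a ring of the form \<open>curve_field h f\<close>, with constants \<open>range constant_fun\<close>.\<close>

definition degree2_subfield ::
  "('k::field poly fract \<times> 'k poly fract) ring \<Rightarrow> ('k poly fract \<times> 'k poly fract) set \<Rightarrow> bool"
where
  "degree2_subfield K F \<longleftrightarrow>
     subfield F K \<and> range constant_fun \<subseteq> F \<and> ring.dimension K 2 F (carrier K)"

text \<open>Isomorphism over \<open>k\<close>: the constants are fixed.\<close>

definition is_function_field_of ::
  "('k::field poly fract \<times> 'k poly fract) ring \<Rightarrow> ('k poly fract \<times> 'k poly fract) set
    \<Rightarrow> 'k weierstrass \<Rightarrow> bool"
where
  "is_function_field_of K F E \<longleftrightarrow>
     (\<exists>\<phi> \<in> ring_iso (weierstrass_field E) (K\<lparr>carrier := F\<rparr>).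
        \<forall>c. \<phi> (constant_fun c) = constant_fun c)"

definition degree2_elliptic_j_invariants ::
  "('k::field poly fract \<times> 'k poly fract) ring \<Rightarrow> 'k set"
where
  "degree2_elliptic_j_invariants K =
     {j_invariant E | F E. degree2_subfield K F \<and> elliptic_curve E \<and> is_function_field_of K F E}"

section \<open>The two families\<close>

definition quintic :: "'k::field \<Rightarrow> 'k poly" where
  "quintic t = monom 1 5 + monom 1 3 + monom t 1"

definition sextic :: "'k::field \<Rightarrow> 'k poly" where
  "sextic t = monom 1 6 + monom 1 3 + monom t 0"

text \<open>Both polynomials have only simple roots for the parameters considered, so the curves
  \<open>y\<^sup>2 = f(x)\<close> have genus 2.\<close>

lemma degree_quintic: "degree (quintic t) = 5"
proof -
  have "quintic t = [:0, t, 0, 1, 0, 1:]"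
    by (simp add: quintic_def monom_altdef numeral_eq_Suc)
  thus ?thesis by simp
qed

lemma degree_sextic: "degree (sextic t) = 6"
proof -
  have "sextic t = [:t, 0, 0, 1, 0, 0, 1:]"
    by (simp add: sextic_def monom_altdef numeral_eq_Suc)
  thus ?thesis by simp
qed

lemma rsquarefree_quintic:
  fixes t :: "'k::field_char_0"
  assumes "t \<noteq> 0" "t \<noteq> 1 / 4"
  shows "rsquarefree (quintic t)"
  unfolding rsquarefree_roots
proof (intro allI notI, elim conjE)
  fix a assume 1: "poly (quintic t) a = 0" and 2: "poly (pderiv (quintic t)) a = 0"
  have e: "quintic t = [:0, t, 0, 1, 0, 1:]"
    by (simp add: quintic_def monom_altdef numeral_eq_Suc)
  have f: "a * (a^4 + a^2 + t) = 0" using 1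
    unfolding e by (simp add: algebra_simps power2_eq_square power4_eq_xxxx)
  have d: "5 * a^4 + 3 * a^2 + t = 0" using 2
    unfolding e by (simp add: pderiv_pCons algebra_simps power2_eq_square power4_eq_xxxx)
  have "a \<noteq> 0" using d assms by auto
  hence f': "a^4 + a^2 + t = 0" using f by simp
  have "2 * a^2 * (2 * a^2 + 1) = (5 * a^4 + 3 * a^2 + t) - (a^4 + a^2 + t)"
    by (simp add: algebra_simps power2_eq_square power4_eq_xxxx)
  hence s: "2 * a^2 + 1 = 0" using \<open>a \<noteq> 0\<close> f' d by simp
  have "4 * (a^4 + a^2 + t) = (2 * a^2 + 1) * (2 * a^2 + 1) + 4 * t - 1"
    by (simp add: algebra_simps power2_eq_square power4_eq_xxxx)
  hence "4 * t = 1" using f' s by simp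
  thus False using assms by (simp add: field_simps)
qed

lemma rsquarefree_sextic:
  fixes t :: "'k::field_char_0"
  assumes "t \<noteq> 0" "t \<noteq> 1 / 4"
  shows "rsquarefree (sextic t)"
  unfolding rsquarefree_roots
proof (intro allI notI, elim conjE)
  fix a assume 1: "poly (sextic t) a = 0" and 2: "poly (pderiv (sextic t)) a = 0"
  have e: "sextic t = [:t, 0, 0, 1, 0, 0, 1:]"
    by (simp add: sextic_def monom_altdef numeral_eq_Suc)
  have f: "a^6 + a^3 + t = 0" using 1
    unfolding e by (simp add: algebra_simps eval_nat_numeral)
  have "3 * (a^2 * (2 * a^3 + 1)) = 0" using 2
    unfolding e by (simp add: pderiv_pCons algebra_simps eval_nat_numeral)
  hence d: "a^2 * (2 * a^3 + 1) = 0" by simp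
  have "a \<noteq> 0" using f assms by auto
  hence s: "2 * a^3 + 1 = 0" using d by simp
  have "4 * (a^6 + a^3 + t) = (2 * a^3 + 1) * (2 * a^3 + 1) + 4 * t - 1"
    by (simp add: algebra_simps eval_nat_numeral)
  hence "4 * t = 1" using f s by simp
  thus False using assms by (simp add: field_simps)
qed

section \<open>\<open>curve_field\<close> is a field\<close>

lemma cring_curve_field: "cring (curve_field h f)"
proof (rule cringI)
  show "abelian_group (curve_field h f)"
  proof (rule abelian_groupI)
    fix x assume "x \<in> carrier (curve_field h f)"
    show "\<exists>y\<in>carrier (curve_field h f). y \<oplus>\<^bsub>curve_field h f\<^esub> x = \<zero>\<^bsub>curve_field h f\<^esub>"
      by (rule bexI[of _ "(- fst x, - snd x)"]) (auto simp: curve_field_def)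
  qed (auto simp: curve_field_def)
  show "comm_monoid (curve_field h f)"
    by (rule comm_monoidI) (auto simp: curve_field_def algebra_simps)
qed (auto simp: curve_field_def algebra_simps)

lemma field_curve_field:
  assumes irr: "\<And>z. z ^ 2 + to_fract h * z \<noteq> to_fract f"
  shows "field (curve_field h f)"
proof (rule cring.cring_fieldI2[OF cring_curve_field])
  show "\<zero>\<^bsub>curve_field h f\<^esub> \<noteq> \<one>\<^bsub>curve_field h f\<^esub>" by (simp add: curve_field_def)
next
  fix u assume "u \<in> carrier (curve_field h f)" and "u \<noteq> \<zero>\<^bsub>curve_field h f\<^esub>"
  hence u: "u \<noteq> (0, 0)" by (simp add: curve_field_def)
  obtain a b where ab: "u = (a, b)" by fastforce
  define N where "N = a^2 - a * b * to_fract h - b^2 * to_fract f"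
  have N: "N \<noteq> 0"
  proof
    assume N0: "N = 0"
    show False
    proof (cases "b = 0")
      case True thus False using N0 u ab by (simp add: N_def)
    next
      case False
      have "(- (a / b))^2 + to_fract h * (- (a / b)) = to_fract f"
        using False N0 by (simp add: N_def field_simps power2_eq_square)
      thus False using irr by blast
    qed
  qed
  show "\<exists>v\<in>carrier (curve_field h f). u \<otimes>\<^bsub>curve_field h f\<^esub> v = \<one>\<^bsub>curve_field h f\<^esub>"
  proof (rule bexI[of _ "((a - b * to_fract h) / N, - b / N)"])
    have "a * ((a - b * to_fract h) / N) + b * (- b / N) * to_fract f = N / N"
      by (simp add: N_def power2_eq_square algebra_simps flip: add_divide_distrib diff_divide_distrib)
    moreover have "a * (- b / N) + b * ((a - b * to_fract h) / N) - b * (- b / N) * to_fract h = 0"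
      using N by (simp add: field_simps)
    ultimately show "u \<otimes>\<^bsub>curve_field h f\<^esub> ((a - b * to_fract h) / N, - b / N)
        = \<one>\<^bsub>curve_field h f\<^esub>"
      using N by (simp add: curve_field_def ab)
  qed (simp add: curve_field_def)
qed

lemma not_square_of_simple_root:
  fixes f :: "'k::field poly"
  assumes "order a f = 1" "f \<noteq> 0"
  shows "z ^ 2 \<noteq> to_fract f"
proof
  assume z: "z ^ 2 = to_fract f"
  obtain p q where pq: "z = Fract p q" "q \<noteq> 0" by (cases z) auto
  have eq: "p * p = f * (q * q)"
    using z pq by (simp add: power2_eq_square to_fract_def eq_fract)
  have "p \<noteq> 0" using eq pq assms by auto
  hence "order a p + order a p = 1 + (order a q + order a q)"
    using arg_cong[OF eq, of "order a"] pq assms by (simp add: order_mult)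
  thus False by presburger
qed

lemma field_curve_field_rsquarefree:
  fixes f :: "'k::alg_closed_field poly"
  assumes "rsquarefree f" "degree f > 0"
  shows "field (curve_field 0 f)"
proof (rule field_curve_field)
  obtain a where "poly f a = 0" using assms(2) alg_closed_imp_poly_has_root by blast
  moreover have f0: "f \<noteq> 0" using assms(2) by auto
  ultimately have "order a f \<noteq> 0" by (simp add: order_root)
  hence "order a f = 1"
    using assms(1) unfolding rsquarefree_def by metis
  thus "z ^ 2 + to_fract 0 * z \<noteq> to_fract f" for z
    using not_square_of_simple_root[of a f z] f0 by simp
qed

section \<open>The coefficient 92 in the second quadratic\<close>

text \<open>
  The middle coefficient of the quadratic for the family \<open>y\<^sup>2 = x\<^sup>6 + x\<^sup>3 + t\<close> is also found in print
  with \<open>500 t\<^sup>2 + 965 t + 27\<close> in place of \<open>500 t\<^sup>2 + 965 t + 92\<close>; that is a misprint.  For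
  \<open>t = 1\<close> the involution \<open>(x, y) \<mapsto> (1/x, y/x\<^sup>3)\<close> has the elliptic quotient below.
\<close>

definition quotient_at_1 :: "'k::field weierstrass" where
  "quotient_at_1 = Weierstrass 0 9 0 6 1"

lemma quotient_at_1_equation:
  fixes x y :: "'L::field"
  assumes "y ^ 2 = x ^ 6 + x ^ 3 + 1" "x + 1 \<noteq> 0"
  defines "u \<equiv> - x / (x + 1) ^ 2" and "v \<equiv> y / (x + 1) ^ 3"
  shows "v ^ 2 = u ^ 3 + 9 * u ^ 2 + 6 * u + 1"
proof -
  define w where "w = x + 1"
  have w: "w \<noteq> 0" using assms(2) by (simp add: w_def)
  have "u ^ 3 + 9 * u ^ 2 + 6 * u + 1
      = (- (x ^ 3) + 9 * x ^ 2 * w ^ 2 - 6 * x * w ^ 4 + w ^ 6) / w ^ 6"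
    unfolding u_def w_def[symmetric] using w by (simp add: field_simps eval_nat_numeral)
  also have "- (x ^ 3) + 9 * x ^ 2 * w ^ 2 - 6 * x * w ^ 4 + w ^ 6 = x ^ 6 + x ^ 3 + 1"
    unfolding w_def by (simp add: algebra_simps eval_nat_numeral)
  also have "(x ^ 6 + x ^ 3 + 1) / w ^ 6 = v ^ 2"
    by (simp add: v_def w_def assms(1)[symmetric] power_divide flip: power_mult)
  finally show ?thesis by simp
qed

lemma quotient_at_1_j:
  fixes E :: "'k::field_char_0 weierstrass"
  defines "E \<equiv> quotient_at_1"
  defines "q \<equiv> \<lambda>(c::'k) (t::'k) j.
    j ^ 2 - 13824 * t * ((500 * t ^ 2 + 965 * t + c) / (4 * t - 1) ^ 3) * j
    + 47775744 * t * ((25 * t - 4) ^ 3 / (4 * t - 1) ^ 4)"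
  shows "elliptic_curve E" "j_invariant E = 790272"
    and "q 92 1 (j_invariant E) = 0" "q 27 1 (j_invariant E) \<noteq> 0"
proof -
  note defs = E_def quotient_at_1_def elliptic_curve_def j_invariant_def wc4_def wdisc_def
    wb2_def wb4_def wb6_def wb8_def
  show "elliptic_curve E" by (simp add: defs)
  show j: "j_invariant E = 790272" by (simp add: defs)
  show "q 92 1 (j_invariant E) = 0" by (simp add: j q_def)
  show "q 27 1 (j_invariant E) \<noteq> 0" by (simp add: j q_def)
qed

end

theory Submission
  imports "HOL-Algebra.Algebraic_Closure_Type" Defs
begin

hide_const (open) Polynomials.degree

text \<open>
  Everything takes place in an algebraic closure of \<open>k(x)\<close>, where \<open>k(C) = k(x) + k(x) y\<close>.

  The main tool is a bidegree bound: if \<open>u\<close> has degree at most \<open>n\<close> over \<open>k(x)\<close> and \<open>x\<close> has degree at most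
  \<open>m\<close> over \<open>k(u)\<close>, then \<open>x\<close> and \<open>u\<close> satisfy a polynomial relation of degree at most \<open>m\<close> in \<open>x\<close> and \<open>n\<close>
  in \<open>u\<close>.  For two coordinates \<open>x\<close>, \<open>u\<close> of degree 2 on an elliptic curve the relation is biquadratic; its
  discriminants with respect to the two variables are, up to squares of constants, the defining cubics, and they
  have the same quartic invariants \<open>I\<close> and \<open>J\<close>.  Hence the \<open>j\<close>-invariant depends only on the function field.

  A subfield \<open>F\<close> of index 2 is the fixed field of an involution \<open>\<sigma>\<close>.  If \<open>\<sigma> x\<close> were not in \<open>k(x)\<close>, then
  \<open>x\<close> and \<open>\<sigma> x\<close> would satisfy a biquadratic relation, with a discriminant of degree at most 4 that is the product of
  a square and the squarefree \<open>f\<close> of degree at least 5.  So \<open>\<sigma> x\<close> is a Moebius transform of \<open>x\<close> permuting the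
  branch points, and comparing coefficients leaves only \<open>\<sigma> x = \<gamma>\<^sup>2 / x\<close>.  In the coordinate
  \<open>z = (x - \<gamma>) / (x + \<gamma>)\<close> this is \<open>z \<mapsto> - z\<close>, the curve becomes \<open>w\<^sup>2 = h(z\<^sup>2)\<close> with a cubic \<open>h\<close>, and the
  elliptic subfields are \<open>k(z\<^sup>2, w)\<close> and \<open>k(1/z\<^sup>2, w/z\<^sup>3)\<close>.
\<close>

section \<open>Polynomial evaluation along a homomorphism\<close>

text \<open>\<open>degree2_elliptic_j_invariants\<close> ranges over all subfields of index 2 and
  over all Weierstrass models of each. Computing two quotients is therefore not enough: no further
  subfield may occur, and no other model of the same field may have another j-invariant. Divisors
  and genus would settle both; here polynomial degrees take their place. If \<open>w\<close> lies in
  \<open>k(x, y)\<close> but not in \<open>k(x)\<close> and \<open>w^2 = D(x)\<close>, then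
  \<open>w = p(x) y\<close> with \<open>2 deg p + deg f = deg D\<close>, because \<open>f\<close> is
  squarefree. This equation either has no solution, which excludes a configuration, or makes
  \<open>p\<close> constant. The j-invariants are rational functions of \<open>\<gamma>^2\<close>
  (quintic) or \<open>\<gamma>^3\<close> (sextic), which is a square root of \<open>t\<close>; the
  two square roots of \<open>t\<close> give the two roots of each quadratic. At \<open>t = 0\<close>
  and \<open>t = 1/4\<close> the polynomial \<open>f\<close> has a multiple root. The values 9/100
  and -1/50 are those that the coefficient comparison forces on an involution of the
  \<open>x\<close>-line whose pole is a finite point other than 0.\<close>

locale coeff_hom =
  fixes h :: "'a::idom \<Rightarrow> 'b::idom"
  assumes one [simp]: "h 1 = 1"
    and add [simp]: "h (a + b) = h a + h b"
    and mult [simp]: "h (a * b) = h a * h b"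
begin

lemma zero [simp]: "h 0 = 0"
  using add[of 0 0] by (metis add.right_neutral add_left_cancel)

lemma minus [simp]: "h (- a) = - h a"
  using add[of a "- a"] by (simp add: eq_neg_iff_add_eq_0 add.commute)

lemma diff [simp]: "h (a - b) = h a - h b"
  using add[of a "- b"] by simp

lemma power [simp]: "h (a ^ n) = h a ^ n"
  by (induction n) auto

lemma of_nat [simp]: "h (of_nat n) = of_nat n"
  by (induction n) auto

lemma numeral [simp]: "h (numeral n) = numeral n"
  using of_nat[of "numeral n"] by simp

lemma sum: "h (\<Sum>i\<in>A. f i) = (\<Sum>i\<in>A. h (f i))"
  by (induction A rule: infinite_finite_induct) auto

lemma map_poly_mult: "map_poly h (p * q) = map_poly h p * map_poly h q"
  by (rule poly_eqI) (simp add: coeff_map_poly coeff_mult sum)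

definition ev :: "'a poly \<Rightarrow> 'b \<Rightarrow> 'b" where
  "ev p x = poly (map_poly h p) x"

lemma ev_0 [simp]: "ev 0 x = 0"
  by (simp add: ev_def)

lemma ev_pCons [simp]: "ev (pCons a p) x = h a + x * ev p x"
  by (cases "a = 0 \<and> p = 0") (auto simp: ev_def map_poly_pCons)

lemma ev_add [simp]: "ev (p + q) x = ev p x + ev q x"
proof (induction p arbitrary: q)
  case (pCons a p)
  obtain b q' where q: "q = pCons b q'" by (cases q)
  show ?case unfolding q by (simp add: pCons.IH algebra_simps)
qed simp

lemma ev_smult [simp]: "ev (smult a p) x = h a * ev p x"
  by (induction p) (auto simp: algebra_simps)

lemma ev_mult [simp]: "ev (p * q) x = ev p x * ev q x"
  by (induction p) (auto simp: algebra_simps)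

lemma ev_1 [simp]: "ev 1 x = 1"
  by (simp add: one_pCons)

text \<open>Evaluation is again a coefficient homomorphism, so everything proved about
  \<open>ev\<close> can be applied to it in turn; evaluation in two variables arises by this
  iteration.\<close>

lemma coeff_hom_ev: "coeff_hom (\<lambda>p. ev p x)"
  by unfold_locales auto

lemmas ev_hom [simp] = coeff_hom.minus[OF coeff_hom_ev] coeff_hom.diff[OF coeff_hom_ev]
  coeff_hom.power[OF coeff_hom_ev] coeff_hom.of_nat[OF coeff_hom_ev]
  coeff_hom.numeral[OF coeff_hom_ev]

lemma ev_sum: "ev (\<Sum>i\<in>A. f i) x = (\<Sum>i\<in>A. ev (f i) x)"
  by (rule coeff_hom.sum[OF coeff_hom_ev])

lemma ev_monom: "ev (monom a n) x = h a * x ^ n"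
  by (simp add: ev_def map_poly_monom poly_monom)

lemma ev_eq_sum: "degree p \<le> n \<Longrightarrow> ev p x = (\<Sum>i\<le>n. h (coeff p i) * x ^ i)"
  by (subst poly_as_sum_of_monoms'[symmetric]) (auto simp: ev_sum ev_monom)

lemma ev_pcompose: "ev (pcompose p q) x = ev p (ev q x)"
  by (induction p) (auto simp: pcompose_pCons)

end

lemma coeff_hom_poly: "coeff_hom (\<lambda>p::'a::idom poly. poly p x)"
  by unfold_locales auto

section \<open>Bivariate polynomials\<close>

text \<open>Gauss's lemma; the last hypothesis is primitivity of \<open>Q\<close>, as no
  \<open>x - a\<close> divides all its coefficients. Modulo a root \<open>a\<close> of
  \<open>d\<close> the product \<open>Q * H\<close> vanishes while \<open>Q\<close> does not, so
  \<open>x - a\<close> divides \<open>H\<close> and can be cancelled, which lowers the degree of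
  \<open>d\<close>.\<close>

lemma poly_poly_gauss:
  fixes P Q H :: "'k::alg_closed_field poly poly"
  assumes "d \<noteq> 0" "smult d P = Q * H"
    and "\<And>a. map_poly (\<lambda>p. poly p a) Q \<noteq> 0"
  shows "\<exists>H'. P = Q * H'"
  using assms(1,2)
proof (induction "degree d" arbitrary: d H rule: less_induct)
  case less
  show ?case
  proof (cases "degree d = 0")
    case True
    then obtain c where c: "d = [:c:]" "c \<noteq> 0"
      using less.prems(1) by (metis degree_eq_zeroE pCons_0_0)
    have "P = smult [:1 / c:] (smult d P)"
      using c by (simp flip: one_pCons)
    also have "\<dots> = Q * smult [:1 / c:] H"
      by (simp only: less.prems(2) mult_smult_right)
    finally show ?thesis by blast
  next
    case False
    then obtain a where a: "poly d a = 0"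
      using alg_closed_imp_poly_has_root by blast
    interpret a: coeff_hom "\<lambda>p::'k poly. poly p a" by (rule coeff_hom_poly)
    have "map_poly (\<lambda>p. poly p a) Q * map_poly (\<lambda>p. poly p a) H = 0"
      unfolding a.map_poly_mult[symmetric] less.prems(2)[symmetric]
      by (rule poly_eqI) (simp add: coeff_map_poly a)
    hence H0: "map_poly (\<lambda>p. poly p a) H = 0"
      using assms(3)[of a] by simp
    have div: "[:-a, 1:] dvd coeff H j" for j
      using arg_cong[OF H0, of "\<lambda>p. coeff p j"] by (simp add: coeff_map_poly poly_eq_0_iff_dvd)
    obtain d' where d': "d = [:-a, 1:] * d'"
      using a by (auto simp: poly_eq_0_iff_dvd)
    define H' where "H' = map_poly (\<lambda>p. p div [:-a, 1:]) H"
    have H': "H = smult [:-a, 1:] H'"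
      unfolding H'_def by (rule poly_eqI) (simp add: coeff_map_poly div del: mult_pCons_left)
    have "smult [:-a, 1:] (smult d' P) = smult [:-a, 1:] (Q * H')"
      using less.prems(2) unfolding d' H' by (simp only: smult_smult mult_smult_right)
    hence eq: "smult d' P = Q * H'"
      by (metis smult_cancel pCons_eq_0_iff one_neq_zero)
    have "d' \<noteq> 0"
      using d' less.prems(1) by auto
    moreover from this have "degree d' < degree d"
      unfolding d' by (subst degree_mult_eq) auto
    ultimately show ?thesis
      using less.hyps eq by blast
  qed
qed

lemma coeff_poly_const_eq:
  "coeff (poly Q [:c:]) i = poly (map_poly (\<lambda>p. coeff p i) Q) (c::'a::comm_ring_1)"
  by (induction Q) (auto simp: map_poly_pCons)

text \<open>Substituting a constant \<open>c\<close> for the outer variable: for almost all \<open>c\<close> the factor \<open>H\<close> does not vanish.\<close>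

lemma degree_coeff_left_factor:
  fixes Q H :: "'k::field_char_0 poly poly"
  assumes "H \<noteq> 0" and deg: "\<And>j. degree (coeff (Q * H) j) \<le> m"
  shows "degree (coeff Q j) \<le> m"
proof (rule degree_le, safe)
  fix i assume i: "i > m"
  \<comment> \<open>The coefficient of the \<open>i\<close>-th power of the inner variable in
    \<open>Q\<close>, read as a polynomial in the outer variable.\<close>
  define q where "q = map_poly (\<lambda>p. coeff p i) Q"
  have "poly q c = 0" if "poly H [:c:] \<noteq> 0" for c
  proof -
    have *: "degree (poly (Q * H) [:c:]) \<le> m"
    proof (rule degree_le, safe)
      fix i' assume "i' > m"
      hence "map_poly (\<lambda>p. coeff p i') (Q * H) = 0"
        by (intro poly_eqI) (simp add: coeff_map_poly coeff_eq_0 le_less_trans[OF deg])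
      thus "coeff (poly (Q * H) [:c:]) i' = 0"
        by (simp only: coeff_poly_const_eq poly_0)
    qed
    show ?thesis
    proof (cases "poly Q [:c:] = 0")
      case True
      thus ?thesis by (simp add: q_def flip: coeff_poly_const_eq)
    next
      case False
      have "degree (poly Q [:c:]) \<le> m"
        using * False that by (simp add: degree_mult_eq)
      thus ?thesis
        using i by (simp add: q_def coeff_eq_0 flip: coeff_poly_const_eq)
    qed
  qed
  hence sub: "UNIV - (\<lambda>c. [:c:]) -` {x. poly H x = 0} \<subseteq> {c. poly q c = 0}"
    by auto
  have "finite ((\<lambda>c::'k. [:c:]) -` {x. poly H x = 0})"
    using poly_roots_finite[OF assms(1)] by (rule finite_vimageI) (auto intro: injI)
  hence "infinite (UNIV - (\<lambda>c::'k. [:c:]) -` {x. poly H x = 0})"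
    by (simp add: Diff_infinite_finite infinite_UNIV_char_0)
  hence "q = 0"
    using sub poly_roots_finite finite_subset by blast
  hence "coeff q j = 0" by simp
  thus "coeff (coeff Q j) i = 0"
    by (simp add: q_def coeff_map_poly)
qed

locale const_field = coeff_hom \<iota> for \<iota> :: "'k::{alg_closed_field,field_char_0} \<Rightarrow> 'L::field"
begin

text \<open>The coefficients of \<open>G\<close> are polynomials in \<open>x\<close> and the outer
  variable takes the value \<open>u\<close>, so \<open>degree G\<close> is the degree in
  \<open>u\<close>.\<close>

definition ev2 :: "'k poly poly \<Rightarrow> 'L \<Rightarrow> 'L \<Rightarrow> 'L" where
  "ev2 G x = coeff_hom.ev (\<lambda>p. ev p x) G"

lemma ev2_0 [simp]: "ev2 0 x u = 0"
  by (simp add: ev2_def coeff_hom.ev_0[OF coeff_hom_ev])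

lemma ev2_pCons [simp]: "ev2 (pCons p G) x u = ev p x + u * ev2 G x u"
  by (simp add: ev2_def coeff_hom.ev_pCons[OF coeff_hom_ev])

lemma ev2_mult [simp]: "ev2 (G * H) x u = ev2 G x u * ev2 H x u"
  by (simp add: ev2_def coeff_hom.ev_mult[OF coeff_hom_ev])

lemma ev2_add [simp]: "ev2 (G + H) x u = ev2 G x u + ev2 H x u"
  by (simp add: ev2_def coeff_hom.ev_add[OF coeff_hom_ev])

lemma ev2_smult [simp]: "ev2 (smult p G) x u = ev p x * ev2 G x u"
  by (simp add: ev2_def coeff_hom.ev_smult[OF coeff_hom_ev])

lemma ev2_const_map [simp]: "ev2 (map_poly (\<lambda>c. [:c:]) q) x u = ev q u"
  by (induction q) (auto simp: map_poly_pCons)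

lemma \<iota>_eq_0_iff [simp]: "\<iota> c = 0 \<longleftrightarrow> c = 0"
proof
  assume "\<iota> c = 0"
  hence "\<iota> (c * inverse c) = 0" by (simp only: mult) simp
  thus "c = 0" by (cases "c = 0") auto
qed simp

lemma \<iota>_eq_iff [simp]: "\<iota> c = \<iota> d \<longleftrightarrow> c = d"
  using \<iota>_eq_0_iff[of "c - d"] by (simp del: \<iota>_eq_0_iff)

lemma \<iota>_inverse [simp]: "\<iota> (inverse c) = inverse (\<iota> c)"
proof (cases "c = 0")
  case False
  hence "inverse c * c = 1" by simp
  from arg_cong[OF this, of \<iota>] have "\<iota> (inverse c) * \<iota> c = 1" unfolding mult one .
  thus ?thesis by (metis inverse_unique mult.commute)
qed auto

lemma \<iota>_divide [simp]: "\<iota> (c / d) = \<iota> c / \<iota> d"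
  by (simp add: divide_inverse)

lemma two_neq_0: "(2::'L) \<noteq> 0"
  using \<iota>_eq_0_iff[of 2] by (simp del: \<iota>_eq_0_iff)

definition transc :: "'L \<Rightarrow> bool" where
  "transc x \<longleftrightarrow> (\<forall>p. ev p x = 0 \<longrightarrow> p = 0)"

lemma transc_eq_0_iff: "transc x \<Longrightarrow> ev p x = 0 \<longleftrightarrow> p = 0"
  by (auto simp: transc_def)

lemma transc_eq_iff: "transc x \<Longrightarrow> ev p x = ev q x \<longleftrightarrow> p = q"
  using transc_eq_0_iff[of x "p - q"] by simp

text \<open>Over an algebraically closed field a polynomial splits into linear factors, so any root
  of it in \<open>'L\<close> is already a constant.\<close>

lemma transc_iff: "transc z \<longleftrightarrow> z \<notin> range \<iota>"
proof
  assume "transc z"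
  thus "z \<notin> range \<iota>"
    using transc_eq_0_iff[of z "[:-c, 1:]" for c] by auto
next
  assume z: "z \<notin> range \<iota>"
  have "p = 0" if "ev p z = 0" for p
    using that
  proof (induction "degree p" arbitrary: p rule: less_induct)
    case less
    show ?case
    proof (cases "degree p = 0")
      case True
      then obtain c where "p = [:c:]" by (rule degree_eq_zeroE)
      thus ?thesis using less.prems by simp
    next
      case False
      then obtain a where "poly p a = 0"
        using alg_closed_imp_poly_has_root by blast
      then obtain q where q: "p = [:-a, 1:] * q"
        by (auto simp: poly_eq_0_iff_dvd elim!: dvdE simp del: mult_pCons_left)
      have "ev p z = (z - \<iota> a) * ev q z"
        unfolding q ev_mult by simp
      moreover have "z - \<iota> a \<noteq> 0" using z by auto
      ultimately have "ev q z = 0" using less.prems by simp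
      moreover have "q \<noteq> 0" using q False by auto
      hence "degree q < degree p" unfolding q by (subst degree_mult_eq) auto
      ultimately have "q = 0" using less.hyps by blast
      thus ?thesis by (simp add: q)
    qed
  qed
  thus "transc z" by (simp add: transc_def)
qed

lemma ex_swap_ev2:
  "\<exists>P. (\<forall>i j. coeff (coeff P j) i = coeff (coeff Q i) j) \<and> ev2 P x u = ev2 Q u x"
proof (induction Q)
  case 0
  show ?case by (rule exI[of _ 0]) simp
next
  case (pCons q Q)
  then obtain P where P: "coeff (coeff P j) i = coeff (coeff Q i) j" "ev2 P x u = ev2 Q u x" for i j
    by blast
  show ?case
    by (rule exI[of _ "map_poly (\<lambda>c. [:c:]) q + smult [:0, 1:] P"])
       (auto simp: coeff_map_poly coeff_pCons P split: nat.splits)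
qed

text \<open>A minimal polynomial of \<open>u\<close> over \<open>k(x)\<close> with denominators
  cleared. Minimising the degree of the leading coefficient as well takes the place of dividing by
  the content.\<close>

lemma ex_minimal_annihilator:
  assumes "A \<noteq> 0" "ev2 A x u = 0"
  obtains Q where "Q \<noteq> 0" "ev2 Q x u = 0" "degree Q \<le> degree A"
    "\<And>B. B \<noteq> 0 \<Longrightarrow> ev2 B x u = 0 \<Longrightarrow> degree Q \<le> degree B"
    "\<And>B. B \<noteq> 0 \<Longrightarrow> ev2 B x u = 0 \<Longrightarrow> degree Q = degree B \<Longrightarrow>
       degree (lead_coeff Q) \<le> degree (lead_coeff B)"
proof -
  define S where "S = {B. B \<noteq> 0 \<and> ev2 B x u = 0}"
  obtain Q0 where Q0: "Q0 \<in> S" "\<And>B. B \<in> S \<Longrightarrow> degree Q0 \<le> degree B"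
    using assms ex_has_least_nat[of "\<lambda>B. B \<in> S" A degree] by (auto simp: S_def)
  obtain Q where Q: "Q \<in> S" "degree Q = degree Q0"
    "\<And>B. B \<in> S \<Longrightarrow> degree B = degree Q0 \<Longrightarrow> degree (lead_coeff Q) \<le> degree (lead_coeff B)"
    using Q0 ex_has_least_nat[of "\<lambda>B. B \<in> S \<and> degree B = degree Q0" Q0 "\<lambda>B. degree (lead_coeff B)"]
    by blast
  show ?thesis
  proof (rule that[of Q])
    show "Q \<noteq> 0" "ev2 Q x u = 0" using Q(1) by (auto simp: S_def)
    show "degree Q \<le> degree A" using Q(2) Q0(2)[of A] assms by (simp add: S_def)
  next
    fix B assume "B \<noteq> 0" "ev2 B x u = 0"
    hence "B \<in> S" by (simp add: S_def)
    thus "degree Q \<le> degree B"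
      "degree Q = degree B \<Longrightarrow> degree (lead_coeff Q) \<le> degree (lead_coeff B)"
      using Q Q0 by auto
  qed
qed

lemma ex_bidegree_relation:
  assumes x: "transc x"
    and A: "A \<noteq> 0" "degree A \<le> n" "ev2 A x u = 0"
    and B: "B \<noteq> 0" "degree B \<le> m" "ev2 B u x = 0"
  obtains G where "G \<noteq> 0" "degree G \<le> n" "\<And>j. degree (coeff G j) \<le> m" "ev2 G x u = 0"
proof -
  \<comment> \<open>\<open>Q\<close> is primitive by minimality of the leading coefficient, so by Gauss's lemma it divides the relation \<open>P\<close> of
    degree at most \<open>m\<close> in \<open>x\<close>.\<close>
  obtain Q where Q: "Q \<noteq> 0" "ev2 Q x u = 0" "degree Q \<le> degree A"
    "\<And>B. B \<noteq> 0 \<Longrightarrow> ev2 B x u = 0 \<Longrightarrow> degree Q \<le> degree B"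
    "\<And>B. B \<noteq> 0 \<Longrightarrow> ev2 B x u = 0 \<Longrightarrow> degree Q = degree B \<Longrightarrow>
       degree (lead_coeff Q) \<le> degree (lead_coeff B)"
    using ex_minimal_annihilator[OF A(1,3)] by blast
  obtain P where P: "\<And>i j. coeff (coeff P j) i = coeff (coeff B i) j" "ev2 P x u = 0"
    using ex_swap_ev2[of B x u] B(3) by auto
  have P0: "P \<noteq> 0"
  proof
    assume "P = 0"
    hence "coeff (coeff B i) j = 0" for i j using P(1)[of j i] by simp
    hence "B = 0" by (intro poly_eqI) simp
    thus False using B(1) by simp
  qed
  have degP: "degree (coeff P j) \<le> m" for j
    by (rule degree_le) (use B(2) in \<open>auto simp: P(1) coeff_eq_0\<close>)
  have prim: "map_poly (\<lambda>p. poly p a) Q \<noteq> 0" for a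
  proof
    assume Q0: "map_poly (\<lambda>p. poly p a) Q = 0"
    have div: "[:-a, 1:] dvd coeff Q j" for j
      using arg_cong[OF Q0, of "\<lambda>p. coeff p j"] by (simp add: coeff_map_poly poly_eq_0_iff_dvd)
    define Q' where "Q' = map_poly (\<lambda>p. p div [:-a, 1:]) Q"
    have Q': "Q = smult [:-a, 1:] Q'"
      unfolding Q'_def by (rule poly_eqI) (simp add: coeff_map_poly div del: mult_pCons_left)
    have "Q' \<noteq> 0" using Q' Q(1) by auto
    moreover have "ev [:-a, 1:] x \<noteq> 0" using x by (subst transc_eq_0_iff) auto
    hence "ev2 Q' x u = 0" using Q(2) unfolding Q' ev2_smult by simp
    ultimately have "degree (lead_coeff Q) \<le> degree (lead_coeff Q')"
      by (intro Q(5)) (auto simp: Q')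
    moreover have "degree (lead_coeff Q) = Suc (degree (lead_coeff Q'))"
      using \<open>Q' \<noteq> 0\<close> unfolding Q' lead_coeff_smult by (subst degree_mult_eq) auto
    ultimately show False by simp
  qed
  \<comment> \<open>Pseudo-division divides over \<open>k(x)\<close> without leaving
    \<open>k[x][u]\<close>. The remainder also vanishes at \<open>(x, u)\<close>, so it is 0 by
    minimality of \<open>degree Q\<close>.\<close>
  obtain H R where HR: "pseudo_divmod P Q = (H, R)" by fastforce
  define d where "d = lead_coeff Q ^ (Suc (degree P) - degree Q)"
  have d: "d \<noteq> 0" using Q(1) by (simp add: d_def)
  have eq: "smult d P = Q * H + R" and R: "R = 0 \<or> degree R < degree Q"
    using pseudo_divmod[OF Q(1) HR] by (auto simp: d_def)
  have "ev2 (smult d P) x u = 0" by (simp add: P)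
  hence "ev2 R x u = 0" unfolding eq by (simp add: Q)
  hence "R = 0" using R Q(4)[of R] by fastforce
  then obtain H' where H': "P = Q * H'"
    using poly_poly_gauss[OF d _ prim, of P H] eq by auto
  show ?thesis
  proof (rule that[OF Q(1)])
    show "degree Q \<le> n" using Q(3) A(2) by simp
    show "degree (coeff Q j) \<le> m" for j
      by (rule degree_coeff_left_factor[of H']) (use H' P0 degP in auto)
  qed (fact Q(2))
qed

end

text \<open>A squarefree \<open>f\<close> cannot cancel a squared denominator: at a root of
  \<open>q\<close> the right-hand side has order at least 2 and \<open>f\<close> contributes at most
  1, so \<open>p\<close> vanishes there too and the linear factor can be removed from both.\<close>

lemma dvd_if_squares_eq_squarefree:
  fixes f :: "'k::alg_closed_field poly"
  assumes f: "rsquarefree f" and "p ^ 2 * f = D * q ^ 2" "q \<noteq> 0"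
  shows "q dvd p"
  using assms(2,3)
proof (induction "degree q" arbitrary: p q rule: less_induct)
  case less
  have f0: "f \<noteq> 0" using f by (auto simp: rsquarefree_def)
  show ?case
  proof (cases "degree q = 0 \<or> p = 0")
    case True
    thus ?thesis using less.prems(2) by (auto simp: is_unit_iff_degree intro: unit_imp_dvd)
  next
    case False
    hence p0: "p \<noteq> 0" and "degree q > 0" by auto
    then obtain a where a: "poly q a = 0"
      using alg_closed_imp_poly_has_root by blast
    have D0: "D \<noteq> 0" using less.prems f0 p0 by auto
    have "order a q \<noteq> 0" using a less.prems(2) by (simp add: order_root)
    have "order a f \<le> 1" using f unfolding rsquarefree_def by (metis le_numeral_extra(4) zero_le)
    have "2 * order a p + order a f = order a D + 2 * order a q"
      using arg_cong[OF less.prems(1), of "order a"] p0 f0 D0 less.prems(2)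
      by (simp add: order_mult power2_eq_square)
    hence "order a p \<noteq> 0"
      using \<open>order a q \<noteq> 0\<close> \<open>order a f \<le> 1\<close> by linarith
    hence "poly p a = 0" by (simp add: order_root)
    with a obtain p' q' where pq: "p = [:-a, 1:] * p'" "q = [:-a, 1:] * q'"
      by (auto simp: poly_eq_0_iff_dvd elim!: dvdE simp del: mult_pCons_left)
    have "q' \<noteq> 0" using pq less.prems(2) by auto
    have "[:-a, 1:] ^ 2 * (p' ^ 2 * f) = [:-a, 1:] ^ 2 * (D * q' ^ 2)"
      using less.prems(1) unfolding pq by (simp only: power_mult_distrib mult_ac)
    hence "p' ^ 2 * f = D * q' ^ 2"
      by (subst (asm) mult_cancel_left) simp
    moreover have "degree q' < degree q"
      using \<open>q' \<noteq> 0\<close> unfolding pq by (subst degree_mult_eq) auto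
    ultimately have "q' dvd p'" using less.hyps \<open>q' \<noteq> 0\<close> by blast
    thus ?thesis unfolding pq by (rule mult_dvd_mono[OF dvd_refl])
  qed
qed

lemma poly_eq_degree_le_1: "degree p \<le> 1 \<Longrightarrow> p = [:coeff p 0, coeff p 1:]"
  by (intro poly_eqI) (auto simp: coeff_pCons coeff_eq_0 split: nat.splits)

lemma poly_eq_degree_le_2: "degree p \<le> 2 \<Longrightarrow> p = [:coeff p 0, coeff p 1, coeff p 2:]"
  by (intro poly_eqI) (auto simp: coeff_pCons coeff_eq_0 numeral_2_eq_2 split: nat.splits)

lemma degree_discriminant_le:
  fixes c :: "nat \<Rightarrow> 'a::comm_ring_1 poly"
  assumes "\<And>j. degree (c j) \<le> m"
  shows "degree (c 1 ^ 2 - 4 * c 2 * c 0) \<le> 2 * m"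
proof (rule degree_diff_le)
  show "degree (c 1 ^ 2) \<le> 2 * m"
    using order.trans[OF degree_power_le[of "c 1" 2]] assms[of 1] by simp
  have "degree (c 2 * c 0) \<le> 2 * m"
    using degree_mult_le[of "c 2" "c 0"] assms[of 2] assms[of 0] by simp
  thus "degree (4 * c 2 * c 0) \<le> 2 * m"
    using degree_smult_le[of 4 "c 2 * c 0"] by (simp add: mult.assoc numeral_poly)
qed

context const_field
begin

section \<open>Intermediate fields\<close>

definition kfld :: "'L set \<Rightarrow> bool" where
  "kfld S \<longleftrightarrow> range \<iota> \<subseteq> S \<and> (\<forall>a\<in>S. \<forall>b\<in>S. a + b \<in> S \<and> a * b \<in> S) \<and> (\<forall>a\<in>S. inverse a \<in> S)"

text \<open>Zero denominators do no harm here: they only contribute the element \<open>0\<close>.\<close>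

definition kf :: "'L \<Rightarrow> 'L set" where
  "kf x = {ev p x / ev q x | p q. True}"

text \<open>The field \<open>S(d)\<close> once \<open>d ^ 2\<close> lies in \<open>S\<close>; every
  quadratic extension below is brought into this form by completing a square.\<close>

definition adj :: "'L set \<Rightarrow> 'L \<Rightarrow> 'L set" where
  "adj S d = {a + b * d | a b. a \<in> S \<and> b \<in> S}"

lemma kfld_const: "kfld S \<Longrightarrow> \<iota> c \<in> S"
  by (auto simp: kfld_def)

lemma kfld_add: "kfld S \<Longrightarrow> a \<in> S \<Longrightarrow> b \<in> S \<Longrightarrow> a + b \<in> S"
  and kfld_mult: "kfld S \<Longrightarrow> a \<in> S \<Longrightarrow> b \<in> S \<Longrightarrow> a * b \<in> S"
  and kfld_inverse: "kfld S \<Longrightarrow> a \<in> S \<Longrightarrow> inverse a \<in> S"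
  by (auto simp: kfld_def)

lemma kfld_0: "kfld S \<Longrightarrow> 0 \<in> S" and kfld_1: "kfld S \<Longrightarrow> 1 \<in> S"
  using kfld_const[of S 0] kfld_const[of S 1] by auto

lemma kfld_numeral: "kfld S \<Longrightarrow> numeral n \<in> S"
  using kfld_const[of S "numeral n"] by auto

lemma kfld_uminus: "kfld S \<Longrightarrow> a \<in> S \<Longrightarrow> - a \<in> S"
  using kfld_mult[of S "\<iota> (-1)" a] kfld_const[of S "-1"] by auto

lemma kfld_diff: "kfld S \<Longrightarrow> a \<in> S \<Longrightarrow> b \<in> S \<Longrightarrow> a - b \<in> S"
  using kfld_add[of S a "- b"] kfld_uminus[of S b] by auto

lemma kfld_divide: "kfld S \<Longrightarrow> a \<in> S \<Longrightarrow> b \<in> S \<Longrightarrow> a / b \<in> S"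
  unfolding divide_inverse by (intro kfld_mult kfld_inverse)

lemma kfld_power: "kfld S \<Longrightarrow> a \<in> S \<Longrightarrow> a ^ n \<in> S"
  by (induction n) (auto intro: kfld_1 kfld_mult)

lemma kfld_ev: "kfld S \<Longrightarrow> a \<in> S \<Longrightarrow> ev p a \<in> S"
  by (induction p) (auto intro: kfld_0 kfld_mult kfld_add kfld_const)

lemmas kfld_intros = kfld_const kfld_add kfld_mult kfld_inverse kfld_0 kfld_1 kfld_numeral
  kfld_uminus kfld_diff kfld_divide kfld_power kfld_ev

lemma kf_cases:
  assumes "w \<in> kf x"
  obtains p q where "w = ev p x / ev q x" "ev q x \<noteq> 0"
proof -
  from assms obtain p q where w: "w = ev p x / ev q x" by (auto simp: kf_def)
  show ?thesis
  proof (cases "ev q x = 0")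
    case True
    show ?thesis by (rule that[of 0 1]) (use w True in auto)
  qed (use w that in blast)
qed

lemma kfI: "ev p x / ev q x \<in> kf x"
  by (auto simp: kf_def)

lemma ev_in_kf: "ev p x \<in> kf x"
  using kfI[of p x 1] by simp

lemma in_kf: "x \<in> kf x"
  using ev_in_kf[of "[:0, 1:]" x] by simp

lemma kfld_kf: "kfld (kf x)"
  unfolding kfld_def
proof (intro conjI ballI)
  show "range \<iota> \<subseteq> kf x" using ev_in_kf[of "[:c:]" x for c] by auto
  fix a assume "a \<in> kf x"
  then obtain p q where a: "a = ev p x / ev q x" "ev q x \<noteq> 0" by (rule kf_cases)
  show "inverse a \<in> kf x" using kfI[of q x p] by (simp add: a)
  fix b assume "b \<in> kf x"
  then obtain r s where b: "b = ev r x / ev s x" "ev s x \<noteq> 0" by (rule kf_cases)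
  show "a + b \<in> kf x"
    using kfI[of "p * s + r * q" x "q * s"] a(2) b(2) unfolding a(1) b(1) by (simp add: add_frac_eq)
  show "a * b \<in> kf x"
    using kfI[of "p * r" x "q * s"] a b by simp
qed

lemma kf_subset: "kfld S \<Longrightarrow> x \<in> S \<Longrightarrow> kf x \<subseteq> S"
  by (auto elim!: kf_cases intro!: kfld_intros)

lemma adjI: "a \<in> S \<Longrightarrow> b \<in> S \<Longrightarrow> a + b * d \<in> adj S d"
  by (auto simp: adj_def)

lemma subset_adj: "kfld S \<Longrightarrow> S \<subseteq> adj S d"
  using adjI[of _ S 0 d] by (auto intro: kfld_0)

lemma in_adj: "kfld S \<Longrightarrow> d \<in> adj S d"
  using adjI[of 0 S 1 d] by (auto intro: kfld_0 kfld_1)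

lemma adj_subset: "kfld T \<Longrightarrow> S \<subseteq> T \<Longrightarrow> d \<in> T \<Longrightarrow> adj S d \<subseteq> T"
  by (auto simp: adj_def intro!: kfld_intros)

lemma kfld_adj:
  assumes S: "kfld S" and d: "d ^ 2 \<in> S"
  shows "kfld (adj S d)"
  unfolding kfld_def
proof (intro conjI ballI)
  show "range \<iota> \<subseteq> adj S d"
    using subset_adj[OF S] S by (auto simp: kfld_def)
  fix w assume "w \<in> adj S d"
  then obtain a b where w: "w = a + b * d" and ab: "a \<in> S" "b \<in> S" by (auto simp: adj_def)
  {
    fix z assume "z \<in> adj S d"
    then obtain a' b' where z: "z = a' + b' * d" and ab': "a' \<in> S" "b' \<in> S" by (auto simp: adj_def)
    have "w + z = (a + a') + (b + b') * d" by (simp add: w z algebra_simps)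
    also have "\<dots> \<in> adj S d" by (intro adjI kfld_add[OF S] ab ab')
    finally show "w + z \<in> adj S d" .
    have "w * z = (a * a' + b * b' * d ^ 2) + (a * b' + b * a') * d"
      by (simp add: w z algebra_simps power2_eq_square)
    also have "\<dots> \<in> adj S d" by (intro adjI kfld_add[OF S] kfld_mult[OF S] ab ab' d)
    finally show "w * z \<in> adj S d" .
  }
  define N where "N = a ^ 2 - b ^ 2 * d ^ 2"
  have N: "N \<in> S" unfolding N_def by (intro kfld_diff[OF S] kfld_mult[OF S] kfld_power[OF S] ab d)
  have eq: "w * (a - b * d) = N" by (simp add: w N_def algebra_simps power2_eq_square)
  show "inverse w \<in> adj S d"
  proof (cases "N = 0")
    case False
    have "inverse w = 1 / w"
      by (rule inverse_eq_divide)
    also have "1 / w = (a - b * d) / N"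
      using False unfolding eq[symmetric] by simp
    also have "\<dots> = a / N + (- b / N) * d"
      by (simp add: diff_divide_distrib)
    also have "\<dots> \<in> adj S d" by (intro adjI kfld_divide[OF S] kfld_uminus[OF S] ab N)
    finally show ?thesis .
  next
    \<comment> \<open>Since \<open>d\<close> may lie in \<open>S\<close>, the norm can vanish for
      nonzero \<open>w\<close>. Then \<open>a = b * d\<close>, and \<open>w = 2 * a\<close> lies in
      \<open>S\<close> anyway.\<close>
    case True
    hence "w = 0 \<or> w = 2 * a" using eq by (auto simp: w)
    hence "w \<in> S" using S ab by (auto intro!: kfld_intros)
    thus ?thesis using kfld_inverse[OF S] subset_adj[OF S] by blast
  qed
qed

text \<open>Kummer theory in degree 2: in the square of \<open>a + b * y\<close> the cross term
  \<open>2 * a * b * y\<close> must lie in \<open>S\<close>, so \<open>a\<close> or \<open>b\<close>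
  is 0.\<close>

lemma in_base_or_multiple_if_square_in_base:
  assumes S: "kfld S" and y: "y ^ 2 \<in> S" "y \<notin> S" and w: "w \<in> adj S y" "w ^ 2 \<in> S" "w \<notin> S"
  obtains s where "s \<in> S" "s \<noteq> 0" "w = s * y"
proof -
  from w(1) obtain a b where w': "w = a + b * y" and ab: "a \<in> S" "b \<in> S" by (auto simp: adj_def)
  have "b \<noteq> 0" using w(3) ab w' by auto
  have eq: "w ^ 2 - a ^ 2 - b ^ 2 * y ^ 2 = 2 * a * b * y"
    by (simp add: w' power2_eq_square algebra_simps)
  have "a = 0"
  proof (rule ccontr)
    assume "a \<noteq> 0"
    hence "y = (w ^ 2 - a ^ 2 - b ^ 2 * y ^ 2) / (2 * a * b)"
      unfolding eq using \<open>b \<noteq> 0\<close> two_neq_0 by simp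
    also have "\<dots> \<in> S" by (intro kfld_intros S w y ab)
    finally show False using y by simp
  qed
  thus ?thesis using that[of b] ab \<open>b \<noteq> 0\<close> w' by simp
qed

section \<open>Quadratic extensions of \<open>k(x)\<close>\<close>

lemma square_cofactor_poly:
  assumes x: "transc x" and f: "rsquarefree f" and s: "s \<in> kf x" "s ^ 2 * ev f x = ev D x"
  obtains p where "s = ev p x" "p ^ 2 * f = D"
proof -
  from s(1) obtain p q where pq: "s = ev p x / ev q x" "ev q x \<noteq> 0" by (rule kf_cases)
  have "ev (p ^ 2 * f) x = ev (D * q ^ 2) x"
    using s(2) pq by (simp add: field_simps)
  hence eq: "p ^ 2 * f = D * q ^ 2" using transc_eq_iff[OF x] by blast
  have q0: "q \<noteq> 0" using pq(2) by auto
  have "q dvd p" by (rule dvd_if_squares_eq_squarefree[OF f eq q0])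
  then obtain r where r: "p = q * r" by (rule dvdE)
  have "q ^ 2 * (r ^ 2 * f) = q ^ 2 * D"
    using eq unfolding r by (simp only: power_mult_distrib mult_ac)
  hence "r ^ 2 * f = D" using q0 by simp
  moreover have "s = ev r x" using pq by (simp add: r)
  ultimately show ?thesis by (rule that[rotated])
qed

text \<open>The argument is applied to \<open>1 / y\<close>, whose square times \<open>f\<close> is
  the polynomial 1: it would be a polynomial \<open>p\<close> with
  \<open>p ^ 2 * f = 1\<close>.\<close>

lemma sqrt_not_in_kf:
  assumes x: "transc x" and f: "rsquarefree f" "degree f > 0" and y: "y ^ 2 = ev f x"
  shows "y \<notin> kf x"
proof
  assume "y \<in> kf x"
  hence "inverse y \<in> kf x" by (rule kfld_inverse[OF kfld_kf])
  moreover have "f \<noteq> 0" using f(2) by auto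
  hence "ev f x \<noteq> 0" by (simp add: transc_eq_0_iff[OF x])
  hence "y \<noteq> 0" unfolding y[symmetric] by simp
  have "inverse y ^ 2 * ev f x = (inverse y * y) ^ 2"
    unfolding y[symmetric] by (rule power_mult_distrib[symmetric])
  hence "inverse y ^ 2 * ev f x = ev 1 x" using \<open>y \<noteq> 0\<close> by simp
  ultimately obtain p where p: "p ^ 2 * f = 1" by (rule square_cofactor_poly[OF x f(1)])
  hence "p \<noteq> 0" "f \<noteq> 0" by auto
  hence "degree (p ^ 2 * f) = 2 * degree p + degree f" by (simp add: degree_mult_eq degree_power_eq)
  thus False using p f(2) by simp
qed

text \<open>The degree equation is the substitute for genus: it is contradictory if
  \<open>degree D < degree f\<close>, and makes \<open>p\<close> constant if \<open>degree D\<close>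
  exceeds \<open>degree f\<close> by at most 1.\<close>

lemma multiple_of_sqrt_poly:
  assumes x: "transc x" and f: "rsquarefree f" "degree f > 0" and y: "y ^ 2 = ev f x"
    and w: "w \<in> adj (kf x) y" "w ^ 2 = ev D x" "w \<notin> kf x"
  obtains p where "p \<noteq> 0" "w = ev p x * y" "p ^ 2 * f = D" "2 * degree p + degree f = degree D"
proof -
  have sq: "y ^ 2 \<in> kf x" "w ^ 2 \<in> kf x" unfolding y w(2) by (rule ev_in_kf)+
  obtain s where s: "s \<in> kf x" "s \<noteq> 0" "w = s * y"
    by (rule in_base_or_multiple_if_square_in_base
          [OF kfld_kf sq(1) sqrt_not_in_kf[OF x f y] w(1) sq(2) w(3)])
  have "s ^ 2 * ev f x = ev D x"
    using w(2) unfolding s(3) by (simp add: power_mult_distrib y)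
  then obtain p where p: "s = ev p x" "p ^ 2 * f = D"
    by (rule square_cofactor_poly[OF x f(1) s(1)])
  have "p \<noteq> 0" using s(2) p(1) by auto
  moreover have "f \<noteq> 0" using f(2) by auto
  ultimately have deg: "2 * degree p + degree f = degree D"
    unfolding p(2)[symmetric] by (simp add: degree_mult_eq degree_power_eq)
  have "w = ev p x * y" using s(3) p(1) by simp
  thus ?thesis by (rule that[OF \<open>p \<noteq> 0\<close> _ p(2) deg])
qed

lemma kf_linear_annihilator:
  assumes "w \<in> kf x"
  obtains A where "A \<noteq> 0" "degree A \<le> 1" "ev2 A x w = 0"
proof -
  from assms obtain p q where pq: "w = ev p x / ev q x" "ev q x \<noteq> 0" by (rule kf_cases)
  show ?thesis
    by (rule that[of "[:-p, q:]"]) (use pq in auto)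
qed

lemma adj_kf_quadratic_annihilator:
  assumes y: "y ^ 2 = ev f x" and w: "w \<in> adj (kf x) y"
  obtains A where "A \<noteq> 0" "degree A \<le> 2" "ev2 A x w = 0"
proof -
  from w obtain a b where ab: "w = a + b * y" "a \<in> kf x" "b \<in> kf x" by (auto simp: adj_def)
  obtain p q where pq: "a = ev p x / ev q x" "ev q x \<noteq> 0" using ab(2) by (rule kf_cases)
  obtain r s where rs: "b = ev r x / ev s x" "ev s x \<noteq> 0" using ab(3) by (rule kf_cases)
  define D where "D = q * s"
  have D: "ev D x \<noteq> 0" using pq rs by (simp add: D_def)
  have eq: "ev D x * w - ev (p * s) x = ev (r * q) x * y"
    using pq(2) rs(2) unfolding ab(1) pq(1) rs(1) by (simp add: D_def field_simps)
  show ?thesis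
  \<comment> \<open>With \<open>T\<close> for the unknown, this is
    \<open>(D T - p s)^2 - (r q)^2 f\<close>, the square of the equation above with
    \<open>y ^ 2\<close> replaced by \<open>f\<close>.\<close>
  proof (rule that[of "[:(p * s) ^ 2 - (r * q) ^ 2 * f, - (2 * (p * s) * D), D ^ 2:]"])
    have "D \<noteq> 0" using D by auto
    thus "[:(p * s) ^ 2 - (r * q) ^ 2 * f, - (2 * (p * s) * D), D ^ 2:] \<noteq> 0" by simp
    have "ev2 [:(p * s) ^ 2 - (r * q) ^ 2 * f, - (2 * (p * s) * D), D ^ 2:] x w
        = (ev D x * w - ev (p * s) x) ^ 2 - ev (r * q) x ^ 2 * y ^ 2"
      using y by (simp add: power2_eq_square algebra_simps)
    also have "\<dots> = 0" unfolding eq by (simp add: power_mult_distrib)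
    finally show "ev2 [:(p * s) ^ 2 - (r * q) ^ 2 * f, - (2 * (p * s) * D), D ^ 2:] x w = 0" .
  qed simp
qed

text \<open>For \<open>G = c0 + c1 u + c2 u^2\<close> the element \<open>2 c2 u + c1\<close> is a
  square root of the discriminant that lies in \<open>k(x, y)\<close> but not in
  \<open>k(x)\<close>, hence a polynomial multiple of \<open>y\<close>.\<close>

lemma quadratic_discriminant:
  assumes x: "transc x" and f: "rsquarefree f" "degree f > 0" and y: "y ^ 2 = ev f x"
    and u: "u \<in> adj (kf x) y" "u \<notin> kf x"
    and G: "G \<noteq> 0" "degree G \<le> 2" "ev2 G x u = 0"
  obtains p where "p \<noteq> 0" "p ^ 2 * f = coeff G 1 ^ 2 - 4 * coeff G 2 * coeff G 0"
    "2 * degree p + degree f = degree (coeff G 1 ^ 2 - 4 * coeff G 2 * coeff G 0)"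
proof -
  define c where "c = coeff G"
  have Ge: "G = [:c 0, c 1, c 2:]" unfolding c_def by (rule poly_eq_degree_le_2) (fact G(2))
  have rel: "ev (c 0) x + u * (ev (c 1) x + u * ev (c 2) x) = 0"
    using G(3) unfolding Ge by simp
  note F = kfld_intros[OF kfld_kf[of x]] ev_in_kf
  have nz: "ev p x \<noteq> 0" if "p \<noteq> 0" for p
    using that transc_eq_0_iff[OF x] by blast
  have c2: "c 2 \<noteq> 0"
  proof
    assume c2: "c 2 = 0"
    have "c 1 \<noteq> 0"
    proof
      assume "c 1 = 0"
      with c2 rel have "ev (c 0) x = 0" by simp
      hence "c 0 = 0" using nz by blast
      thus False using G(1) Ge c2 \<open>c 1 = 0\<close> by simp
    qed
    hence "u = - ev (c 0) x / ev (c 1) x"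
      using rel c2 nz[of "c 1"] by (simp add: field_simps eq_neg_iff_add_eq_0)
    also have "\<dots> \<in> kf x" by (intro F)
    finally show False using u by simp
  qed
  define w where "w = 2 * ev (c 2) x * u + ev (c 1) x"
  have "w ^ 2 = ev (c 1 ^ 2 - 4 * c 2 * c 0) x
      + 4 * ev (c 2) x * (ev (c 0) x + u * (ev (c 1) x + u * ev (c 2) x))"
    by (simp add: w_def power2_eq_square algebra_simps)
  hence w2: "w ^ 2 = ev (c 1 ^ 2 - 4 * c 2 * c 0) x" using rel by simp
  have K: "kfld (adj (kf x) y)" by (rule kfld_adj[OF kfld_kf]) (simp add: y ev_in_kf)
  have sub: "ev p x \<in> adj (kf x) y" for p using subset_adj[OF kfld_kf] ev_in_kf by blast
  have w: "w \<in> adj (kf x) y"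
    unfolding w_def by (intro kfld_intros[OF K] sub u)
  have "w \<notin> kf x"
  proof
    assume "w \<in> kf x"
    have "u = (w - ev (c 1) x) / (2 * ev (c 2) x)"
      using nz[OF c2] two_neq_0 by (simp add: w_def field_simps)
    also have "\<dots> \<in> kf x" by (intro F \<open>w \<in> kf x\<close>)
    finally show False using u by simp
  qed
  then obtain p where "p \<noteq> 0" "p ^ 2 * f = c 1 ^ 2 - 4 * c 2 * c 0"
      "2 * degree p + degree f = degree (c 1 ^ 2 - 4 * c 2 * c 0)"
    by (rule multiple_of_sqrt_poly[OF x f y w w2])
  thus ?thesis unfolding c_def by (rule that)
qed

text \<open>An elliptic function field is not generated by one element, so \<open>u\<close> in \<open>k(x)\<close> forces \<open>k(u) = k(x)\<close>.\<close>

lemma rational_parameter: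
  assumes u: "transc u" and g: "rsquarefree g" "degree g \<ge> 3" and v: "v ^ 2 = ev g u"
    and x: "x \<in> adj (kf u) v" "u \<in> kf x"
  shows "x \<in> kf u"
proof (rule ccontr)
  assume nx: "x \<notin> kf u"
  obtain A where A: "A \<noteq> 0" "degree A \<le> 2" "ev2 A u x = 0"
    using adj_kf_quadratic_annihilator[OF v x(1)] .
  obtain B where B: "B \<noteq> 0" "degree B \<le> 1" "ev2 B x u = 0"
    using kf_linear_annihilator[OF x(2)] .
  obtain G where G: "G \<noteq> 0" "degree G \<le> 2" "\<And>j. degree (coeff G j) \<le> 1" "ev2 G u x = 0"
    using ex_bidegree_relation[OF u A B] by blast
  have "degree g > 0" using g(2) by simp
  then obtain p :: "'k poly"
    where p: "2 * degree p + degree g = degree (coeff G 1 ^ 2 - 4 * coeff G 2 * coeff G 0)"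
    by (rule quadratic_discriminant[OF u g(1) _ v x(1) nx G(1,2,4)])
  \<comment> \<open>The relation is quadratic in \<open>x\<close> but linear in \<open>u\<close>, so
    its discriminant has degree at most 2, below the degree of \<open>g\<close>.\<close>
  have "degree (coeff G 1 ^ 2 - 4 * coeff G 2 * coeff G 0) \<le> 2 * 1"
    by (rule degree_discriminant_le) (fact G(3))
  thus False using p g(2) by simp
qed

lemma bilinear_relation:
  assumes x: "transc x" and u: "transc u" and "x \<in> kf u" "u \<in> kf x"
  obtains a b c d where "\<iota> a + \<iota> b * x + \<iota> c * u + \<iota> d * x * u = 0" "a * d \<noteq> b * c"
proof -
  obtain A where A: "A \<noteq> 0" "degree A \<le> 1" "ev2 A x u = 0"
    using kf_linear_annihilator[OF assms(4)] .
  obtain B where B: "B \<noteq> 0" "degree B \<le> 1" "ev2 B u x = 0"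
    using kf_linear_annihilator[OF assms(3)] .
  obtain G where G: "G \<noteq> 0" "degree G \<le> 1" "\<And>j. degree (coeff G j) \<le> 1" "ev2 G x u = 0"
    using ex_bidegree_relation[OF x A B] by blast
  define e where "e i j = coeff (coeff G j) i" for i j
  have "coeff G j = [:e 0 j, e 1 j:]" for j
    unfolding e_def by (rule poly_eq_degree_le_1) (fact G(3))
  hence Ge: "G = [:[:e 0 0, e 1 0:], [:e 0 1, e 1 1:]:]"
    using poly_eq_degree_le_1[OF G(2)] by simp
  have rel: "\<iota> (e 0 0) + \<iota> (e 1 0) * x + \<iota> (e 0 1) * u + \<iota> (e 1 1) * x * u = 0"
    using G(4) unfolding Ge by (simp add: algebra_simps)
  have lin: "p = 0 \<and> q = 0" if "\<iota> p + \<iota> q * z = 0" "transc z" for p q z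
    using transc_eq_0_iff[OF that(2), of "[:p, q:]"] that(1) by (simp add: mult.commute)
  have "e 0 0 * e 1 1 \<noteq> e 1 0 * e 0 1"
  proof
    assume dep: "e 0 0 * e 1 1 = e 1 0 * e 0 1"
    \<comment> \<open>For vanishing determinant, \<open>e 1 1\<close> times the relation is a
      product of a linear form in \<open>x\<close> and one in \<open>u\<close>. One factor is 0, so
      by transcendence its coefficients are 0.\<close>
    have "(\<iota> (e 0 1) + \<iota> (e 1 1) * x) * (\<iota> (e 1 0) + \<iota> (e 1 1) * u)
        = \<iota> (e 1 0 * e 0 1) + \<iota> (e 1 1) * (\<iota> (e 1 0) * x + \<iota> (e 0 1) * u + \<iota> (e 1 1) * x * u)"
      by (simp add: algebra_simps)
    also have "\<dots> = \<iota> (e 1 0 * e 0 1 - e 0 0 * e 1 1) + \<iota> (e 1 1) *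
        (\<iota> (e 0 0) + \<iota> (e 1 0) * x + \<iota> (e 0 1) * u + \<iota> (e 1 1) * x * u)"
      by (simp add: algebra_simps)
    also have "\<dots> = \<iota> (e 1 0 * e 0 1 - e 0 0 * e 1 1)"
      unfolding rel by simp
    also have "\<dots> = 0" unfolding dep by simp
    finally have "\<iota> (e 0 1) + \<iota> (e 1 1) * x = 0 \<or> \<iota> (e 1 0) + \<iota> (e 1 1) * u = 0"
      by simp
    hence "(e 0 1 = 0 \<and> e 1 1 = 0) \<or> (e 1 0 = 0 \<and> e 1 1 = 0)"
      using lin[OF _ x, of "e 0 1" "e 1 1"] lin[OF _ u, of "e 1 0" "e 1 1"] by fast
    hence 0: "e 1 1 = 0" "e 0 1 = 0 \<or> e 1 0 = 0" by auto
    have "e 0 1 = 0 \<and> e 1 0 = 0 \<and> e 0 0 = 0"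
      using 0(2)
    proof
      assume z: "e 0 1 = 0"
      hence "\<iota> (e 0 0) + \<iota> (e 1 0) * x = 0" using rel 0(1) by simp
      thus ?thesis using z lin[OF _ x] by fast
    next
      assume z: "e 1 0 = 0"
      hence "\<iota> (e 0 0) + \<iota> (e 0 1) * u = 0" using rel 0(1) by simp
      thus ?thesis using z lin[OF _ u] by fast
    qed
    thus False using G(1) Ge 0(1) by simp
  qed
  thus ?thesis by (rule that[OF rel])
qed

end

section \<open>Invariants of binary quartics\<close>

text \<open>The classical invariants of a binary quartic form.  A cubic counts as a quartic with a root at infinity,
  and \<open>quartic_j\<close> is normalised so that it is the usual \<open>j\<close>-invariant.\<close>

definition quartic_I :: "'a::field poly \<Rightarrow> 'a" where
  "quartic_I p = 12 * coeff p 4 * coeff p 0 - 3 * coeff p 3 * coeff p 1 + coeff p 2 ^ 2"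

definition quartic_J :: "'a::field poly \<Rightarrow> 'a" where
  "quartic_J p = 72 * coeff p 4 * coeff p 2 * coeff p 0 + 9 * coeff p 3 * coeff p 2 * coeff p 1
     - 27 * coeff p 4 * coeff p 1 ^ 2 - 27 * coeff p 0 * coeff p 3 ^ 2 - 2 * coeff p 2 ^ 3"

text \<open>This is 27 times the usual discriminant. Since \<open>6912 = 4 * 1728\<close>, the value
  \<open>quartic_j\<close> below is \<open>1728 * 4 I^3 / (4 I^3 - J^2)\<close>.\<close>

definition quartic_disc :: "'a::field poly \<Rightarrow> 'a" where
  "quartic_disc p = 4 * quartic_I p ^ 3 - quartic_J p ^ 2"

definition quartic_j :: "'a::field poly \<Rightarrow> 'a" where
  "quartic_j p = 6912 * quartic_I p ^ 3 / quartic_disc p"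

lemma quartic_I_smult: "quartic_I (smult c p) = c ^ 2 * quartic_I p"
  by (simp add: quartic_I_def algebra_simps power2_eq_square)

lemma quartic_J_smult: "quartic_J (smult c p) = c ^ 3 * quartic_J p"
  by (simp add: quartic_J_def algebra_simps power2_eq_square power3_eq_cube)

lemma quartic_disc_scale:
  assumes "quartic_I p = c ^ 2 * quartic_I q" "quartic_J p = c ^ 3 * quartic_J q"
  shows "quartic_disc p = c ^ 6 * quartic_disc q"
  by (simp add: quartic_disc_def assms power_mult_distrib right_diff_distrib mult_ac flip: power_mult)

lemma quartic_j_scale:
  assumes "c \<noteq> 0" "quartic_I p = c ^ 2 * quartic_I q" "quartic_J p = c ^ 3 * quartic_J q"
  shows "quartic_j p = quartic_j q"
  using assms(1) unfolding quartic_j_def quartic_disc_scale[OF assms(2,3)] assms(2)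
  by (simp add: power_mult_distrib flip: power_mult)

lemma quartic_j_smult: "c \<noteq> 0 \<Longrightarrow> quartic_j (smult c p) = quartic_j p"
  by (rule quartic_j_scale) (auto simp: quartic_I_smult quartic_J_smult)

lemma quartic_disc_smult: "quartic_disc (smult c p) = c ^ 6 * quartic_disc p"
  by (rule quartic_disc_scale) (auto simp: quartic_I_smult quartic_J_smult)

lemma rsquarefree_cubic:
  fixes p :: "'a::field_char_0 poly"
  assumes "degree p = 3" "quartic_disc p \<noteq> 0"
  shows "rsquarefree p"
  unfolding rsquarefree_roots
proof (intro allI notI, elim conjE)
  fix r assume r: "poly p r = 0" "poly (pderiv p) r = 0"
  obtain e d c b where p: "p = [:e, d, c, b:]"
  proof
    show "p = [:coeff p 0, coeff p 1, coeff p 2, coeff p 3:]"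
      using assms(1) by (intro poly_eqI) (auto simp: coeff_pCons coeff_eq_0 numeral_2_eq_2 numeral_3_eq_3 split: nat.splits)
  qed
  \<comment> \<open>A double root \<open>r\<close> determines the two lowest coefficients from the
    other two; after substitution the discriminant vanishes identically.\<close>
  have d: "d = - (2 * c * r + 3 * b * r ^ 2)"
    using r(2) by (simp add: p pderiv_pCons eq_neg_iff_add_eq_0 algebra_simps power2_eq_square)
  have e: "e = - (d * r + c * r ^ 2 + b * r ^ 3)"
    using r(1) by (simp add: p eq_neg_iff_add_eq_0 algebra_simps power2_eq_square power3_eq_cube)
  have "quartic_disc p = 0"
    by (simp add: p e d quartic_disc_def quartic_I_def quartic_J_def eval_nat_numeral) Groebner_Basis.algebra
  thus False using assms(2) by simp
qed

text \<open>The discriminant of \<open>\<Sum> e i j x\<^sup>i u\<^sup>j\<close> (\<open>i, j \<le> 2\<close>) with respect to \<open>u\<close>; transposing \<open>e\<close> gives the one with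
  respect to \<open>x\<close>.\<close>

definition biquadratic_disc :: "(nat \<Rightarrow> nat \<Rightarrow> 'a::field) \<Rightarrow> 'a poly" where
  "biquadratic_disc e =
     [:e 0 1 ^ 2 - 4 * e 0 2 * e 0 0,
       2 * e 0 1 * e 1 1 - 4 * (e 0 2 * e 1 0 + e 1 2 * e 0 0),
       e 1 1 ^ 2 + 2 * e 0 1 * e 2 1 - 4 * (e 0 2 * e 2 0 + e 1 2 * e 1 0 + e 2 2 * e 0 0),
       2 * e 1 1 * e 2 1 - 4 * (e 1 2 * e 2 0 + e 2 2 * e 1 0),
       e 2 1 ^ 2 - 4 * e 2 2 * e 2 0:]"

text \<open>The two discriminants are the branch quartics of the two projections of one curve of
  bidegree (2, 2), so they must have the same j-invariant. In fact \<open>I\<close> and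
  \<open>J\<close> agree exactly, without a scaling factor.\<close>

lemma quartic_I_biquadratic_disc:
  "quartic_I (biquadratic_disc (\<lambda>i j. e j i)) = quartic_I (biquadratic_disc e)"
  by (simp add: biquadratic_disc_def quartic_I_def eval_nat_numeral) Groebner_Basis.algebra

lemma quartic_J_biquadratic_disc:
  "quartic_J (biquadratic_disc (\<lambda>i j. e j i)) = quartic_J (biquadratic_disc e)"
  by (simp add: biquadratic_disc_def quartic_J_def eval_nat_numeral) Groebner_Basis.algebra

text \<open>This is \<open>s^4 p(r / s)\<close>. The exponent is 4 even for a cubic
  \<open>p\<close>, so that its root at infinity can be moved to a finite point.\<close>

definition moebius_quartic :: "'a::field poly \<Rightarrow> 'a poly \<Rightarrow> 'a poly \<Rightarrow> 'a poly" where
  "moebius_quartic p r s = (\<Sum>i\<le>4. smult (coeff p i) (r ^ i * s ^ (4 - i)))"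

lemma quartic_I_moebius:
  "quartic_I (moebius_quartic p [:a, b:] [:c, d:]) = (b * c - a * d) ^ 4 * quartic_I p"
  by (simp add: moebius_quartic_def quartic_I_def eval_nat_numeral coeff_pCons) Groebner_Basis.algebra

lemma quartic_J_moebius:
  "quartic_J (moebius_quartic p [:a, b:] [:c, d:]) = (b * c - a * d) ^ 6 * quartic_J p"
  by (simp add: moebius_quartic_def quartic_J_def eval_nat_numeral coeff_pCons) Groebner_Basis.algebra

section \<open>The \<open>j\<close>-invariant of an elliptic function field\<close>

lemma degree_moebius_quartic_le:
  assumes "degree r \<le> 1" "degree s \<le> 1"
  shows "degree (moebius_quartic p r s) \<le> 4"
  unfolding moebius_quartic_def
proof (intro degree_sum_le)
  fix i :: nat assume i: "i \<in> {..4}"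
  have "degree (r ^ i * s ^ (4 - i)) \<le> degree r * i + degree s * (4 - i)"
    by (intro order.trans[OF degree_mult_le] add_mono degree_power_le)
  also have "\<dots> \<le> 1 * i + 1 * (4 - i)"
    by (intro add_mono mult_right_mono assms) auto
  finally have "degree (r ^ i * s ^ (4 - i)) \<le> 4" using i by simp
  thus "degree (smult (coeff p i) (r ^ i * s ^ (4 - i))) \<le> 4"
    using degree_smult_le order.trans by blast
qed auto

lemma quartic_j_moebius:
  fixes p :: "'a::field poly"
  assumes "a * d \<noteq> b * c"
  shows "quartic_j (moebius_quartic p [:-a, -b:] [:c, d:]) = quartic_j p"
  \<comment> \<open>\<open>I\<close> and \<open>J\<close> pick up the determinant to the powers 4
    and 6, so the scaling constant is its square.\<close>
  by (rule quartic_j_scale[of "(a * d - b * c) ^ 2"])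
     (use assms in \<open>auto simp: quartic_I_moebius quartic_J_moebius simp flip: power_mult\<close>)

context const_field
begin

text \<open>Here \<open>k(u) = k(x)\<close>, so \<open>u\<close> is a Moebius transform of
  \<open>x\<close> with some denominator \<open>q\<close>. Then \<open>v q^2\<close> is a square
  root of a transformed \<open>g\<close> of degree at most 4, which must be a constant multiple of
  \<open>f\<close>.\<close>

lemma quartic_j_eq_if_rational:
  assumes x: "transc x" and u: "transc u"
    and f: "degree f = 3" "quartic_disc f \<noteq> 0" and y: "y ^ 2 = ev f x"
    and g: "degree g = 3" "quartic_disc g \<noteq> 0" and v: "v ^ 2 = ev g u"
    and eq: "adj (kf u) v = adj (kf x) y" and ux: "u \<in> kf x"
  shows "quartic_j g = quartic_j f"
proof -
  have rf: "rsquarefree f" and rg: "rsquarefree g"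
    using f g by (auto intro: rsquarefree_cubic)
  have "x \<in> adj (kf u) v"
    unfolding eq using subset_adj[OF kfld_kf] in_kf by blast
  hence xu: "x \<in> kf u"
    using rational_parameter[OF u rg _ v _ ux] g(1) by simp
  have kf_eq: "kf u = kf x"
    using kf_subset[OF kfld_kf ux] kf_subset[OF kfld_kf xu] by blast
  obtain a b c d where rel: "\<iota> a + \<iota> b * x + \<iota> c * u + \<iota> d * x * u = 0" and det: "a * d \<noteq> b * c"
    using bilinear_relation[OF x u xu ux] .
  define q where "q = [:c, d:]"
  define D where "D = moebius_quartic g [:-a, -b:] q"
  have "q \<noteq> 0" using det by (auto simp: q_def)
  hence q: "ev q x \<noteq> 0" using transc_eq_0_iff[OF x] by blast
  have pu: "ev [:-a, -b:] x = u * ev q x"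
    using rel by (simp add: q_def algebra_simps eq_neg_iff_add_eq_0 neg_eq_iff_add_eq_0 minus_equation_iff)
  define w where "w = v * ev q x ^ 2"
  have "w ^ 2 = ev g u * ev q x ^ 4"
    by (simp add: w_def power_mult_distrib v flip: power_mult)
  also have "\<dots> = (\<Sum>i\<le>4. \<iota> (coeff g i) * u ^ i * (ev q x ^ i * ev q x ^ (4 - i)))"
    using g(1) by (subst ev_eq_sum[of g 4]) (auto simp: sum_distrib_right simp flip: power_add)
  also have "\<dots> = ev D x"
    unfolding D_def moebius_quartic_def ev_sum ev_smult ev_mult ev_hom pu
    by (simp add: power_mult_distrib mult_ac)
  finally have w2: "w ^ 2 = ev D x" .
  have v': "v \<in> adj (kf x) y" unfolding eq[symmetric] by (rule in_adj[OF kfld_kf])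
  have K: "kfld (adj (kf x) y)" by (rule kfld_adj[OF kfld_kf]) (simp add: y ev_in_kf)
  have sub: "ev p x \<in> adj (kf x) y" for p using subset_adj[OF kfld_kf] ev_in_kf by blast
  have w: "w \<in> adj (kf x) y"
    unfolding w_def by (intro kfld_intros[OF K] sub v')
  have nw: "w \<notin> kf x"
  proof
    assume "w \<in> kf x"
    have "v = w / ev q x ^ 2" using q by (simp add: w_def)
    also have "\<dots> \<in> kf x" by (intro kfld_intros[OF kfld_kf] in_kf \<open>w \<in> kf x\<close>)
    finally show False
      using sqrt_not_in_kf[OF u rg _ v] g(1) kf_eq by simp
  qed
  have "degree f > 0" using f by simp
  then obtain p where p: "p \<noteq> 0" "p ^ 2 * f = D" "2 * degree p + degree f = degree D"
    by (rule multiple_of_sqrt_poly[OF x rf _ y w w2 nw])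
  have "degree D \<le> 4"
    unfolding D_def by (rule degree_moebius_quartic_le) (auto simp: q_def)
  hence "degree p = 0" using p(3) f(1) by simp
  then obtain e where e: "p = [:e:]" by (rule degree_eq_zeroE)
  have "D = smult (e ^ 2) f" using p(2) by (simp add: e power2_eq_square)
  hence "quartic_j D = quartic_j f" using p(1) by (simp add: e quartic_j_smult)
  thus ?thesis unfolding D_def q_def using det by (simp add: quartic_j_moebius)
qed

theorem quartic_j_unique:
  assumes x: "transc x" and u: "transc u"
    and f: "degree f = 3" "quartic_disc f \<noteq> 0" and y: "y ^ 2 = ev f x"
    and g: "degree g = 3" "quartic_disc g \<noteq> 0" and v: "v ^ 2 = ev g u"
    and eq: "adj (kf u) v = adj (kf x) y"
  shows "quartic_j g = quartic_j f"
proof (cases "u \<in> kf x")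
  case True
  show ?thesis by (rule quartic_j_eq_if_rational[OF assms True])
next
  case ux: False
  have rf: "rsquarefree f" and rg: "rsquarefree g" and pos: "degree f > 0" "degree g > 0"
    using f g by (auto intro: rsquarefree_cubic)
  have x': "x \<in> adj (kf u) v"
    unfolding eq by (rule subsetD[OF subset_adj[OF kfld_kf] in_kf])
  have u': "u \<in> adj (kf x) y"
    unfolding eq[symmetric] by (rule subsetD[OF subset_adj[OF kfld_kf] in_kf])
  have xu: "x \<notin> kf u"
    using rational_parameter[OF x rf _ y u'] f(1) ux by auto
  obtain A where A: "A \<noteq> 0" "degree A \<le> 2" "ev2 A x u = 0"
    using adj_kf_quadratic_annihilator[OF y u'] .
  obtain B where B: "B \<noteq> 0" "degree B \<le> 2" "ev2 B u x = 0"
    using adj_kf_quadratic_annihilator[OF v x'] .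
  obtain G where G: "G \<noteq> 0" "degree G \<le> 2" "\<And>j. degree (coeff G j) \<le> 2" "ev2 G x u = 0"
    using ex_bidegree_relation[OF x A B] by blast
  define e where "e i j = coeff (coeff G j) i" for i j
  \<comment> \<open>The transpose is the same relation seen from \<open>u\<close>; its discriminant
    belongs to the projection onto the \<open>u\<close>-line.\<close>
  obtain H where H: "\<And>i j. coeff (coeff H j) i = e j i" "ev2 H u x = 0"
    using ex_swap_ev2[of G u x] G(4) by (auto simp: e_def)
  have H0: "H \<noteq> 0"
  proof
    assume "H = 0"
    hence "coeff (coeff G i) j = 0" for i j using H(1)[of j i] by (simp add: e_def)
    hence "G = 0" by (intro poly_eqI) simp
    thus False using G(1) by simp
  qed
  have degH: "degree H \<le> 2"
  proof (rule degree_le, safe)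
    fix i :: nat assume "i > 2"
    hence "coeff (coeff H i) j = 0" for j
      unfolding H(1) e_def using G(3)[of j] by (simp add: coeff_eq_0)
    thus "coeff H i = 0" by (intro poly_eqI) simp
  qed
  have degHj: "degree (coeff H j) \<le> 2" for j
    by (rule degree_le) (use G(2) in \<open>auto simp: H(1) e_def coeff_eq_0\<close>)
  have Gc: "coeff G j = [:e 0 j, e 1 j, e 2 j:]" for j
    unfolding e_def by (rule poly_eq_degree_le_2) (fact G(3))
  have Hc: "coeff H j = [:e j 0, e j 1, e j 2:]" for j
    unfolding H(1)[symmetric] by (rule poly_eq_degree_le_2) (fact degHj)
  define D where "D = biquadratic_disc e"
  define D' where "D' = biquadratic_disc (\<lambda>i j. e j i)"
  have D: "coeff G 1 ^ 2 - 4 * coeff G 2 * coeff G 0 = D"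
    unfolding Gc D_def biquadratic_disc_def by (simp add: power2_eq_square numeral_poly algebra_simps)
  have D': "coeff H 1 ^ 2 - 4 * coeff H 2 * coeff H 0 = D'"
    unfolding Hc D'_def biquadratic_disc_def by (simp add: power2_eq_square numeral_poly algebra_simps)
  obtain p where p: "p \<noteq> 0" "p ^ 2 * f = D" "2 * degree p + degree f = degree D"
    by (rule quadratic_discriminant[OF x rf pos(1) y u' ux G(1,2,4), unfolded D])
  obtain q where q: "q \<noteq> 0" "q ^ 2 * g = D'" "2 * degree q + degree g = degree D'"
    by (rule quadratic_discriminant[OF u rg pos(2) v x' xu H0 degH H(2), unfolded D'])
  \<comment> \<open>With cubics \<open>f\<close> and \<open>g\<close>, the degree equations leave
    only constants for \<open>p\<close> and \<open>q\<close>.\<close>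
  have "degree D \<le> 4" "degree D' \<le> 4"
    by (auto simp: D_def D'_def biquadratic_disc_def)
  hence "degree p = 0" "degree q = 0" using p(3) q(3) f(1) g(1) by auto
  then obtain c c' where c: "p = [:c:]" "q = [:c':]" by (auto elim!: degree_eq_zeroE)
  have "quartic_j D = quartic_j f" "quartic_j D' = quartic_j g"
    unfolding p(2)[symmetric] q(2)[symmetric] using p(1) q(1)
    by (simp_all add: c power2_eq_square quartic_j_smult)
  moreover have "quartic_j D = quartic_j D'"
    unfolding D_def D'_def quartic_j_def quartic_disc_def quartic_I_biquadratic_disc[of e]
      quartic_J_biquadratic_disc[of e] ..
  ultimately show ?thesis by simp
qed

end

section \<open>Involutions\<close>

locale involution = const_field \<iota> for \<iota> :: "'k::{alg_closed_field,field_char_0} \<Rightarrow> 'L::field" +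
  fixes F :: "'L set" and d :: 'L
  assumes F: "kfld F" and d2: "d ^ 2 \<in> F" and dF: "d \<notin> F"
begin

definition K :: "'L set" where
  "K = adj F d"

text \<open>Conjugation of \<open>K\<close> over \<open>F\<close>. It is well defined on
  \<open>K\<close> because \<open>d \<notin> F\<close> makes the representation
  \<open>a + b * d\<close> unique.\<close>

definition \<sigma> :: "'L \<Rightarrow> 'L" where
  "\<sigma> w = (SOME z. \<exists>a\<in>F. \<exists>b\<in>F. w = a + b * d \<and> z = a - b * d)"

lemma kfld_K: "kfld K"
  unfolding K_def by (rule kfld_adj[OF F d2])

lemma F_subset_K: "F \<subseteq> K"
  unfolding K_def by (rule subset_adj[OF F])

lemma K_unique:
  assumes "a \<in> F" "b \<in> F" "a' \<in> F" "b' \<in> F" "a + b * d = a' + b' * d"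
  shows "a = a'" "b = b'"
proof -
  show b: "b = b'"
  proof (rule ccontr)
    assume "b \<noteq> b'"
    hence "d = (a - a') / (b' - b)"
      using assms(5) by (simp add: field_simps)
    also have "\<dots> \<in> F" by (intro kfld_intros[OF F] assms)
    finally show False using dF by simp
  qed
  show "a = a'" using assms(5) b by simp
qed

lemma \<sigma>_eq:
  assumes "a \<in> F" "b \<in> F"
  shows "\<sigma> (a + b * d) = a - b * d"
  unfolding \<sigma>_def
proof (rule some_equality)
  show "\<exists>a'\<in>F. \<exists>b'\<in>F. a + b * d = a' + b' * d \<and> a - b * d = a' - b' * d"
    using assms by blast
next
  fix z assume "\<exists>a'\<in>F. \<exists>b'\<in>F. a + b * d = a' + b' * d \<and> z = a' - b' * d"
  thus "z = a - b * d" using K_unique assms by metis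
qed

lemma K_cases:
  assumes "w \<in> K"
  obtains a b where "a \<in> F" "b \<in> F" "w = a + b * d" "\<sigma> w = a - b * d"
  using assms \<sigma>_eq by (auto simp: K_def adj_def)

lemma \<sigma>_in_K: "w \<in> K \<Longrightarrow> \<sigma> w \<in> K"
  using adjI[of _ F "- b" d for b] by (elim K_cases) (auto simp: K_def intro!: kfld_uminus[OF F])

lemma \<sigma>_\<sigma>: "w \<in> K \<Longrightarrow> \<sigma> (\<sigma> w) = w"
proof (elim K_cases)
  fix a b assume ab: "a \<in> F" "b \<in> F" "w = a + b * d" "\<sigma> w = a - b * d"
  have "\<sigma> (a + (-b) * d) = a - (-b) * d"
    using ab by (intro \<sigma>_eq kfld_uminus[OF F])
  thus ?thesis using ab by simp
qed

lemma \<sigma>_F: "w \<in> F \<Longrightarrow> \<sigma> w = w"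
  using \<sigma>_eq[of w 0] kfld_0[OF F] by simp

lemma \<sigma>_fixed_iff: "w \<in> K \<Longrightarrow> \<sigma> w = w \<longleftrightarrow> w \<in> F"
proof (elim K_cases, rule iffI)
  fix a b assume ab: "a \<in> F" "b \<in> F" "w = a + b * d" "\<sigma> w = a - b * d"
  assume "\<sigma> w = w"
  hence "2 * (b * d) = 0" using ab by (simp add: algebra_simps)
  moreover have "d \<noteq> 0" using dF kfld_0[OF F] by auto
  ultimately have "b = 0" using two_neq_0 by simp
  thus "w \<in> F" using ab by simp
qed (rule \<sigma>_F)

lemma \<sigma>_add:
  assumes "w \<in> K" "z \<in> K"
  shows "\<sigma> (w + z) = \<sigma> w + \<sigma> z"
proof -
  obtain a b where ab: "a \<in> F" "b \<in> F" "w = a + b * d" "\<sigma> w = a - b * d"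
    using assms(1) by (rule K_cases)
  obtain a' b' where ab': "a' \<in> F" "b' \<in> F" "z = a' + b' * d" "\<sigma> z = a' - b' * d"
    using assms(2) by (rule K_cases)
  have "w + z = (a + a') + (b + b') * d"
    unfolding ab(3) ab'(3) by (simp add: algebra_simps)
  also have "\<sigma> \<dots> = (a + a') - (b + b') * d"
    by (intro \<sigma>_eq kfld_add[OF F] ab ab')
  also have "\<dots> = \<sigma> w + \<sigma> z"
    unfolding ab(4) ab'(4) by (simp add: algebra_simps)
  finally show ?thesis .
qed

lemma \<sigma>_mult:
  assumes "w \<in> K" "z \<in> K"
  shows "\<sigma> (w * z) = \<sigma> w * \<sigma> z"
proof -
  obtain a b where ab: "a \<in> F" "b \<in> F" "w = a + b * d" "\<sigma> w = a - b * d"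
    using assms(1) by (rule K_cases)
  obtain a' b' where ab': "a' \<in> F" "b' \<in> F" "z = a' + b' * d" "\<sigma> z = a' - b' * d"
    using assms(2) by (rule K_cases)
  have "w * z = (a * a' + b * b' * d ^ 2) + (a * b' + b * a') * d"
    unfolding ab(3) ab'(3) by (simp add: algebra_simps power2_eq_square)
  also have "\<sigma> \<dots> = (a * a' + b * b' * d ^ 2) - (a * b' + b * a') * d"
    by (intro \<sigma>_eq kfld_add[OF F] kfld_mult[OF F] ab ab' d2)
  also have "\<dots> = \<sigma> w * \<sigma> z"
    unfolding ab(4) ab'(4) by (simp add: algebra_simps power2_eq_square)
  finally show ?thesis .
qed

lemma \<sigma>_const: "\<sigma> (\<iota> c) = \<iota> c"
  by (intro \<sigma>_F kfld_const[OF F])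

lemma \<sigma>_0: "\<sigma> 0 = 0" and \<sigma>_1: "\<sigma> 1 = 1" and \<sigma>_numeral: "\<sigma> (numeral n) = numeral n"
  using \<sigma>_const[of 0] \<sigma>_const[of 1] \<sigma>_const[of "numeral n"] by simp_all

lemma \<sigma>_uminus: "w \<in> K \<Longrightarrow> \<sigma> (- w) = - \<sigma> w"
  using \<sigma>_mult[of "\<iota> (-1)" w] \<sigma>_const[of "-1"] kfld_const[OF kfld_K, of "-1"] by simp

lemma \<sigma>_diff: "w \<in> K \<Longrightarrow> z \<in> K \<Longrightarrow> \<sigma> (w - z) = \<sigma> w - \<sigma> z"
  using \<sigma>_add[of w "- z"] \<sigma>_uminus[of z] kfld_uminus[OF kfld_K, of z] by simp

lemma \<sigma>_power: "w \<in> K \<Longrightarrow> \<sigma> (w ^ n) = \<sigma> w ^ n"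
  by (induction n) (auto simp: \<sigma>_1 \<sigma>_mult kfld_power[OF kfld_K])

lemma \<sigma>_inverse:
  assumes "w \<in> K"
  shows "\<sigma> (inverse w) = inverse (\<sigma> w)"
proof (cases "w = 0")
  case False
  have "\<sigma> w * \<sigma> (inverse w) = \<sigma> (w * inverse w)"
    by (rule \<sigma>_mult[symmetric]) (use assms kfld_inverse[OF kfld_K] in auto)
  also have "w * inverse w = 1" using False by simp
  finally show ?thesis by (metis \<sigma>_1 inverse_unique)
qed (simp add: \<sigma>_0)

lemma \<sigma>_divide: "w \<in> K \<Longrightarrow> z \<in> K \<Longrightarrow> \<sigma> (w / z) = \<sigma> w / \<sigma> z"
  unfolding divide_inverse by (simp add: \<sigma>_mult \<sigma>_inverse kfld_inverse[OF kfld_K])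

lemma \<sigma>_ev: "w \<in> K \<Longrightarrow> \<sigma> (ev p w) = ev p (\<sigma> w)"
  by (induction p)
     (auto simp: \<sigma>_0 \<sigma>_add \<sigma>_mult \<sigma>_const kfld_const[OF kfld_K] kfld_mult[OF kfld_K] kfld_ev[OF kfld_K])

lemma \<sigma>_ev2:
  assumes "w \<in> K" "z \<in> K"
  shows "\<sigma> (ev2 G w z) = ev2 G (\<sigma> w) (\<sigma> z)"
proof -
  have "ev2 G w z \<in> K \<and> \<sigma> (ev2 G w z) = ev2 G (\<sigma> w) (\<sigma> z)"
    by (induction G)
       (auto simp: \<sigma>_0 \<sigma>_add \<sigma>_mult \<sigma>_ev assms kfld_mult[OF kfld_K] kfld_ev[OF kfld_K]
             intro!: kfld_0[OF kfld_K] kfld_add[OF kfld_K] kfld_mult[OF kfld_K] kfld_ev[OF kfld_K])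
  thus ?thesis ..
qed

lemma \<sigma>_kf: "w \<in> K \<Longrightarrow> z \<in> kf w \<Longrightarrow> \<sigma> z \<in> kf (\<sigma> w)"
  by (elim kf_cases) (auto simp: \<sigma>_divide \<sigma>_ev kfld_ev[OF kfld_K] intro!: kfI)

lemma \<sigma>_transc: "w \<in> K \<Longrightarrow> transc w \<Longrightarrow> transc (\<sigma> w)"
  unfolding transc_iff by (metis (no_types, lifting) \<sigma>_\<sigma> \<sigma>_const imageE rangeI)

lemmas \<sigma>_simps = \<sigma>_add \<sigma>_mult \<sigma>_const \<sigma>_0 \<sigma>_1 \<sigma>_numeral \<sigma>_uminus \<sigma>_diff \<sigma>_power \<sigma>_inverse \<sigma>_divide

text \<open>Recognises the fixed field without counting degrees: conjugation changes the sign of the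
  \<open>z\<close>-part, so a fixed \<open>a + b * z\<close> has \<open>b = 0\<close>.\<close>

lemma fixed_field_eq:
  assumes S: "kfld S" "S \<subseteq> F" and z: "z \<in> K" "\<sigma> z = - z" "z \<noteq> 0" "z ^ 2 \<in> S" and gen: "K \<subseteq> adj S z"
  shows "F = S"
proof
  show "F \<subseteq> S"
  proof
    fix w assume w: "w \<in> F"
    then obtain a b where ab: "a \<in> S" "b \<in> S" "w = a + b * z"
      using gen F_subset_K by (fastforce simp: adj_def)
    have abF: "a \<in> F" "b \<in> F" "a \<in> K" "b \<in> K" using ab S(2) F_subset_K by auto
    have "\<sigma> w = a - b * z"
      using abF z by (simp add: ab(3) \<sigma>_simps \<sigma>_F kfld_mult[OF kfld_K])
    hence "2 * (b * z) = 0" using \<sigma>_F[OF w] ab(3) by (simp add: algebra_simps)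
    hence "b = 0" using z(3) two_neq_0 by simp
    thus "w \<in> S" using ab by simp
  qed
qed (fact S(2))

end

text \<open>This is \<open>s^6 p(r / s)\<close>: a genus 2 curve has six branch points, one of them
  at infinity for a quintic.\<close>

definition moebius_sextic :: "'a::comm_ring_1 poly \<Rightarrow> 'a poly \<Rightarrow> 'a poly \<Rightarrow> 'a poly" where
  "moebius_sextic p r s = (\<Sum>i\<le>6. smult (coeff p i) (r ^ i * s ^ (6 - i)))"

lemma degree_moebius_sextic_le:
  assumes "degree r \<le> 1" "degree s \<le> 1"
  shows "degree (moebius_sextic p r s) \<le> 6"
  unfolding moebius_sextic_def
proof (intro degree_sum_le)
  fix i :: nat assume i: "i \<in> {..6}"
  have "degree (r ^ i * s ^ (6 - i)) \<le> degree r * i + degree s * (6 - i)"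
    by (intro order.trans[OF degree_mult_le] add_mono degree_power_le)
  also have "\<dots> \<le> 1 * i + 1 * (6 - i)"
    by (intro add_mono mult_right_mono assms) auto
  finally have "degree (r ^ i * s ^ (6 - i)) \<le> 6" using i by simp
  thus "degree (smult (coeff p i) (r ^ i * s ^ (6 - i))) \<le> 6"
    using degree_smult_le order.trans by blast
qed auto

section \<open>Involutions of a hyperelliptic field with elliptic fixed field\<close>

locale elliptic_involution = involution \<iota> F d
  for \<iota> :: "'k::{alg_closed_field,field_char_0} \<Rightarrow> 'L::field" and F d +
  fixes f :: "'k poly" and x y :: 'L and g :: "'k poly" and u v :: 'L
  assumes x: "transc x" and f: "rsquarefree f" "degree f \<ge> 5" "degree f \<le> 6"
    and y: "y ^ 2 = ev f x" and K_eq: "K = adj (kf x) y"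
    and u: "transc u" and g: "degree g = 3" "quartic_disc g \<noteq> 0"
    and v: "v ^ 2 = ev g u" and F_eq: "F = adj (kf u) v"
begin

lemma rg: "rsquarefree g"
  using g by (rule rsquarefree_cubic)

lemma x_in_K: "x \<in> K" and y_in_K: "y \<in> K" and kf_subset_K: "kf x \<subseteq> K"
  unfolding K_eq using subset_adj[OF kfld_kf] in_kf in_adj[OF kfld_kf] by auto

lemma y_notin: "y \<notin> kf x"
  using sqrt_not_in_kf[OF x f(1) _ y] f(2) by simp

lemma \<sigma>_x_in_kf: "\<sigma> x \<in> kf x"
proof (rule ccontr)
  assume nx: "\<sigma> x \<notin> kf x"
  have sx: "\<sigma> x \<in> adj (kf x) y"
    using \<sigma>_in_K[OF x_in_K] K_eq by simp
  obtain A where A: "A \<noteq> 0" "degree A \<le> 2" "ev2 A x (\<sigma> x) = 0"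
    using adj_kf_quadratic_annihilator[OF y sx] .
  \<comment> \<open>Applying \<open>\<sigma>\<close> exchanges the two arguments, so the single
    polynomial \<open>A\<close> supplies the degree bound for either variable.\<close>
  have "\<sigma> (ev2 A x (\<sigma> x)) = ev2 A (\<sigma> x) x"
    using \<sigma>_ev2[OF x_in_K \<sigma>_in_K[OF x_in_K]] \<sigma>_\<sigma>[OF x_in_K] by simp
  hence A': "ev2 A (\<sigma> x) x = 0" using A(3) by (simp add: \<sigma>_0)
  obtain G where G: "G \<noteq> 0" "degree G \<le> 2" "\<And>j. degree (coeff G j) \<le> 2" "ev2 G x (\<sigma> x) = 0"
    using ex_bidegree_relation[OF x A A(1,2) A'] by blast
  have "degree f > 0" using f(2) by simp
  then obtain p :: "'k poly"
    where p: "2 * degree p + degree f = degree (coeff G 1 ^ 2 - 4 * coeff G 2 * coeff G 0)"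
    by (rule quadratic_discriminant[OF x f(1) _ y sx nx G(1,2,4)])
  have "degree (coeff G 1 ^ 2 - 4 * coeff G 2 * coeff G 0) \<le> 2 * 2"
    by (rule degree_discriminant_le) (fact G(3))
  thus False using p f(2) by simp
qed

lemma x_in_kf_\<sigma>: "x \<in> kf (\<sigma> x)"
  using \<sigma>_kf[OF x_in_K \<sigma>_x_in_kf] \<sigma>_\<sigma>[OF x_in_K] by simp

lemma kf_\<sigma>_x: "kf (\<sigma> x) = kf x"
  using kf_subset[OF kfld_kf \<sigma>_x_in_kf] kf_subset[OF kfld_kf x_in_kf_\<sigma>] by blast

lemma d_in_K: "d \<in> K"
  unfolding K_def by (rule in_adj[OF F])

text \<open>Excludes the identity on the \<open>x\<close>-line: then \<open>\<sigma>\<close> would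
  be the hyperelliptic involution and \<open>F = k(x)\<close>, but an elliptic function field is not
  rational.\<close>

lemma \<sigma>_x_neq: "\<sigma> x \<noteq> x"
proof
  assume "\<sigma> x = x"
  hence xF: "x \<in> F" using \<sigma>_fixed_iff[OF x_in_K] by simp
  have kF: "kf x \<subseteq> F" by (rule kf_subset[OF F xF])
  have yF: "y \<notin> F"
  proof
    assume "y \<in> F"
    hence "K \<subseteq> F" unfolding K_eq by (rule adj_subset[OF F kF])
    thus False using d_in_K dF by blast
  qed
  have "\<sigma> y ^ 2 = \<sigma> (y ^ 2)" by (rule \<sigma>_power[OF y_in_K, symmetric])
  also have "\<dots> = y ^ 2" using \<sigma>_ev[OF x_in_K, of f] y \<open>\<sigma> x = x\<close> by simp
  finally have "\<sigma> y = y \<or> \<sigma> y = - y" by (simp add: power2_eq_iff)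
  hence sy: "\<sigma> y = - y" using yF \<sigma>_fixed_iff[OF y_in_K] by auto
  have Fk: "F = kf x"
  proof
    show "F \<subseteq> kf x"
    proof
      fix w assume w: "w \<in> F"
      hence "w \<in> adj (kf x) y" using F_subset_K K_eq by auto
      then obtain a b where ab: "a \<in> kf x" "b \<in> kf x" "w = a + b * y" by (auto simp: adj_def)
      have abF: "a \<in> F" "b \<in> F" using ab kF by auto
      hence abK: "a \<in> K" "b \<in> K" using F_subset_K by auto
      have "\<sigma> w = a - b * y"
        using abF abK y_in_K sy by (simp add: ab(3) \<sigma>_simps \<sigma>_F kfld_mult[OF kfld_K])
      hence "2 * (b * y) = 0" using \<sigma>_F[OF w] ab(3) by (simp add: algebra_simps)
      moreover have "y \<noteq> 0" using yF kfld_0[OF F] by auto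
      ultimately have "b = 0" using two_neq_0 by simp
      thus "w \<in> kf x" using ab by simp
    qed
  qed (fact kF)
  have "u \<in> F" "v \<in> F"
    unfolding F_eq using subset_adj[OF kfld_kf] in_kf in_adj[OF kfld_kf] by auto
  hence "x \<in> kf u"
    using rational_parameter[OF u rg _ v] g(1) xF Fk F_eq by simp
  hence "kf x \<subseteq> kf u" by (rule kf_subset[OF kfld_kf])
  hence "v \<in> kf u" using \<open>v \<in> F\<close> Fk by blast
  thus False using sqrt_not_in_kf[OF u rg _ v] g(1) by simp
qed

lemma \<sigma>_y_multiple:
  obtains q where "q \<in> kf x" "q \<noteq> 0" "\<sigma> y = q * y"
proof -
  have "\<sigma> y ^ 2 = ev f (\<sigma> x)"
    using \<sigma>_power[OF y_in_K, of 2] \<sigma>_ev[OF x_in_K, of f] y by simp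
  hence sq: "\<sigma> y ^ 2 \<in> kf x" using kfld_ev[OF kfld_kf \<sigma>_x_in_kf] by simp
  have sy: "\<sigma> y \<in> adj (kf x) y" using \<sigma>_in_K[OF y_in_K] K_eq by simp
  have nsy: "\<sigma> y \<notin> kf x"
  proof
    assume "\<sigma> y \<in> kf x"
    hence "\<sigma> (\<sigma> y) \<in> kf (\<sigma> x)" by (rule \<sigma>_kf[OF x_in_K])
    thus False using \<sigma>_\<sigma>[OF y_in_K] kf_\<sigma>_x y_notin by simp
  qed
  have y2: "y ^ 2 \<in> kf x" using y ev_in_kf by simp
  show ?thesis
    using in_base_or_multiple_if_square_in_base[OF kfld_kf y2 y_notin sy sq nsy] that by blast
qed

text \<open>A Moebius transformation of order 2 has trace 0, which leaves the shapes
  \<open>b - x\<close> and \<open>(a x + b) / (x - a)\<close>. That \<open>\<sigma>\<close> has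
  order 2 on \<open>y\<close> as well fixes the constant \<open>e\<close> up to sign.\<close>

lemma involution_cases:
  obtains (affine) b where "pcompose f [:b, -1:] = f"
  | (moebius) a b e where "a ^ 2 + b \<noteq> 0" "\<sigma> x = (\<iota> a * x + \<iota> b) / (x - \<iota> a)" "x - \<iota> a \<noteq> 0"
      "\<sigma> y = \<iota> e * y / (x - \<iota> a) ^ 3" "e ^ 2 = (a ^ 2 + b) ^ 3"
      "moebius_sextic f [:b, a:] [:-a, 1:] = smult (e ^ 2) f"
proof -
  have y0: "y \<noteq> 0" using y_notin kfld_0[OF kfld_kf] by auto
  have tsx: "transc (\<sigma> x)" by (rule \<sigma>_transc[OF x_in_K x])
  obtain \<alpha> \<beta> \<gamma> \<delta> where rel: "\<iota> \<alpha> + \<iota> \<beta> * x + \<iota> \<gamma> * \<sigma> x + \<iota> \<delta> * x * \<sigma> x = 0"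
    and det: "\<alpha> * \<delta> \<noteq> \<beta> * \<gamma>"
    using bilinear_relation[OF x tsx x_in_kf_\<sigma> \<sigma>_x_in_kf] .
  have "\<sigma> (\<iota> \<alpha> + \<iota> \<beta> * x + \<iota> \<gamma> * \<sigma> x + \<iota> \<delta> * x * \<sigma> x)
      = \<iota> \<alpha> + \<iota> \<beta> * \<sigma> x + \<iota> \<gamma> * x + \<iota> \<delta> * \<sigma> x * x"
    using x_in_K \<sigma>_in_K[OF x_in_K] \<sigma>_\<sigma>[OF x_in_K]
    by (simp add: \<sigma>_simps kfld_const[OF kfld_K] kfld_mult[OF kfld_K] kfld_add[OF kfld_K])
  hence rel': "\<iota> \<alpha> + \<iota> \<beta> * \<sigma> x + \<iota> \<gamma> * x + \<iota> \<delta> * \<sigma> x * x = 0" using rel by (simp add: \<sigma>_0)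
  \<comment> \<open>The difference of the relation and its conjugate; as \<open>\<sigma> x\<close>
    differs from \<open>x\<close>, the relation is symmetric.\<close>
  have "(\<iota> \<beta> - \<iota> \<gamma>) * (x - \<sigma> x) =
     (\<iota> \<alpha> + \<iota> \<beta> * x + \<iota> \<gamma> * \<sigma> x + \<iota> \<delta> * x * \<sigma> x) - (\<iota> \<alpha> + \<iota> \<beta> * \<sigma> x + \<iota> \<gamma> * x + \<iota> \<delta> * \<sigma> x * x)"
    by (simp add: algebra_simps)
  hence \<gamma>: "\<gamma> = \<beta>" using rel rel' \<sigma>_x_neq by simp
  obtain q where q: "q \<in> kf x" "q \<noteq> 0" "\<sigma> y = q * y" by (rule \<sigma>_y_multiple)
  have qK: "q \<in> K" using q(1) kf_subset_K by blast
  have "\<sigma> (\<sigma> y) = \<sigma> q * \<sigma> y"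
    using q(3) \<sigma>_mult[OF qK y_in_K] by simp
  hence "y = \<sigma> q * q * y" using \<sigma>_\<sigma>[OF y_in_K] q(3) by simp
  hence qq: "\<sigma> q * q = 1" using y0 by simp
  have "(q * y) ^ 2 = ev f (\<sigma> x)"
    using \<sigma>_power[OF y_in_K, of 2] \<sigma>_ev[OF x_in_K, of f] y q(3) by simp
  hence qf: "q ^ 2 * ev f x = ev f (\<sigma> x)" by (simp add: power_mult_distrib y)
  show ?thesis
  proof (cases "\<delta> = 0")
    case True
    define b where "b = - \<alpha> / \<beta>"
    have "\<beta> \<noteq> 0" using det True \<gamma> by auto
    hence sx: "\<sigma> x = ev [:b, -1:] x"
      using rel True \<gamma> by (simp add: b_def field_simps eq_neg_iff_add_eq_0)
    have "q ^ 2 * ev f x = ev (pcompose f [:b, -1:]) x"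
      unfolding qf ev_pcompose sx ..
    then obtain p where p: "q = ev p x" "p ^ 2 * f = pcompose f [:b, -1:]"
      by (rule square_cofactor_poly[OF x f(1) q(1)])
    have p0: "p \<noteq> 0" using p(1) q(2) by auto
    have f0: "f \<noteq> 0" using f(2) by auto
    have "2 * degree p + degree f = degree (p ^ 2 * f)"
      using p0 f0 by (simp add: degree_mult_eq degree_power_eq)
    also have "\<dots> = degree f" unfolding p(2) by (simp add: degree_pcompose)
    finally have "degree p = 0" by simp
    then obtain e where e: "p = [:e:]" by (rule degree_eq_zeroE)
    hence "q = \<iota> e" using p(1) by simp
    hence "\<iota> (e * e) = \<iota> 1" using qq \<sigma>_const by simp
    hence "e * e = 1" unfolding \<iota>_eq_iff .
    hence "pcompose f [:b, -1:] = f"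
      unfolding p(2)[symmetric] by (simp add: e power2_eq_square)
    thus ?thesis by (rule affine)
  next
    case False
    define a where "a = - \<beta> / \<delta>"
    define b where "b = - \<alpha> / \<delta>"
    have ab: "\<beta> = - (a * \<delta>)" "\<alpha> = - (b * \<delta>)" using False by (simp_all add: a_def b_def)
    have "\<delta> * \<delta> * (a ^ 2 + b) = \<beta> * \<gamma> - \<alpha> * \<delta>"
      unfolding \<gamma> ab by (simp add: power2_eq_square algebra_simps)
    hence "\<delta> * \<delta> * (a ^ 2 + b) \<noteq> 0"
      using det by simp
    hence \<Delta>: "a ^ 2 + b \<noteq> 0" by auto
    have "\<iota> \<delta> * ((x - \<iota> a) * \<sigma> x - (\<iota> a * x + \<iota> b)) = 0"
      using rel unfolding \<gamma> ab by (simp add: algebra_simps)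
    hence sx': "(x - \<iota> a) * \<sigma> x = \<iota> a * x + \<iota> b" using False by simp
    have xa: "x - \<iota> a \<noteq> 0" using x transc_iff by auto
    have sx: "\<sigma> x = (\<iota> a * x + \<iota> b) / (x - \<iota> a)" using sx' xa by (simp add: field_simps)
    define D where "D = moebius_sextic f [:b, a:] [:-a, 1:]"
    \<comment> \<open>Multiplying by \<open>(x - a)^3\<close> clears the denominator of
      \<open>f(\<sigma> x)\<close> under the square root. As \<open>2 deg p + deg f\<close> is at
      most 6 and \<open>deg f\<close> at least 5, the result is a constant.\<close>
    define s where "s = q * (x - \<iota> a) ^ 3"
    have xk: "x - \<iota> a \<in> kf x" by (intro kfld_intros[OF kfld_kf] in_kf)
    have sk: "s \<in> kf x" unfolding s_def by (intro kfld_mult[OF kfld_kf] kfld_power[OF kfld_kf] q xk)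
    have e1: "ev [:b, a:] x = \<sigma> x * ev [:-a, 1:] x" using sx' by (simp add: algebra_simps)
    have "s ^ 2 * ev f x = ev f (\<sigma> x) * ev [:-a, 1:] x ^ 6"
      unfolding qf[symmetric] by (simp add: s_def power_mult_distrib flip: power_mult)
    also have "\<dots> = (\<Sum>i\<le>6. \<iota> (coeff f i) * \<sigma> x ^ i * (ev [:-a, 1:] x ^ i * ev [:-a, 1:] x ^ (6 - i)))"
      by (subst ev_eq_sum[OF f(3)]) (auto simp: sum_distrib_right simp del: ev_pCons simp flip: power_add)
    also have "\<dots> = ev D x"
      unfolding D_def moebius_sextic_def ev_sum ev_smult ev_mult ev_hom e1
      by (simp add: power_mult_distrib mult_ac)
    finally obtain p where p: "s = ev p x" "p ^ 2 * f = D"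
      by (rule square_cofactor_poly[OF x f(1) sk])
    have p0: "p \<noteq> 0" using p(1) q(2) xa by (auto simp: s_def)
    have f0: "f \<noteq> 0" using f(2) by auto
    have "2 * degree p + degree f = degree (p ^ 2 * f)"
      using p0 f0 by (simp add: degree_mult_eq degree_power_eq)
    also have "\<dots> \<le> 6" unfolding p(2) D_def by (rule degree_moebius_sextic_le) auto
    finally have "degree p = 0" using f(2) by simp
    then obtain e where e: "p = [:e:]" by (rule degree_eq_zeroE)
    have D: "D = smult (e ^ 2) f" using p(2) by (simp add: e power2_eq_square)
    have qe: "q = \<iota> e / (x - \<iota> a) ^ 3" using p(1) xa by (simp add: e s_def field_simps)
    \<comment> \<open>The norm of \<open>x - a\<close>; it turns \<open>\<sigma> q * q = 1\<close>
      into the equation for \<open>e ^ 2\<close>.\<close>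
    have prod: "(x - \<iota> a) * (\<sigma> x - \<iota> a) = \<iota> (a ^ 2 + b)"
      using sx' by (simp add: algebra_simps power2_eq_square)
    have "\<sigma> q = \<iota> e / (\<sigma> x - \<iota> a) ^ 3"
      unfolding qe using x_in_K
      by (simp add: \<sigma>_simps kfld_const[OF kfld_K] kfld_diff[OF kfld_K] kfld_power[OF kfld_K])
    hence "\<sigma> q * q = \<iota> (e ^ 2) / \<iota> (a ^ 2 + b) ^ 3"
      unfolding qe prod[symmetric] by (simp add: power_mult_distrib power2_eq_square mult.commute)
    moreover have "\<iota> (a ^ 2 + b) ^ 3 \<noteq> 0" using \<Delta> by (simp del: add power)
    ultimately have "\<iota> (e ^ 2) = \<iota> (a ^ 2 + b) ^ 3" using qq by simp
    hence "\<iota> (e ^ 2) = \<iota> ((a ^ 2 + b) ^ 3)" by (simp only: power)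
    hence e2: "e ^ 2 = (a ^ 2 + b) ^ 3" unfolding \<iota>_eq_iff .
    show ?thesis
      by (rule moebius[OF \<Delta> sx xa _ e2 D[unfolded D_def]]) (simp add: q(3) qe)
  qed
qed

end

context const_field
begin

lemma kf_eqI:
  assumes "z \<in> kf w" "w \<in> kf z"
  shows "kf z = kf w"
  using kf_subset[OF kfld_kf assms(1)] kf_subset[OF kfld_kf assms(2)] by blast

lemma transc_in_kf:
  assumes "transc x" "x \<in> kf z"
  shows "transc z"
  unfolding transc_iff
proof
  assume "z \<in> range \<iota>"
  hence "kf z \<subseteq> range \<iota>"
    by (intro kf_subset) (auto simp: kfld_def simp flip: add mult \<iota>_inverse)
  thus False using assms transc_iff by blast
qed

end

section \<open>Coordinates adapted to the involution\<close>

text \<open>The fixed points \<open>\<gamma>\<close> and \<open>-\<gamma>\<close> of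
  \<open>\<gamma>^2 / x\<close> are moved to 0 and infinity, where the involution is a sign change.
  The scalar \<open>\<epsilon>\<close> absorbs the factor \<open>\<gamma>^3\<close> that appears in
  the equation for \<open>w ^ 2\<close>.\<close>

locale flipped_coordinates = const_field \<iota>
  for \<iota> :: "'k::{alg_closed_field,field_char_0} \<Rightarrow> 'L::field" +
  fixes x y :: 'L and \<gamma> \<epsilon> :: 'k
  assumes x: "transc x" and \<gamma>: "\<gamma> \<noteq> 0" and \<epsilon>: "\<epsilon> ^ 2 = \<gamma> ^ 3"
begin

definition z :: 'L where
  "z = (x - \<iota> \<gamma>) / (x + \<iota> \<gamma>)"

definition w :: 'L where
  "w = y * (1 - z) ^ 3 / \<iota> \<epsilon>"

lemma denom: "x + \<iota> \<gamma> \<noteq> 0"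
proof
  assume "x + \<iota> \<gamma> = 0"
  hence "x = \<iota> (- \<gamma>)" by (simp add: eq_neg_iff_add_eq_0)
  thus False using x transc_iff by blast
qed

lemma \<epsilon>0: "\<epsilon> \<noteq> 0"
  using \<gamma> \<epsilon> by auto

lemma one_minus_z: "1 - z = 2 * \<iota> \<gamma> / (x + \<iota> \<gamma>)" and one_plus_z: "1 + z = 2 * x / (x + \<iota> \<gamma>)"
  using denom by (simp_all add: z_def field_simps)

lemma one_minus_z_neq_0: "1 - z \<noteq> 0"
  unfolding one_minus_z using denom \<gamma> two_neq_0 by simp

lemma x_eq: "x = \<iota> \<gamma> * (1 + z) / (1 - z)"
  unfolding one_minus_z one_plus_z using denom \<gamma> two_neq_0 by simp

lemma y_eq: "y = w * \<iota> \<epsilon> / (1 - z) ^ 3"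
  using one_minus_z_neq_0 \<epsilon>0 by (simp add: w_def)

lemma z_in_kf: "z \<in> kf x"
  unfolding z_def by (intro kfld_intros[OF kfld_kf] in_kf)

lemma x_in_kf: "x \<in> kf z"
  by (subst x_eq) (intro kfld_intros[OF kfld_kf] in_kf)

lemma transc_z: "transc z"
  by (rule transc_in_kf[OF x x_in_kf])

lemma z_neq_0: "z \<noteq> 0"
  using transc_z transc_eq_0_iff[of z "[:0, 1:]"] by auto

lemma transc_z2: "transc (z ^ 2)"
  unfolding transc_def
proof (intro allI impI)
  fix p assume "ev p (z ^ 2) = 0"
  hence "ev (pcompose p [:0, 0, 1:]) z = 0"
    by (simp add: ev_pcompose power2_eq_square)
  hence "pcompose p [:0, 0, 1:] = 0"
    using transc_eq_0_iff[OF transc_z] by blast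
  thus "p = 0" by (simp add: pcompose_eq_0_iff)
qed

lemma adj_kf_subset:
  assumes T: "kfld T" "z \<in> T" "w \<in> T"
  shows "adj (kf x) y \<subseteq> T"
proof (rule adj_subset[OF T(1)])
  have "x \<in> T" by (subst x_eq) (intro kfld_intros[OF T(1)] T)
  thus "kf x \<subseteq> T" by (rule kf_subset[OF T(1)])
  show "y \<in> T" by (subst y_eq) (intro kfld_intros[OF T(1)] T)
qed

lemma w2_eqI:
  assumes "y ^ 2 * (1 - z) ^ 6 = \<iota> (\<gamma> ^ 3) * c"
  shows "w ^ 2 = c"
proof -
  have "w ^ 2 = y ^ 2 * (1 - z) ^ 6 / \<iota> (\<epsilon> ^ 2)"
    by (simp add: w_def power_divide power_mult_distrib flip: power_mult)
  thus ?thesis unfolding assms \<epsilon> using \<gamma> by simp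
qed

end

text \<open>With \<open>\<beta> = \<gamma>\<^sup>2\<close> and \<open>\<delta> = \<gamma>\<^sup>3\<close>, these are the cubics \<open>h\<close> with \<open>w\<^sup>2 = h(z\<^sup>2)\<close>, see \<open>w2_quintic\<close> and \<open>w2_sextic\<close>.\<close>

definition quintic_quotient :: "'a::comm_ring_1 \<Rightarrow> 'a poly" where
  "quintic_quotient \<beta> = [:2 * \<beta> + 1, 10 * \<beta> - 3, 3 - 10 * \<beta>, - (2 * \<beta> + 1):]"

definition sextic_quotient :: "'a::comm_ring_1 \<Rightarrow> 'a poly" where
  "sextic_quotient \<delta> = [:2 * \<delta> + 1, 30 * \<delta> - 3, 30 * \<delta> + 3, 2 * \<delta> - 1:]"

lemma quintic_eq: "quintic t = [:0, t, 0, 1, 0, 1:]"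
  by (simp add: quintic_def monom_altdef numeral_eq_Suc)

lemma sextic_eq: "sextic t = [:t, 0, 0, 1, 0, 0, 1:]"
  by (simp add: sextic_def monom_altdef numeral_eq_Suc)

context flipped_coordinates
begin

text \<open>In terms of \<open>1 + z\<close> and \<open>1 - z\<close> the equation becomes
  symmetric, precisely because \<open>t = \<gamma>^4\<close>. Exchanging the two is the sign change
  of \<open>z\<close>, so only even powers of \<open>z\<close> survive.\<close>

lemma w2_quintic:
  assumes "y ^ 2 = ev (quintic (\<gamma> ^ 4)) x"
  shows "w ^ 2 = ev (quintic_quotient (\<gamma> ^ 2)) (z ^ 2)"
proof (rule w2_eqI)
  define r s where "r = 1 + z" and "s = 1 - z"
  have s: "s \<noteq> 0" using one_minus_z_neq_0 by (simp add: s_def)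
  have xs: "x * s = \<iota> \<gamma> * r" using x_eq s by (simp add: r_def s_def field_simps)
  have "y ^ 2 * s ^ 6 = (x * s) ^ 5 * s + (x * s) ^ 3 * s ^ 3 + \<iota> \<gamma> ^ 4 * (x * s) * s ^ 5"
    unfolding assms quintic_eq by (simp add: algebra_simps eval_nat_numeral)
  also have "\<dots> = \<iota> \<gamma> ^ 3 * (r * s * (\<iota> \<gamma> ^ 2 * (r ^ 4 + s ^ 4) + r ^ 2 * s ^ 2))"
    unfolding xs by (simp add: algebra_simps eval_nat_numeral)
  also have "r * s * (\<iota> \<gamma> ^ 2 * (r ^ 4 + s ^ 4) + r ^ 2 * s ^ 2)
      = ev (quintic_quotient (\<gamma> ^ 2)) (z ^ 2)"
    unfolding quintic_quotient_def r_def s_def by simp Groebner_Basis.algebra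
  finally show "y ^ 2 * (1 - z) ^ 6 = \<iota> (\<gamma> ^ 3) * ev (quintic_quotient (\<gamma> ^ 2)) (z ^ 2)"
    by (simp add: s_def)
qed

lemma w2_sextic:
  assumes "y ^ 2 = ev (sextic (\<gamma> ^ 6)) x"
  shows "w ^ 2 = ev (sextic_quotient (\<gamma> ^ 3)) (z ^ 2)"
proof (rule w2_eqI)
  define r s where "r = 1 + z" and "s = 1 - z"
  have s: "s \<noteq> 0" using one_minus_z_neq_0 by (simp add: s_def)
  have xs: "x * s = \<iota> \<gamma> * r" using x_eq s by (simp add: r_def s_def field_simps)
  have "y ^ 2 * s ^ 6 = (x * s) ^ 6 + (x * s) ^ 3 * s ^ 3 + \<iota> \<gamma> ^ 6 * s ^ 6"
    unfolding assms sextic_eq by (simp add: algebra_simps eval_nat_numeral)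
  also have "\<dots> = \<iota> \<gamma> ^ 3 * (\<iota> \<gamma> ^ 3 * (r ^ 6 + s ^ 6) + r ^ 3 * s ^ 3)"
    unfolding xs by (simp add: algebra_simps eval_nat_numeral)
  also have "\<iota> \<gamma> ^ 3 * (r ^ 6 + s ^ 6) + r ^ 3 * s ^ 3
      = ev (sextic_quotient (\<gamma> ^ 3)) (z ^ 2)"
    unfolding sextic_quotient_def r_def s_def by simp Groebner_Basis.algebra
  finally show "y ^ 2 * (1 - z) ^ 6 = \<iota> (\<gamma> ^ 3) * ev (sextic_quotient (\<gamma> ^ 3)) (z ^ 2)"
    by (simp add: s_def)
qed

end

text \<open>For \<open>\<beta>^2 = t\<close> the discriminant vanishes only at \<open>t = 0\<close>
  and \<open>t = 1/4\<close>; the same holds for the sextic with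
  \<open>\<delta>^2 = t\<close>.\<close>

lemma quintic_quotient_invariants:
  fixes \<beta> :: "'a::field"
  shows "quartic_I (quintic_quotient \<beta>) = 16 * \<beta> * (10 * \<beta> - 3)"
    and "quartic_disc (quintic_quotient \<beta>) = 442368 * \<beta> ^ 3 * (2 * \<beta> - 1) * (2 * \<beta> + 1) ^ 2"
  by (simp_all add: quartic_disc_def quartic_I_def quartic_J_def quintic_quotient_def eval_nat_numeral)
     Groebner_Basis.algebra+

lemma sextic_quotient_invariants:
  fixes \<delta> :: "'a::field"
  shows "quartic_I (sextic_quotient \<delta>) = 144 * \<delta> * (5 * \<delta> + 2)"
    and "quartic_disc (sextic_quotient \<delta>) = 2985984 * \<delta> ^ 2 * (2 * \<delta> - 1) ^ 3 * (2 * \<delta> + 1)"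
  by (simp_all add: quartic_disc_def quartic_I_def quartic_J_def sextic_quotient_def eval_nat_numeral)
     Groebner_Basis.algebra+

context elliptic_involution
begin

text \<open>The two cases are \<open>\<sigma> w = w\<close> and \<open>\<sigma> w = - w\<close>.\<close>

lemma quartic_j_cases:
  assumes \<gamma>: "\<gamma> \<noteq> 0" and sx: "\<sigma> x = \<iota> (\<gamma> ^ 2) / x"
    and sy: "\<sigma> y = \<iota> e * y / x ^ 3" and e: "e ^ 2 = \<gamma> ^ 6"
    and fl: "flipped_coordinates \<iota> x \<gamma> \<epsilon>"
    and w2: "flipped_coordinates.w \<iota> x y \<gamma> \<epsilon> ^ 2 = ev [:a, b, c, d':] (flipped_coordinates.z \<iota> x \<gamma> ^ 2)"
    and h: "a \<noteq> 0" "d' \<noteq> 0" "quartic_disc [:a, b, c, d':] \<noteq> 0" "quartic_disc [:d', c, b, a:] \<noteq> 0"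
  shows "quartic_j g = quartic_j [:a, b, c, d':] \<or> quartic_j g = quartic_j [:d', c, b, a:]"
proof -
  interpret flipped_coordinates \<iota> x y \<gamma> \<epsilon> by (rule fl)
  have zK: "z \<in> K" using z_in_kf kf_subset_K by blast
  have x0: "x \<noteq> 0" using x transc_eq_0_iff[of x "[:0, 1:]"] by auto
  have cK: "\<iota> c \<in> K" for c by (rule kfld_const[OF kfld_K])
  have sz: "\<sigma> z = - z"
  proof -
    have "\<sigma> z = (\<sigma> x - \<iota> \<gamma>) / (\<sigma> x + \<iota> \<gamma>)"
      unfolding z_def using x_in_K cK
      by (simp add: \<sigma>_simps kfld_diff[OF kfld_K] kfld_add[OF kfld_K])
    also have "\<sigma> x - \<iota> \<gamma> = \<iota> \<gamma> * (\<iota> \<gamma> - x) / x"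
      unfolding sx using x0 by (simp add: field_simps power2_eq_square)
    also have "\<sigma> x + \<iota> \<gamma> = \<iota> \<gamma> * (x + \<iota> \<gamma>) / x"
      unfolding sx using x0 by (simp add: field_simps power2_eq_square)
    also have "\<iota> \<gamma> * (\<iota> \<gamma> - x) / x / (\<iota> \<gamma> * (x + \<iota> \<gamma>) / x) = (\<iota> \<gamma> - x) / (x + \<iota> \<gamma>)"
      using \<gamma> x0 by simp
    also have "\<dots> = - z" using minus_divide_left[of "x - \<iota> \<gamma>" "x + \<iota> \<gamma>"] by (simp add: z_def)
    finally show ?thesis .
  qed
  have wK: "w \<in> K"
    unfolding w_def by (intro kfld_intros[OF kfld_K] y_in_K zK)
  have sw: "\<sigma> w = \<iota> (e / \<gamma> ^ 3) * w"
  proof -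
    have "\<sigma> w = \<sigma> y * (1 + z) ^ 3 / \<iota> \<epsilon>"
      unfolding w_def using y_in_K cK zK kfld_1[OF kfld_K]
      by (simp add: \<sigma>_simps sz kfld_diff[OF kfld_K] kfld_power[OF kfld_K] kfld_mult[OF kfld_K])
    also have "\<dots> = \<iota> e * y * ((1 + z) / x) ^ 3 / \<iota> \<epsilon>"
      unfolding sy by (simp add: power_divide)
    also have "(1 + z) / x = (1 - z) / \<iota> \<gamma>"
      unfolding one_plus_z one_minus_z using x0 \<gamma> by simp
    finally show ?thesis by (simp add: w_def power_divide)
  qed
  \<comment> \<open>The two signs of \<open>e\<close> correspond to an involution and its product
    with the hyperelliptic one; both lie over the same transformation of \<open>x\<close>.\<close>
  have "(e / \<gamma> ^ 3) ^ 2 = 1"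
    using e \<gamma> by (simp add: power_divide flip: power_mult)
  hence "e / \<gamma> ^ 3 = 1 \<or> e / \<gamma> ^ 3 = -1" by (simp add: power2_eq_1_iff)
  hence "\<sigma> w = \<iota> 1 * w \<or> \<sigma> w = \<iota> (-1) * w"
    unfolding sw by (elim disjE) (simp_all only: refl simp_thms)
  hence sw_cases: "\<sigma> w = w \<or> \<sigma> w = - w" by simp
  have z2F: "z ^ 2 \<in> F"
    using \<sigma>_fixed_iff[of "z ^ 2"] kfld_power[OF kfld_K zK] zK by (simp add: \<sigma>_power sz)
  \<comment> \<open>Since \<open>z\<close> and \<open>w\<close> generate \<open>K\<close>, the field
    \<open>k(U, V)\<close> with \<open>z\<close> adjoined is all of \<open>K\<close>; hence fixed
    elements \<open>U\<close>, \<open>V\<close> already generate \<open>F\<close>.\<close>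
  have fixed: "F = adj (kf U) V"
    if U: "z ^ 2 \<in> kf U" "U \<in> F" and V: "V \<in> F" "V ^ 2 \<in> kf U" "w \<in> adj (adj (kf U) V) z" for U V
  proof (rule fixed_field_eq)
    have S: "kfld (adj (kf U) V)" by (rule kfld_adj[OF kfld_kf V(2)])
    show "kfld (adj (kf U) V)" by (rule S)
    show "adj (kf U) V \<subseteq> F" by (rule adj_subset[OF F kf_subset[OF F U(2)] V(1)])
    show z2: "z ^ 2 \<in> adj (kf U) V" using subset_adj[OF kfld_kf] U(1) by blast
    show "K \<subseteq> adj (adj (kf U) V) z"
      unfolding K_eq by (rule adj_kf_subset[OF kfld_adj[OF S z2] in_adj[OF S] V(3)])
  qed (use zK sz z_neq_0 in auto)
  from sw_cases show ?thesis
  proof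
    assume "\<sigma> w = w"
    hence wF: "w \<in> F" using \<sigma>_fixed_iff[OF wK] by simp
    have w2k: "w ^ 2 \<in> kf (z ^ 2)" unfolding w2 by (rule ev_in_kf)
    have S: "kfld (adj (kf (z ^ 2)) w)" by (rule kfld_adj[OF kfld_kf w2k])
    have "w \<in> adj (adj (kf (z ^ 2)) w) z"
      using subset_adj[OF S] in_adj[OF kfld_kf] by blast
    hence "F = adj (kf (z ^ 2)) w"
      by (rule fixed[OF in_kf z2F wF w2k])
    hence eq: "adj (kf u) v = adj (kf (z ^ 2)) w" using F_eq by simp
    have "quartic_j g = quartic_j [:a, b, c, d':]"
      by (rule quartic_j_unique[OF transc_z2 u _ h(3) w2 g v eq]) (use h in simp)
    thus ?thesis ..
  next
    assume sw: "\<sigma> w = - w"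
    \<comment> \<open>Both \<open>w\<close> and \<open>z ^ 3\<close> change sign, so their quotient
      is fixed. Dividing \<open>h(z^2)\<close> by \<open>z^6\<close> reverses the coefficients of
      the cubic \<open>h\<close>.\<close>
    define U where "U = inverse (z ^ 2)"
    define V where "V = w / z ^ 3"
    have VK: "V \<in> K" unfolding V_def by (intro kfld_intros[OF kfld_K] wK zK)
    have "\<sigma> V = V"
      unfolding V_def using wK zK kfld_power[OF kfld_K zK] by (simp add: \<sigma>_simps sw sz)
    hence VF: "V \<in> F" using \<sigma>_fixed_iff[OF VK] by simp
    have UF: "U \<in> F" unfolding U_def by (rule kfld_inverse[OF F z2F])
    have zU: "z ^ 2 \<in> kf U"
      using kfld_inverse[OF kfld_kf in_kf, of U] by (simp add: U_def)
    have tU: "transc U" by (rule transc_in_kf[OF transc_z2 zU])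
    have V2: "V ^ 2 = ev [:d', c, b, a:] U"
      unfolding V_def U_def power_divide w2 using z_neq_0
      by (simp add: field_simps eval_nat_numeral)
    have V2k: "V ^ 2 \<in> kf U" unfolding V2 by (rule ev_in_kf)
    have S: "kfld (adj (kf U) V)" by (rule kfld_adj[OF kfld_kf V2k])
    have T: "kfld (adj (adj (kf U) V) z)"
      by (rule kfld_adj[OF S]) (use subset_adj[OF kfld_kf] zU in blast)
    have "w = V * z ^ 3" using z_neq_0 by (simp add: V_def)
    also have "\<dots> \<in> adj (adj (kf U) V) z"
      using subset_adj[OF S, of z] in_adj[OF kfld_kf, of V U]
      by (intro kfld_mult[OF T] kfld_power[OF T] in_adj[OF S]) blast
    finally have "F = adj (kf U) V"
      by (rule fixed[OF zU UF VF V2k])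
    hence eq: "adj (kf u) v = adj (kf U) V" using F_eq by simp
    have "quartic_j g = quartic_j [:d', c, b, a:]"
      by (rule quartic_j_unique[OF tU u _ h(4) V2 g v eq]) (use h in simp)
    thus ?thesis ..
  qed
qed

end

section \<open>Involutions of the two families\<close>

lemma quintic_involution:
  fixes a b t :: "'a::field_char_0"
  assumes t: "t \<noteq> 9 / 100" and \<Delta>: "a ^ 2 + b \<noteq> 0"
    and id: "\<And>z. (z - a) * (a * z + b) * ((a * z + b) ^ 4 + (a * z + b) ^ 2 * (z - a) ^ 2 + t * (z - a) ^ 4)
      = (a ^ 2 + b) ^ 3 * (z ^ 5 + z ^ 3 + t * z)"
  shows "a = 0 \<and> b ^ 2 = t"
proof (cases "a = 0")
  case True
  hence "b \<noteq> 0" using \<Delta> by simp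
  have "b * (b ^ 4 + b ^ 2 + t - b ^ 2 * (2 + t)) = 0"
    using id[of 1] True by (simp add: algebra_simps eval_nat_numeral)
  hence 1: "b ^ 4 + b ^ 2 + t = b ^ 2 * (2 + t)" using \<open>b \<noteq> 0\<close> by simp
  have "2 * b * (b ^ 4 + 4 * b ^ 2 + 16 * t - b ^ 2 * (20 + t)) = 0"
    using id[of 2] True by (simp add: algebra_simps eval_nat_numeral)
  hence 2: "b ^ 4 + 4 * b ^ 2 + 16 * t = b ^ 2 * (20 + t)" using \<open>b \<noteq> 0\<close> by simp
  have "15 * (t - b ^ 2) = (b ^ 4 + 4 * b ^ 2 + 16 * t - b ^ 2 * (20 + t)) - (b ^ 4 + b ^ 2 + t - b ^ 2 * (2 + t))"
    by (simp add: algebra_simps)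
  hence "t = b ^ 2" unfolding 1 2 by simp
  thus ?thesis using True by simp
next
  case False
  \<comment> \<open>After substituting \<open>b = r a\<^sup>2\<close> and \<open>a z\<close> for \<open>z\<close>, the identity involves \<open>a\<close> only through \<open>s\<close>.\<close>
  define r where "r = b / a ^ 2"
  define s where "s = a ^ 2"
  have b: "b = r * a ^ 2" using False by (simp add: r_def)
  have s0: "s \<noteq> 0" using False by (simp add: s_def)
  have "a ^ 2 * (1 + r) \<noteq> 0" using \<Delta> by (simp add: b algebra_simps)
  hence r1: "1 + r \<noteq> 0" by simp
  have scaled: "(z - 1) * (z + r) * (s ^ 2 * (z + r) ^ 4 + s * (z + r) ^ 2 * (z - 1) ^ 2 + t * (z - 1) ^ 4)
      = (1 + r) ^ 3 * z * (s ^ 2 * z ^ 4 + s * z ^ 2 + t)" for z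
  proof -
    have "a ^ 7 * ((z - 1) * (z + r) * (s ^ 2 * (z + r) ^ 4 + s * (z + r) ^ 2 * (z - 1) ^ 2 + t * (z - 1) ^ 4))
      = (a * z - a) * (a * (a * z) + b) * ((a * (a * z) + b) ^ 4 + (a * (a * z) + b) ^ 2 * (a * z - a) ^ 2 + t * (a * z - a) ^ 4)"
      unfolding b s_def by Groebner_Basis.algebra
    also have "\<dots> = (a ^ 2 + b) ^ 3 * ((a * z) ^ 5 + (a * z) ^ 3 + t * (a * z))"
      by (rule id)
    also have "\<dots> = a ^ 7 * ((1 + r) ^ 3 * z * (s ^ 2 * z ^ 4 + s * z ^ 2 + t))"
      unfolding b s_def by Groebner_Basis.algebra
    finally show ?thesis using False by simp
  qed
  \<comment> \<open>In the scaled coordinate the transformation is \<open>(z + r) / (z - 1)\<close>.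
    The values at 1, 0 and -1 say that the images of infinity, 0 and -1 are branch points; -1 is one
    because 1 is and the quartic factor is even. The cases \<open>r = 0\<close> and
    \<open>r = 1\<close> are those in which 0 or -1 is mapped to 0.\<close>
  have A: "t = - s - s ^ 2"
  proof -
    have "s ^ 2 + s + t = 0" using scaled[of 1] r1 by simp
    moreover have "t = (s ^ 2 + s + t) - s - s ^ 2" by simp
    ultimately show ?thesis by simp
  qed
  have B: "r = 0 \<or> s ^ 2 * r ^ 4 + s * r ^ 2 + t = 0"
    using scaled[of 0] by simp
  have C: "r = 1 \<or> s ^ 2 * (r - 1) ^ 4 + 4 * s * (r - 1) ^ 2 + 16 * t = 0"
  proof -
    have "(-2) * ((r - 1) * (s ^ 2 * (r - 1) ^ 4 + 4 * s * (r - 1) ^ 2 + 16 * t)) = - ((1 + r) ^ 3 * (s ^ 2 + s + t))"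
      using scaled[of "-1"] by (simp add: algebra_simps eval_nat_numeral)
    also have "s ^ 2 + s + t = 0" by (simp add: A)
    finally show ?thesis by simp
  qed
  consider "r = 0" | "r = 1" | "r \<noteq> 0" "r \<noteq> 1" by blast
  hence False
  proof cases
    case 1
    have "s ^ 2 + 4 * s + 16 * t = 0" using C 1 by simp
    hence "s * (15 * s + 12) = 0" unfolding A by Groebner_Basis.algebra
    hence "15 * s = - 12" using s0 by (simp add: eq_neg_iff_add_eq_0)
    moreover have "3 * (s * (50 * s + 32)) = 0"
      using scaled[of 3] 1 by (simp add: A algebra_simps power2_eq_square)
    hence "s * (50 * s + 32) = 0" by simp
    hence "50 * s = - 32" using s0 by (simp add: eq_neg_iff_add_eq_0)
    ultimately have "(24::'a) = 0" by Groebner_Basis.algebra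
    thus False by simp
  next
    case 2
    have "24 * s = 0"
      using scaled[of 2] 2 by (simp add: A algebra_simps power2_eq_square)
    thus False using s0 by simp
  next
    case 3
    \<comment> \<open>The other two cases are contradictory for every \<open>t\<close>; this one is
      possible only at the excluded value \<open>t = 9/100\<close>.\<close>
    have B': "s ^ 2 * r ^ 4 + s * r ^ 2 + t = 0" using B 3 by simp
    have C': "s ^ 2 * (r - 1) ^ 4 + 4 * s * (r - 1) ^ 2 + 16 * t = 0" using C 3 by simp
    have "s * (r - 1) * (1 + r) * (s * (r ^ 2 + 1) + 1) = 0"
      using B' unfolding A by (simp add: algebra_simps eval_nat_numeral)
    hence D: "s * (r ^ 2 + 1) = - 1" using s0 3 r1 by (simp add: eq_neg_iff_add_eq_0)
    have t': "t = s ^ 2 * r ^ 2" using D unfolding A by Groebner_Basis.algebra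
    have "s ^ 2 * (1 + r) ^ 2 * (3 * (r ^ 2 + 1) - 10 * r) = 0"
      using C' D unfolding t' by Groebner_Basis.algebra
    hence "3 * (r ^ 2 + 1) = 10 * r" using s0 r1 by simp
    hence "s * (10 * r) = - 3" using D by Groebner_Basis.algebra
    hence "100 * t = 9" unfolding t' by Groebner_Basis.algebra
    thus False using t by (simp add: field_simps)
  qed
  thus ?thesis ..
qed

lemma sextic_involution:
  fixes a b t :: "'a::field_char_0"
  assumes t: "t \<noteq> - (1 / 50)" and \<Delta>: "a ^ 2 + b \<noteq> 0"
    and id: "\<And>z. (a * z + b) ^ 6 + (a * z + b) ^ 3 * (z - a) ^ 3 + t * (z - a) ^ 6
      = (a ^ 2 + b) ^ 3 * (z ^ 6 + z ^ 3 + t)"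
  shows "a = 0 \<and> b ^ 3 = t"
proof (cases "a = 0")
  case True
  hence "b \<noteq> 0" using \<Delta> by simp
  have "b ^ 3 * (b ^ 3 - t) = 0"
    using id[of 0] True by (simp add: algebra_simps flip: power_add)
  thus ?thesis using True \<open>b \<noteq> 0\<close> by simp
next
  case False
  define r where "r = b / a ^ 2"
  define s where "s = a ^ 3"
  have b: "b = r * a ^ 2" using False by (simp add: r_def)
  have s0: "s \<noteq> 0" using False by (simp add: s_def)
  have "a ^ 2 * (1 + r) \<noteq> 0" using \<Delta> by (simp add: b algebra_simps)
  hence r1: "1 + r \<noteq> 0" by simp
  have scaled: "s ^ 2 * (z + r) ^ 6 + s * (z + r) ^ 3 * (z - 1) ^ 3 + t * (z - 1) ^ 6
      = (1 + r) ^ 3 * (s ^ 2 * z ^ 6 + s * z ^ 3 + t)" for z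
  proof -
    have "a ^ 6 * (s ^ 2 * (z + r) ^ 6 + s * (z + r) ^ 3 * (z - 1) ^ 3 + t * (z - 1) ^ 6)
      = (a * (a * z) + b) ^ 6 + (a * (a * z) + b) ^ 3 * (a * z - a) ^ 3 + t * (a * z - a) ^ 6"
      unfolding b s_def by Groebner_Basis.algebra
    also have "\<dots> = (a ^ 2 + b) ^ 3 * ((a * z) ^ 6 + (a * z) ^ 3 + t)"
      by (rule id)
    also have "\<dots> = a ^ 6 * ((1 + r) ^ 3 * (s ^ 2 * z ^ 6 + s * z ^ 3 + t))"
      unfolding b s_def by Groebner_Basis.algebra
    finally show ?thesis using False by simp
  qed
  \<comment> \<open>The coefficients of left side minus right side. In degrees 1, 2, 4 and 5 the
    right side contributes nothing, so the equations taken from there are free of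
    \<open>(1 + r) ^ 3\<close>.\<close>
  define p where "p = [:s ^ 2 * r ^ 6 - s * r ^ 3 + t - (1 + r) ^ 3 * t,
    6 * s ^ 2 * r ^ 5 + 3 * s * r ^ 2 * (r - 1) - 6 * t,
    15 * s ^ 2 * r ^ 4 + s * (3 * r ^ 2 - 3 * r * (r - 1) ^ 2) + 15 * t,
    20 * s ^ 2 * r ^ 3 + s * ((r - 1) ^ 3 - 6 * r * (r - 1)) - 20 * t - (1 + r) ^ 3 * s,
    15 * s ^ 2 * r ^ 2 + s * (3 * (r - 1) ^ 2 - 3 * r) + 15 * t,
    6 * s ^ 2 * r + 3 * s * (r - 1) - 6 * t,
    s ^ 2 + s + t - (1 + r) ^ 3 * s ^ 2:]"
  have "poly p z = (s ^ 2 * (z + r) ^ 6 + s * (z + r) ^ 3 * (z - 1) ^ 3 + t * (z - 1) ^ 6)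
      - (1 + r) ^ 3 * (s ^ 2 * z ^ 6 + s * z ^ 3 + t)" for z
    unfolding p_def by simp Groebner_Basis.algebra
  hence "poly p z = 0" for z using scaled by simp
  hence "p = 0" using poly_all_0_iff_0[of p] by simp
  hence c1: "6 * s ^ 2 * r ^ 5 + 3 * s * r ^ 2 * (r - 1) - 6 * t = 0"
    and c2: "15 * s ^ 2 * r ^ 4 + s * (3 * r ^ 2 - 3 * r * (r - 1) ^ 2) + 15 * t = 0"
    and c4: "15 * s ^ 2 * r ^ 2 + s * (3 * (r - 1) ^ 2 - 3 * r) + 15 * t = 0"
    and c5: "6 * s ^ 2 * r + 3 * s * (r - 1) - 6 * t = 0"
    unfolding p_def pCons_eq_0_iff by blast+
  have "3 * (s * (r - 1) * (1 + r) * (2 * s * r * (r ^ 2 + 1) + (r - 1))) = 0"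
    using c1 c5 by Groebner_Basis.algebra
  hence "r - 1 = 0 \<or> 2 * s * r * (r ^ 2 + 1) + (r - 1) = 0"
    using s0 r1 unfolding mult_eq_0_iff by simp
  hence cases: "r = 1 \<or> 2 * s * r * (r ^ 2 + 1) = 1 - r"
  proof
    assume "2 * s * r * (r ^ 2 + 1) + (r - 1) = 0"
    hence "2 * s * r * (r ^ 2 + 1) = 1 - r" by Groebner_Basis.algebra
    thus ?thesis ..
  qed simp
  have "3 * (s * (1 + r) * (10 * s * r + 2 * r - 3)) = 0"
    using c4 c5 by Groebner_Basis.algebra
  hence sr: "10 * s * r + 2 * r - 3 = 0" using s0 r1 by simp
  from cases have False
  proof
    assume "r = 1"
    with sr have "10 * s = 1" by simp
    moreover have "15 * s ^ 2 + s * 3 + 15 * t = 0" "6 * s ^ 2 - 6 * t = 0"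
      using c2 c5 \<open>r = 1\<close> by simp_all
    hence "6 * (s * (10 * s + 1)) = 0" by Groebner_Basis.algebra
    hence "s * (10 * s + 1) = 0" by simp
    hence "10 * s = - 1" using s0 by (simp add: eq_neg_iff_add_eq_0)
    ultimately have "(1::'a) = - 1" by simp
    thus False by simp
  next
    assume E: "2 * s * r * (r ^ 2 + 1) = 1 - r"
    \<comment> \<open>Eliminating \<open>s\<close> leaves \<open>r = 2\<close> or
      \<open>r = 1/2\<close>, and either value forces \<open>t = -1/50\<close>.\<close>
    have "(1 + r) * ((r - 2) * (2 * r - 1)) = 0"
      using E sr by Groebner_Basis.algebra
    hence "r = 2 \<or> 2 * r = 1" using r1 by simp
    hence "50 * t = - 1"
    proof
      assume r: "r = 2"
      have "20 * s = - 1" using sr unfolding r by Groebner_Basis.algebra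
      moreover have "12 * s ^ 2 + 3 * s - 6 * t = 0" using c5 by (simp add: r)
      ultimately have "48 * (50 * t) = 48 * (- 1)" by Groebner_Basis.algebra
      thus ?thesis unfolding mult_cancel_left by simp
    next
      assume r: "2 * r = 1"
      have "5 * s = 2" using sr r by Groebner_Basis.algebra
      hence s: "s = 2 / 5" by (simp add: field_simps)
      have r': "r = 1 / 2" using r by (simp add: field_simps)
      show ?thesis using c5 by (simp add: s r' field_simps)
    qed
    thus False using t by (simp add: field_simps)
  qed
  thus ?thesis ..
qed

section \<open>The j-values as functions of a square root of \<open>t\<close>, and their
  quadratics\<close>

definition j_quintic :: "'a::field \<Rightarrow> 'a" where
  "j_quintic \<beta> = 64 * (10 * \<beta> - 3) ^ 3 / ((2 * \<beta> - 1) * (2 * \<beta> + 1) ^ 2)"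

definition j_sextic :: "'a::field \<Rightarrow> 'a" where
  "j_sextic \<delta> = 6912 * \<delta> * (5 * \<delta> + 2) ^ 3 / ((2 * \<delta> - 1) ^ 3 * (2 * \<delta> + 1))"

lemma quartic_j_quintic_quotient:
  fixes \<beta> :: "'a::field_char_0"
  shows "\<beta> \<noteq> 0 \<Longrightarrow> quartic_j (quintic_quotient \<beta>) = j_quintic \<beta>"
  by (simp add: quartic_j_def quintic_quotient_invariants j_quintic_def power_mult_distrib)

lemma quartic_j_sextic_quotient:
  fixes \<delta> :: "'a::field_char_0"
  assumes "\<delta> \<noteq> 0"
  shows "quartic_j (sextic_quotient \<delta>) = j_sextic \<delta>"
proof -
  have "quartic_j (sextic_quotient \<delta>) = (2985984 * \<delta> ^ 2) * (6912 * \<delta> * (5 * \<delta> + 2) ^ 3)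
      / ((2985984 * \<delta> ^ 2) * ((2 * \<delta> - 1) ^ 3 * (2 * \<delta> + 1)))"
    unfolding quartic_j_def sextic_quotient_invariants
    by (rule arg_cong2[of _ _ _ _ "(/)"]) Groebner_Basis.algebra+
  also have "\<dots> = j_sextic \<delta>"
    unfolding j_sextic_def using assms by (intro mult_divide_mult_cancel_left) simp
  finally show ?thesis .
qed

text \<open>Vieta's formulas for the values at \<open>\<beta>\<close> and \<open>- \<beta>\<close>.
  Over the common denominator \<open>N ^ 2\<close> the product has numerator divisible by
  \<open>N\<close>, which leaves \<open>N ^ 3\<close>.\<close>

lemma quintic_quadratic_factorization:
  fixes \<beta> j :: "'a::field_char_0"
  assumes "4 * \<beta> ^ 2 - 1 \<noteq> 0"
  shows "j ^ 2 - 128 * ((2000 * (\<beta> ^ 2) ^ 2 + 1440 * \<beta> ^ 2 + 27) / (4 * \<beta> ^ 2 - 1) ^ 2) * j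
      + 4096 * ((100 * \<beta> ^ 2 - 9) ^ 3 / (4 * \<beta> ^ 2 - 1) ^ 3) = (j - j_quintic \<beta>) * (j - j_quintic (- \<beta>))"
proof -
  define N where "N = 4 * \<beta> ^ 2 - 1"
  have N: "N = (2 * \<beta> - 1) * (2 * \<beta> + 1)" by (simp add: N_def algebra_simps power2_eq_square)
  have N0: "N \<noteq> 0" "2 * \<beta> - 1 \<noteq> 0" "2 * \<beta> + 1 \<noteq> 0" using assms N by (auto simp: N_def)
  have N0': "2 * (- \<beta>) - 1 \<noteq> 0" "2 * (- \<beta>) + 1 \<noteq> 0"
  proof -
    have "2 * (- \<beta>) - 1 = - (2 * \<beta> + 1)" "2 * (- \<beta>) + 1 = - (2 * \<beta> - 1)" by simp_all
    thus "2 * (- \<beta>) - 1 \<noteq> 0" "2 * (- \<beta>) + 1 \<noteq> 0" using N0 by (simp_all only: neg_equal_0_iff_equal) simp_all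
  qed
  have j1: "j_quintic \<beta> = 64 * (10 * \<beta> - 3) ^ 3 * (2 * \<beta> - 1) / N ^ 2"
    unfolding j_quintic_def N
  proof (subst frac_eq_eq)
    show "(2 * \<beta> - 1) * (2 * \<beta> + 1) ^ 2 \<noteq> 0" "((2 * \<beta> - 1) * (2 * \<beta> + 1)) ^ 2 \<noteq> 0"
      using N0 by simp_all
  qed Groebner_Basis.algebra
  have j2: "j_quintic (- \<beta>) = 64 * (10 * \<beta> + 3) ^ 3 * (2 * \<beta> + 1) / N ^ 2"
    unfolding j_quintic_def N
  proof (subst frac_eq_eq)
    show "(2 * (- \<beta>) - 1) * (2 * (- \<beta>) + 1) ^ 2 \<noteq> 0"
      using N0' by (simp only: mult_eq_0_iff power_eq_0_iff) simp
    show "((2 * \<beta> - 1) * (2 * \<beta> + 1)) ^ 2 \<noteq> 0"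
      using N0 by simp
  qed Groebner_Basis.algebra
  have s: "j_quintic \<beta> + j_quintic (- \<beta>) = 128 * (2000 * (\<beta> ^ 2) ^ 2 + 1440 * \<beta> ^ 2 + 27) / N ^ 2"
    unfolding j1 j2 add_divide_distrib[symmetric] by (rule arg_cong[of _ _ "\<lambda>x. x / N ^ 2"]) Groebner_Basis.algebra
  have "j_quintic \<beta> * j_quintic (- \<beta>) = (4096 * (100 * \<beta> ^ 2 - 9) ^ 3 * N) / (N ^ 3 * N)"
    unfolding j1 j2 times_divide_times_eq
    by (rule arg_cong2[of _ _ _ _ "(/)"]) (unfold N_def, Groebner_Basis.algebra+)
  hence p: "j_quintic \<beta> * j_quintic (- \<beta>) = 4096 * (100 * \<beta> ^ 2 - 9) ^ 3 / N ^ 3"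
    using N0(1) by simp
  have "(j - j_quintic \<beta>) * (j - j_quintic (- \<beta>))
      = j ^ 2 - (j_quintic \<beta> + j_quintic (- \<beta>)) * j + j_quintic \<beta> * j_quintic (- \<beta>)"
    by (simp add: algebra_simps power2_eq_square)
  thus ?thesis unfolding s p N_def by simp
qed

text \<open>Vieta's formulas over the common denominator \<open>N ^ 3\<close>. The coefficient 92
  comes out of the sum; in the product a factor \<open>N ^ 2\<close> cancels.\<close>

lemma sextic_quadratic_factorization:
  fixes \<delta> j :: "'a::field_char_0"
  assumes "4 * \<delta> ^ 2 - 1 \<noteq> 0"
  shows "j ^ 2 - 13824 * \<delta> ^ 2 * ((500 * (\<delta> ^ 2) ^ 2 + 965 * \<delta> ^ 2 + 92) / (4 * \<delta> ^ 2 - 1) ^ 3) * j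
      + 47775744 * \<delta> ^ 2 * ((25 * \<delta> ^ 2 - 4) ^ 3 / (4 * \<delta> ^ 2 - 1) ^ 4)
      = (j - j_sextic \<delta>) * (j - j_sextic (- \<delta>))"
proof -
  define N where "N = 4 * \<delta> ^ 2 - 1"
  have N: "N = (2 * \<delta> - 1) * (2 * \<delta> + 1)" by (simp add: N_def algebra_simps power2_eq_square)
  have N0: "N \<noteq> 0" "2 * \<delta> - 1 \<noteq> 0" "2 * \<delta> + 1 \<noteq> 0" using assms N by (auto simp: N_def)
  have N0': "2 * (- \<delta>) - 1 \<noteq> 0" "2 * (- \<delta>) + 1 \<noteq> 0"
  proof -
    have "2 * (- \<delta>) - 1 = - (2 * \<delta> + 1)" "2 * (- \<delta>) + 1 = - (2 * \<delta> - 1)" by simp_all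
    thus "2 * (- \<delta>) - 1 \<noteq> 0" "2 * (- \<delta>) + 1 \<noteq> 0" using N0 by (simp_all only: neg_equal_0_iff_equal) simp_all
  qed
  have j1: "j_sextic \<delta> = 6912 * \<delta> * (5 * \<delta> + 2) ^ 3 * (2 * \<delta> + 1) ^ 2 / N ^ 3"
    unfolding j_sextic_def N
  proof (subst frac_eq_eq)
    show "(2 * \<delta> - 1) ^ 3 * (2 * \<delta> + 1) \<noteq> 0" "((2 * \<delta> - 1) * (2 * \<delta> + 1)) ^ 3 \<noteq> 0"
      using N0 by simp_all
  qed Groebner_Basis.algebra
  have j2: "j_sextic (- \<delta>) = 6912 * \<delta> * (5 * \<delta> - 2) ^ 3 * (2 * \<delta> - 1) ^ 2 / N ^ 3"
    unfolding j_sextic_def N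
  proof (subst frac_eq_eq)
    show "(2 * (- \<delta>) - 1) ^ 3 * (2 * (- \<delta>) + 1) \<noteq> 0"
      using N0' by (simp only: mult_eq_0_iff power_eq_0_iff) simp
    show "((2 * \<delta> - 1) * (2 * \<delta> + 1)) ^ 3 \<noteq> 0"
      using N0 by simp
  qed Groebner_Basis.algebra
  have s: "j_sextic \<delta> + j_sextic (- \<delta>)
      = 13824 * \<delta> ^ 2 * (500 * (\<delta> ^ 2) ^ 2 + 965 * \<delta> ^ 2 + 92) / N ^ 3"
    unfolding j1 j2 add_divide_distrib[symmetric]
    by (rule arg_cong[of _ _ "\<lambda>x. x / N ^ 3"]) Groebner_Basis.algebra
  have "j_sextic \<delta> * j_sextic (- \<delta>) = (47775744 * \<delta> ^ 2 * (25 * \<delta> ^ 2 - 4) ^ 3 * N ^ 2) / (N ^ 4 * N ^ 2)"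
    unfolding j1 j2 times_divide_times_eq
    by (rule arg_cong2[of _ _ _ _ "(/)"]) (unfold N_def, Groebner_Basis.algebra+)
  also have "\<dots> = 47775744 * \<delta> ^ 2 * (25 * \<delta> ^ 2 - 4) ^ 3 / N ^ 4"
    using N0(1) by (intro mult_divide_mult_cancel_right) simp
  finally have p: "j_sextic \<delta> * j_sextic (- \<delta>) = 47775744 * \<delta> ^ 2 * (25 * \<delta> ^ 2 - 4) ^ 3 / N ^ 4" .
  have "(j - j_sextic \<delta>) * (j - j_sextic (- \<delta>))
      = j ^ 2 - (j_sextic \<delta> + j_sextic (- \<delta>)) * j + j_sextic \<delta> * j_sextic (- \<delta>)"
    by (simp add: algebra_simps power2_eq_square)
  thus ?thesis unfolding s p N_def by simp
qed

section \<open>Classification of the elliptic quotients in each family\<close>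

context elliptic_involution
begin

lemma quintic_j:
  assumes ft: "f = quintic t" and t: "t \<notin> {0, 1 / 4, 9 / 100}"
  obtains \<beta> where "\<beta> ^ 2 = t" "quartic_j g = j_quintic \<beta>"
proof (rule involution_cases)
  fix b assume "pcompose f [:b, -1:] = f"
  \<comment> \<open>The degree is odd, so \<open>b - x\<close> would reverse the sign of the leading
    coefficient.\<close>
  hence "lead_coeff (pcompose f [:b, -1:]) = lead_coeff f" by simp
  hence False by (simp add: lead_coeff_comp ft quintic_eq)
  thus thesis ..
next
  fix a b e
  assume \<Delta>: "a ^ 2 + b \<noteq> 0" and sx: "\<sigma> x = (\<iota> a * x + \<iota> b) / (x - \<iota> a)"
    and sy: "\<sigma> y = \<iota> e * y / (x - \<iota> a) ^ 3" and e: "e ^ 2 = (a ^ 2 + b) ^ 3"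
    and D: "moebius_sextic f [:b, a:] [:-a, 1:] = smult (e ^ 2) f"
  have "(z - a) * (a * z + b) * ((a * z + b) ^ 4 + (a * z + b) ^ 2 * (z - a) ^ 2 + t * (z - a) ^ 4)
      = (a ^ 2 + b) ^ 3 * (z ^ 5 + z ^ 3 + t * z)" for z
  proof -
    have "poly (moebius_sextic f [:b, a:] [:-a, 1:]) z
        = (z - a) * (a * z + b) * ((a * z + b) ^ 4 + (a * z + b) ^ 2 * (z - a) ^ 2 + t * (z - a) ^ 4)"
      unfolding moebius_sextic_def ft quintic_eq
      by (simp add: eval_nat_numeral) Groebner_Basis.algebra
    moreover have "poly f z = z ^ 5 + z ^ 3 + t * z"
      unfolding ft quintic_eq by (simp add: eval_nat_numeral algebra_simps)
    ultimately show ?thesis using arg_cong[OF D, of "\<lambda>p. poly p z"] by (simp add: e)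
  qed
  hence ab: "a = 0" "b ^ 2 = t"
    using quintic_involution[of t a b] t \<Delta> by auto
  have b0: "b \<noteq> 0" using ab t by auto
  obtain \<gamma> where \<gamma>: "\<gamma> ^ 2 = b" using nth_root_exists[of 2 b] by auto
  obtain \<epsilon> where \<epsilon>: "\<epsilon> ^ 2 = \<gamma> ^ 3" using nth_root_exists[of 2 "\<gamma> ^ 3"] by auto
  have \<gamma>0: "\<gamma> \<noteq> 0" using \<gamma> b0 by auto
  have \<gamma>4: "\<gamma> ^ 4 = t" using \<gamma> ab(2) by (metis power_mult num_double numeral_times_numeral)
  have fl: "flipped_coordinates \<iota> x \<gamma> \<epsilon>"
    using x \<gamma>0 \<epsilon> by unfold_locales
  have nz: "2 * b + 1 \<noteq> 0" "2 * b - 1 \<noteq> 0"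
  proof -
    have "(2 * b + 1) * (2 * b - 1) = 4 * t - 1"
      unfolding ab(2)[symmetric] by (simp add: algebra_simps power2_eq_square)
    also have "\<dots> \<noteq> 0" using t by (auto simp: field_simps)
    finally show "2 * b + 1 \<noteq> 0" "2 * b - 1 \<noteq> 0" by auto
  qed
  \<comment> \<open>Reversing this cubic only changes its sign, so both elliptic subfields attached
    to \<open>b\<close> have the same j-invariant.\<close>
  have refl: "[:- (2 * b + 1), 3 - 10 * b, 10 * b - 3, 2 * b + 1:] = smult (-1) (quintic_quotient b)"
    by (simp add: quintic_quotient_def)
  have "quartic_j g = quartic_j (quintic_quotient b) \<or>
        quartic_j g = quartic_j [:- (2 * b + 1), 3 - 10 * b, 10 * b - 3, 2 * b + 1:]"
    unfolding quintic_quotient_def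
  proof (rule quartic_j_cases[OF \<gamma>0 _ _ _ fl])
    show "\<sigma> x = \<iota> (\<gamma> ^ 2) / x" "\<sigma> y = \<iota> e * y / x ^ 3"
      using sx sy ab(1) \<gamma> by simp_all
    show "e ^ 2 = \<gamma> ^ 6" using e ab(1) \<gamma>[symmetric] by (simp flip: power_mult)
    show "flipped_coordinates.w \<iota> x y \<gamma> \<epsilon> ^ 2
        = ev [:2 * b + 1, 10 * b - 3, 3 - 10 * b, - (2 * b + 1):] (flipped_coordinates.z \<iota> x \<gamma> ^ 2)"
      using flipped_coordinates.w2_quintic[OF fl, of y] y
      unfolding ft \<gamma>4 \<gamma> quintic_quotient_def by blast
    show "quartic_disc [:2 * b + 1, 10 * b - 3, 3 - 10 * b, - (2 * b + 1):] \<noteq> 0"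
      unfolding quintic_quotient_def[symmetric] quintic_quotient_invariants using b0 nz by simp
    show "quartic_disc [:- (2 * b + 1), 3 - 10 * b, 10 * b - 3, 2 * b + 1:] \<noteq> 0"
      unfolding refl quartic_disc_smult quintic_quotient_invariants using b0 nz by simp
  qed (use nz in \<open>simp_all only: neg_equal_0_iff_equal not_False_eq_True\<close>)
  moreover have "quartic_j [:- (2 * b + 1), 3 - 10 * b, 10 * b - 3, 2 * b + 1:]
      = quartic_j (quintic_quotient b)"
    unfolding refl by (rule quartic_j_smult) simp
  ultimately have "quartic_j g = j_quintic b"
    using quartic_j_quintic_quotient[OF b0] by argo
  thus thesis using that ab(2) by blast
qed

lemma sextic_j:
  assumes ft: "f = sextic t" and t: "t \<notin> {0, 1 / 4, - (1 / 50)}"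
  obtains \<delta> where "\<delta> ^ 2 = t" "quartic_j g = j_sextic \<delta>"
proof (rule involution_cases)
  fix b assume "pcompose f [:b, -1:] = f"
  hence eq: "poly (pcompose f [:b, -1:]) z - poly f z = 0" for z by simp
  have "poly (pcompose f [:b, -1:]) z - poly f z = ((b - z) ^ 6 + (b - z) ^ 3) - (z ^ 6 + z ^ 3)" for z
    unfolding poly_pcompose ft sextic_eq by simp Groebner_Basis.algebra
  hence inv: "(b - z) ^ 6 + (b - z) ^ 3 = z ^ 6 + z ^ 3" for z
    unfolding eq by simp
  have "b = 0"
  proof (rule ccontr)
    assume b: "b \<noteq> 0"
    have "b ^ 3 * (b ^ 3 + 1) = 0" using inv[of 0] by (simp add: algebra_simps eval_nat_numeral)
    hence "b ^ 3 = - 1" using b by (simp add: eq_neg_iff_add_eq_0)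
    moreover have "9 * (b ^ 3 * (7 * b ^ 3 + 1)) = 0"
      using inv[of "2 * b"] by (simp add: algebra_simps eval_nat_numeral)
    hence "7 * b ^ 3 + 1 = 0" using b by simp
    ultimately show False by simp
  qed
  hence False using inv[of 1] by simp
  thus thesis ..
next
  fix a b e
  assume \<Delta>: "a ^ 2 + b \<noteq> 0" and sx: "\<sigma> x = (\<iota> a * x + \<iota> b) / (x - \<iota> a)"
    and sy: "\<sigma> y = \<iota> e * y / (x - \<iota> a) ^ 3" and e: "e ^ 2 = (a ^ 2 + b) ^ 3"
    and D: "moebius_sextic f [:b, a:] [:-a, 1:] = smult (e ^ 2) f"
  have "(a * z + b) ^ 6 + (a * z + b) ^ 3 * (z - a) ^ 3 + t * (z - a) ^ 6
      = (a ^ 2 + b) ^ 3 * (z ^ 6 + z ^ 3 + t)" for z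
  proof -
    have "poly (moebius_sextic f [:b, a:] [:-a, 1:]) z
        = (a * z + b) ^ 6 + (a * z + b) ^ 3 * (z - a) ^ 3 + t * (z - a) ^ 6"
      unfolding moebius_sextic_def ft sextic_eq
      by (simp add: eval_nat_numeral) Groebner_Basis.algebra
    moreover have "poly f z = z ^ 6 + z ^ 3 + t"
      unfolding ft sextic_eq by (simp add: eval_nat_numeral algebra_simps)
    ultimately show ?thesis using arg_cong[OF D, of "\<lambda>p. poly p z"] by (simp add: e)
  qed
  hence ab: "a = 0" "b ^ 3 = t"
    using sextic_involution[of t a b] t \<Delta> by auto
  have b0: "b \<noteq> 0" using ab t by auto
  obtain \<gamma> where \<gamma>: "\<gamma> ^ 2 = b" using nth_root_exists[of 2 b] by auto
  obtain \<epsilon> where \<epsilon>: "\<epsilon> ^ 2 = \<gamma> ^ 3" using nth_root_exists[of 2 "\<gamma> ^ 3"] by auto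
  have \<gamma>0: "\<gamma> \<noteq> 0" using \<gamma> b0 by auto
  have \<gamma>6: "\<gamma> ^ 6 = t" unfolding ab(2)[symmetric] \<gamma>[symmetric] by (simp flip: power_mult)
  have fl: "flipped_coordinates \<iota> x \<gamma> \<epsilon>"
    using x \<gamma>0 \<epsilon> by unfold_locales
  define \<delta> where "\<delta> = \<gamma> ^ 3"
  have \<delta>2: "\<delta> ^ 2 = t" unfolding \<delta>_def \<gamma>6[symmetric] by (simp flip: power_mult)
  have \<delta>0: "\<delta> \<noteq> 0" "- \<delta> \<noteq> 0" using \<gamma>0 by (auto simp: \<delta>_def)
  have nz: "2 * \<delta> + 1 \<noteq> 0" "2 * \<delta> - 1 \<noteq> 0"
  proof -
    have "(2 * \<delta> + 1) * (2 * \<delta> - 1) = 4 * t - 1"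
      unfolding \<delta>2[symmetric] by (simp add: algebra_simps power2_eq_square)
    also have "\<dots> \<noteq> 0" using t by (auto simp: field_simps)
    finally show "2 * \<delta> + 1 \<noteq> 0" "2 * \<delta> - 1 \<noteq> 0" by auto
  qed
  \<comment> \<open>Here reversal replaces \<open>\<delta>\<close> by \<open>- \<delta>\<close> up
    to sign, so the two elliptic subfields realise the two square roots of \<open>t\<close>.\<close>
  have refl: "[:2 * \<delta> - 1, 30 * \<delta> + 3, 30 * \<delta> - 3, 2 * \<delta> + 1:] = smult (-1) (sextic_quotient (- \<delta>))"
    by (simp add: sextic_quotient_def)
  have nz': "2 * (- \<delta>) - 1 \<noteq> 0" "2 * (- \<delta>) + 1 \<noteq> 0"
  proof -
    have "2 * (- \<delta>) - 1 = - (2 * \<delta> + 1)" "2 * (- \<delta>) + 1 = - (2 * \<delta> - 1)" by simp_all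
    thus "2 * (- \<delta>) - 1 \<noteq> 0" "2 * (- \<delta>) + 1 \<noteq> 0" using nz by (simp_all only: neg_equal_0_iff_equal) simp_all
  qed
  have "quartic_j g = quartic_j (sextic_quotient \<delta>) \<or>
        quartic_j g = quartic_j [:2 * \<delta> - 1, 30 * \<delta> + 3, 30 * \<delta> - 3, 2 * \<delta> + 1:]"
    unfolding sextic_quotient_def[of \<delta>]
  proof (rule quartic_j_cases[OF \<gamma>0 _ _ _ fl])
    show "\<sigma> x = \<iota> (\<gamma> ^ 2) / x" "\<sigma> y = \<iota> e * y / x ^ 3"
      using sx sy ab(1) \<gamma> by simp_all
    show "e ^ 2 = \<gamma> ^ 6" using e ab(1) \<gamma>[symmetric] by (simp flip: power_mult)
    show "flipped_coordinates.w \<iota> x y \<gamma> \<epsilon> ^ 2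
        = ev [:2 * \<delta> + 1, 30 * \<delta> - 3, 30 * \<delta> + 3, 2 * \<delta> - 1:] (flipped_coordinates.z \<iota> x \<gamma> ^ 2)"
      using flipped_coordinates.w2_sextic[OF fl, of y] y
      unfolding ft \<gamma>6 \<delta>_def[symmetric] sextic_quotient_def by blast
    show "quartic_disc [:2 * \<delta> + 1, 30 * \<delta> - 3, 30 * \<delta> + 3, 2 * \<delta> - 1:] \<noteq> 0"
      unfolding sextic_quotient_def[symmetric] sextic_quotient_invariants using \<delta>0 nz by simp
    show "quartic_disc [:2 * \<delta> - 1, 30 * \<delta> + 3, 30 * \<delta> - 3, 2 * \<delta> + 1:] \<noteq> 0"
      unfolding refl quartic_disc_smult sextic_quotient_invariants mult_eq_0_iff power_eq_0_iff
      using \<delta>0 nz' by simp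
  qed (use nz in \<open>simp_all only: not_False_eq_True\<close>)
  moreover have "quartic_j [:2 * \<delta> - 1, 30 * \<delta> + 3, 30 * \<delta> - 3, 2 * \<delta> + 1:]
      = quartic_j (sextic_quotient (- \<delta>))"
    unfolding refl by (rule quartic_j_smult) simp
  ultimately have "quartic_j g = j_sextic \<delta> \<or> quartic_j g = j_sextic (- \<delta>)"
    using quartic_j_sextic_quotient[OF \<delta>0(1)] quartic_j_sextic_quotient[OF \<delta>0(2)] by argo
  moreover have "(- \<delta>) ^ 2 = t" using \<delta>2 by simp
  ultimately show thesis using that \<delta>2 by blast
qed

end

section \<open>Subfields of the function field of the curve\<close>

context const_field
begin

lemma kf_range:
  fixes \<Phi> :: "'k poly fract \<Rightarrow> 'L"
  assumes \<Phi>: "coeff_hom \<Phi>" and ev: "\<And>p. \<Phi> (to_fract p) = ev p u"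
  shows "range \<Phi> = kf u"
proof -
  interpret \<Phi>: coeff_hom \<Phi> by (rule \<Phi>)
  have frac: "\<Phi> (Fract p q) = ev p u / ev q u" if "q \<noteq> 0" for p q
  proof -
    have "Fract p q * to_fract q = to_fract p"
      using that by (simp add: Fract_conv_to_fract)
    from arg_cong[OF this, of \<Phi>] have "\<Phi> (Fract p q) * ev q u = ev p u" by (simp add: ev)
    moreover have "Fract 1 q * to_fract q = 1"
      using that by (simp add: Fract_conv_to_fract)
    hence "\<Phi> (Fract 1 q) * ev q u = 1" using \<Phi>.mult[of "Fract 1 q" "to_fract q"] by (simp add: ev)
    hence "ev q u \<noteq> 0" by auto
    ultimately show ?thesis by (simp add: field_simps)
  qed
  show ?thesis
  proof safe
    fix a :: "'k poly fract"
    obtain p q where "a = Fract p q" "q \<noteq> 0" by (cases a) auto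
    thus "\<Phi> a \<in> kf u" using frac kfI by simp
  next
    fix w assume "w \<in> kf u"
    then obtain p q where pq: "w = ev p u / ev q u" "ev q u \<noteq> 0" by (rule kf_cases)
    hence "q \<noteq> 0" by auto
    hence "w = \<Phi> (Fract p q)" using frac pq by simp
    thus "w \<in> range \<Phi>" by simp
  qed
qed

text \<open>The embedding of the rational function field that sends the variable to
  \<open>u\<close>; for transcendental \<open>u\<close> it does not depend on the chosen
  fraction.\<close>

definition rat_ev :: "'L \<Rightarrow> 'k poly fract \<Rightarrow> 'L" where
  "rat_ev u r = (SOME w. \<exists>p q. q \<noteq> 0 \<and> r = Fract p q \<and> w = ev p u / ev q u)"

lemma rat_ev_Fract:
  assumes u: "transc u" and q: "q \<noteq> 0"
  shows "rat_ev u (Fract p q) = ev p u / ev q u"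
  unfolding rat_ev_def
proof (rule some_equality)
  show "\<exists>p' q'. q' \<noteq> 0 \<and> Fract p q = Fract p' q' \<and> ev p u / ev q u = ev p' u / ev q' u"
    using q by blast
next
  fix w assume "\<exists>p' q'. q' \<noteq> 0 \<and> Fract p q = Fract p' q' \<and> w = ev p' u / ev q' u"
  then obtain p' q' where pq: "q' \<noteq> 0" "Fract p q = Fract p' q'" "w = ev p' u / ev q' u" by blast
  have "p * q' = p' * q" using pq q by (simp add: eq_fract)
  hence "ev p u * ev q' u = ev p' u * ev q u" by (simp flip: ev_mult)
  thus "w = ev p u / ev q u"
    using pq q transc_eq_0_iff[OF u] by (simp add: frac_eq_eq)
qed

lemma rat_ev_to_fract: "transc u \<Longrightarrow> rat_ev u (to_fract p) = ev p u"
  by (simp add: to_fract_def rat_ev_Fract)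

lemma coeff_hom_rat_ev:
  assumes u: "transc u"
  shows "coeff_hom (rat_ev u)"
proof
  show "rat_ev u 1 = 1"
    using rat_ev_to_fract[OF u, of 1] by simp
  fix a b :: "'k poly fract"
  obtain p q where a: "a = Fract p q" "q \<noteq> 0" by (cases a) auto
  obtain r s where b: "b = Fract r s" "s \<noteq> 0" by (cases b) auto
  show "rat_ev u (a + b) = rat_ev u a + rat_ev u b"
    using a b transc_eq_0_iff[OF u] by (simp add: rat_ev_Fract[OF u] add_frac_eq)
  show "rat_ev u (a * b) = rat_ev u a * rat_ev u b"
    using a b by (simp add: rat_ev_Fract[OF u])
qed

end

section \<open>Weierstrass equations with the square completed\<close>

definition weierstrass_cubic :: "'k::field weierstrass \<Rightarrow> 'k poly" where
  "weierstrass_cubic E = [:wb6 E / 4, wb4 E / 2, wb2 E / 4, 1:]"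

lemma weierstrass_cubic_invariants:
  fixes E :: "'k::field_char_0 weierstrass"
  shows "quartic_I (weierstrass_cubic E) = wc4 E / 16"
    and "quartic_disc (weierstrass_cubic E) = 27 * wdisc E / 16"
    and "degree (weierstrass_cubic E) = 3"
proof -
  show I: "quartic_I (weierstrass_cubic E) = wc4 E / 16"
    by (simp add: quartic_I_def weierstrass_cubic_def wc4_def eval_nat_numeral field_simps)
  \<comment> \<open>The classical relation that removes \<open>wb8\<close> from the
    discriminant.\<close>
  have b8: "4 * wb8 E = wb2 E * wb6 E - wb4 E ^ 2"
    unfolding wb2_def wb4_def wb6_def wb8_def by Groebner_Basis.algebra
  \<comment> \<open>The right-hand side is the classical \<open>c6\<close>, and the next computation
    is \<open>1728 * wdisc = c4^3 - c6^2\<close>.\<close>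
  have J: "32 * quartic_J (weierstrass_cubic E) = 36 * wb2 E * wb4 E - 216 * wb6 E - wb2 E ^ 3"
    by (simp add: quartic_J_def weierstrass_cubic_def eval_nat_numeral field_simps)
  have "1024 * quartic_disc (weierstrass_cubic E)
      = (16 * quartic_I (weierstrass_cubic E)) ^ 3 - (32 * quartic_J (weierstrass_cubic E)) ^ 2"
    by (simp add: quartic_disc_def power_mult_distrib)
  also have "\<dots> = 1728 * wdisc E"
    using b8 unfolding I J wc4_def wdisc_def by simp Groebner_Basis.algebra
  finally show "quartic_disc (weierstrass_cubic E) = 27 * wdisc E / 16"
    by (simp add: field_simps)
  show "degree (weierstrass_cubic E) = 3" by (simp add: weierstrass_cubic_def)
qed

lemma quartic_j_weierstrass_cubic:
  fixes E :: "'k::field_char_0 weierstrass"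
  shows "quartic_j (weierstrass_cubic E) = j_invariant E"
  by (simp add: quartic_j_def weierstrass_cubic_invariants j_invariant_def power_divide)

text \<open>The field \<open>curve_field 0 f\<close> is a record on a type of pairs; embedding it into the algebraic closure of \<open>k(x)\<close>
  makes type class arithmetic available.\<close>

definition const_ac :: "'k::field \<Rightarrow> 'k poly fract alg_closure" where
  "const_ac c = to_ac (to_fract [:c:])"

locale curve_embedding =
  fixes f :: "'k::{alg_closed_field,field_char_0} poly" and y :: "'k poly fract alg_closure"
  assumes f: "rsquarefree f" "degree f > 0" and y: "y ^ 2 = to_ac (to_fract f)"

lemma coeff_hom_const_ac: "coeff_hom (const_ac :: 'k::field \<Rightarrow> _)"
proof
  show "const_ac (a + b) = const_ac a + const_ac b" for a b :: 'k
    unfolding const_ac_def by (simp flip: to_ac_add to_fract_add)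
  show "const_ac (a * b) = const_ac a * const_ac b" for a b :: 'k
    unfolding const_ac_def by (simp flip: to_ac_mult to_fract_mult)
qed (simp add: const_ac_def flip: one_pCons)

sublocale curve_embedding \<subseteq> const_field const_ac
  by (intro const_field.intro coeff_hom_const_ac)

context curve_embedding
begin

definition x :: "'k poly fract alg_closure" where
  "x = to_ac (to_fract [:0, 1:])"

definition emb :: "'k poly fract \<times> 'k poly fract \<Rightarrow> 'k poly fract alg_closure" where
  "emb w = to_ac (fst w) + to_ac (snd w) * y"

lemma ev_x: "ev p x = to_ac (to_fract p)"
proof (induction p)
  case (pCons a p)
  have "pCons a p = [:a:] + [:0, 1:] * p" by simp
  hence "to_fract (pCons a p) = to_fract [:a:] + to_fract [:0, 1:] * to_fract p"
    by (simp only: to_fract_add to_fract_mult)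
  thus ?case using pCons.IH by (simp add: const_ac_def[of a] flip: x_def)
qed simp

lemma transc_x: "transc x"
  by (simp add: transc_def ev_x)

lemma y2: "y ^ 2 = ev f x"
  by (simp add: y ev_x)

lemma y_notin: "y \<notin> kf x"
  by (rule sqrt_not_in_kf[OF transc_x f y2])

lemma range_to_ac: "range to_ac = kf x"
  by (rule kf_range) (auto simp: ev_x intro!: coeff_hom.intro)

lemma range_emb: "range emb = adj (kf x) y"
proof safe
  show "emb (a, b) \<in> adj (kf x) y" for a b
    unfolding emb_def range_to_ac[symmetric] by (intro adjI rangeI)
next
  fix w assume "w \<in> adj (kf x) y"
  then obtain a b where "w = emb (a, b)"
    unfolding adj_def range_to_ac[symmetric] by (auto simp: emb_def)
  thus "w \<in> range emb" by (rule range_eqI)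
qed

lemma inj_emb: "inj emb"
proof (rule injI)
  fix w w' assume eq: "emb w = emb w'"
  have "snd w = snd w'"
  proof (rule ccontr)
    assume "snd w \<noteq> snd w'"
    hence "y = to_ac ((fst w - fst w') / (snd w' - snd w))"
      using eq by (simp add: emb_def field_simps)
    hence "y \<in> range to_ac" by (rule range_eqI)
    thus False using y_notin range_to_ac by simp
  qed
  with eq show "w = w'" by (simp add: emb_def prod_eq_iff)
qed

abbreviation C :: "('k poly fract \<times> 'k poly fract) ring" where
  "C \<equiv> curve_field 0 f"

lemma emb_simps [simp]:
  "emb (\<one>\<^bsub>C\<^esub>) = 1" "emb (\<zero>\<^bsub>C\<^esub>) = 0"
  "emb (v \<oplus>\<^bsub>C\<^esub> w) = emb v + emb w" "emb (v \<otimes>\<^bsub>C\<^esub> w) = emb v * emb w"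
  "emb (constant_fun c) = const_ac c" "w \<in> carrier C"
proof -
  have f': "to_ac (to_fract f) = y * y" using y by (simp add: power2_eq_square)
  show "emb (v \<otimes>\<^bsub>C\<^esub> w) = emb v * emb w"
    by (simp add: emb_def curve_field_def f' algebra_simps)
qed (simp_all add: emb_def curve_field_def constant_fun_def const_ac_def algebra_simps)

lemma emb_eq_iff [simp]: "emb v = emb w \<longleftrightarrow> v = w"
  using inj_emb by (auto dest: injD)

lemma field_C: "field C"
  by (rule field_curve_field_rsquarefree[OF f])

lemma emb_inv: "w \<noteq> \<zero>\<^bsub>C\<^esub> \<Longrightarrow> emb (inv\<^bsub>C\<^esub> w) = inverse (emb w)"
proof -
  interpret C: field C by (rule field_C)
  assume "w \<noteq> \<zero>\<^bsub>C\<^esub>"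
  hence "w \<otimes>\<^bsub>C\<^esub> inv\<^bsub>C\<^esub> w = \<one>\<^bsub>C\<^esub>"
    using C.field_Units by (intro C.Units_r_inv) auto
  hence "emb w * emb (inv\<^bsub>C\<^esub> w) = 1" by (metis emb_simps(1,4))
  thus ?thesis by (metis inverse_unique)
qed

lemma subfield_imp_kfld:
  assumes F: "subfield F C" and c: "range constant_fun \<subseteq> F"
  shows "kfld (emb ` F)"
proof -
  interpret C: field C by (rule field_C)
  note sub = subringE[OF subfieldE(1)[OF F]]
  show ?thesis
    unfolding kfld_def
  proof (intro conjI ballI)
    show "range const_ac \<subseteq> emb ` F"
    proof safe
      fix c' :: 'k
      have "constant_fun c' \<in> F" using c by blast
      moreover have "const_ac c' = emb (constant_fun c')" by simp
      ultimately show "const_ac c' \<in> emb ` F" by (rule rev_image_eqI)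
    qed
  next
    fix v w assume "v \<in> emb ` F" "w \<in> emb ` F"
    then obtain v' w' where vw: "v = emb v'" "v' \<in> F" "w = emb w'" "w' \<in> F" by blast
    show "v + w \<in> emb ` F"
      using sub(7)[OF vw(2,4)] vw by (auto intro!: rev_image_eqI)
    show "v * w \<in> emb ` F"
      using sub(6)[OF vw(2,4)] vw by (auto intro!: rev_image_eqI)
  next
    fix v assume "v \<in> emb ` F"
    then obtain v' where v: "v = emb v'" "v' \<in> F" by blast
    show "inverse v \<in> emb ` F"
    proof (cases "v' = \<zero>\<^bsub>C\<^esub>")
      case True
      thus ?thesis using v by (auto intro: rev_image_eqI)
    next
      case False
      hence "inv\<^bsub>C\<^esub> v' \<in> F" using C.subfield_m_inv(1)[OF F, of v'] v by blast
      thus ?thesis using emb_inv[OF False] v by (auto intro: rev_image_eqI)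
    qed
  qed
qed

text \<open>Dimension 2 unfolds to a basis \<open>v1, v2\<close> over \<open>F\<close>. Dividing by
  \<open>v2\<close> gives a basis \<open>1, e\<close>, and completing the square in the quadratic
  equation of \<open>e\<close> gives \<open>d\<close>.\<close>

lemma degree2_imp_adj:
  assumes F: "degree2_subfield C F"
  obtains d where "d ^ 2 \<in> emb ` F" "d \<notin> emb ` F" "adj (emb ` F) d = adj (kf x) y"
proof -
  interpret C: field C by (rule field_C)
  define S where "S = emb ` F"
  have S: "kfld S"
    using F subfield_imp_kfld unfolding S_def degree2_subfield_def by blast
  have KL: "kfld (adj (kf x) y)"
    by (rule kfld_adj[OF kfld_kf]) (simp add: y2 ev_in_kf)
  have "C.dimension (Suc (Suc 0)) F (carrier C)"
    using F by (simp add: degree2_subfield_def numeral_2_eq_2)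
  then obtain v1 E where v1: "carrier C = C.line_extension F v1 E" "v1 \<notin> E" "C.dimension (Suc 0) F E"
    by (cases rule: C.dimension.cases) auto
  from v1(3) obtain v2 E' where v2: "E = C.line_extension F v2 E'" "v2 \<notin> E'" "C.dimension 0 F E'"
    by (cases rule: C.dimension.cases) auto
  from v2(3) have E': "E' = {\<zero>\<^bsub>C\<^esub>}"
    by (cases rule: C.dimension.cases) auto
  have E: "w \<in> E \<longleftrightarrow> emb w \<in> (\<lambda>k. k * emb v2) ` S" for w
  proof -
    have "w \<in> E \<longleftrightarrow> (\<exists>k\<in>F. emb w = emb (k \<otimes>\<^bsub>C\<^esub> v2 \<oplus>\<^bsub>C\<^esub> \<zero>\<^bsub>C\<^esub>))"
      by (simp add: v2(1) C.line_extension_mem_iff E' del: emb_simps)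
    thus ?thesis by (auto simp: S_def simp del: emb_eq_iff)
  qed
  have all: "\<exists>k\<in>S. \<exists>l\<in>S. emb w = k * emb v1 + l * emb v2" for w
  proof -
    have "w \<in> carrier C" by simp
    hence "w \<in> C.line_extension F v1 E" unfolding v1(1) .
    then obtain k e where ke: "k \<in> F" "e \<in> E" "w = k \<otimes>\<^bsub>C\<^esub> v1 \<oplus>\<^bsub>C\<^esub> e"
      unfolding C.line_extension_mem_iff by blast
    obtain l where l: "l \<in> S" "emb e = l * emb v2" using ke(2) E by blast
    have "emb k \<in> S" using ke(1) by (simp add: S_def)
    moreover have "emb w = emb k * emb v1 + l * emb v2" using ke(3) l(2) by simp
    ultimately show ?thesis using l(1) by blast
  qed
  have v20: "emb v2 \<noteq> 0"
    using v2(2) E' by (metis emb_eq_iff emb_simps(2) singletonI)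
  define e where "e = emb v1 / emb v2"
  have embK: "emb w \<in> adj (kf x) y" for w using range_emb by blast
  have eS: "e \<notin> S"
  proof
    assume "e \<in> S"
    moreover have "emb v1 = e * emb v2" using v20 by (simp add: e_def)
    ultimately show False using v1(2) E by blast
  qed
  have K: "adj S e = adj (kf x) y"
  proof
    have "S \<subseteq> adj (kf x) y" using embK by (auto simp: S_def)
    moreover have "e \<in> adj (kf x) y"
      unfolding e_def by (intro kfld_divide[OF KL] embK)
    ultimately show "adj S e \<subseteq> adj (kf x) y" by (intro adj_subset[OF KL])
    show "adj (kf x) y \<subseteq> adj S e"
    proof
      fix w assume "w \<in> adj (kf x) y"
      hence "w * emb v2 \<in> adj (kf x) y" by (intro kfld_mult[OF KL] embK)
      then obtain w' where w': "w * emb v2 = emb w'"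
        unfolding range_emb[symmetric] by (rule rangeE)
      obtain k l where kl: "k \<in> S" "l \<in> S" "w * emb v2 = k * emb v1 + l * emb v2"
        using all[of w'] w' by auto
      have "w = w * emb v2 / emb v2" using v20 by simp
      also have "\<dots> = l + k * e"
        unfolding kl(3) using v20 by (simp add: e_def add_divide_distrib)
      also have "\<dots> \<in> adj S e" by (intro adjI kl)
      finally show "w \<in> adj S e" .
    qed
  qed
  have "e ^ 2 \<in> adj S e"
    unfolding K using in_adj[OF S, of e] unfolding K by (rule kfld_power[OF KL])
  then obtain \<alpha> \<beta> where \<alpha>\<beta>: "\<alpha> \<in> S" "\<beta> \<in> S" "e ^ 2 = \<alpha> + \<beta> * e" by (auto simp: adj_def)
  define d where "d = e - \<beta> / 2"
  have \<beta>2: "\<beta> / 2 \<in> S" by (intro kfld_intros[OF S] \<alpha>\<beta>)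
  have "(e - h) ^ 2 = e ^ 2 - (2 * h) * e + h ^ 2" for h
    by (simp add: algebra_simps power2_eq_square)
  from this[of "\<beta> / 2"] have "d ^ 2 = e ^ 2 - \<beta> * e + (\<beta> / 2) ^ 2"
    unfolding times_divide_eq_right nonzero_mult_div_cancel_left[OF two_neq_0] d_def .
  also have "\<dots> = \<alpha> + (\<beta> / 2) ^ 2" unfolding \<alpha>\<beta>(3) by simp
  finally have d2: "d ^ 2 = \<alpha> + (\<beta> / 2) ^ 2" .
  have "d ^ 2 \<in> S" unfolding d2 by (intro kfld_intros[OF S] \<alpha>\<beta>)
  moreover have "d \<notin> S"
  proof
    assume "d \<in> S"
    hence "d + \<beta> / 2 \<in> S" by (intro kfld_add[OF S] \<beta>2)
    thus False using eS by (simp add: d_def)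
  qed
  moreover have "adj S d = adj S e"
  proof safe
    fix w assume "w \<in> adj S d"
    then obtain a b where ab: "a \<in> S" "b \<in> S" "w = a + b * d" by (auto simp: adj_def)
    have "w = (a - b * (\<beta> / 2)) + b * e" by (simp add: ab d_def algebra_simps)
    also have "\<dots> \<in> adj S e" by (intro adjI kfld_diff[OF S] kfld_mult[OF S] ab \<beta>2)
    finally show "w \<in> adj S e" .
  next
    fix w assume "w \<in> adj S e"
    then obtain a b where ab: "a \<in> S" "b \<in> S" "w = a + b * e" by (auto simp: adj_def)
    have "w = (a + b * (\<beta> / 2)) + b * d" by (simp add: ab d_def algebra_simps)
    also have "\<dots> \<in> adj S d" by (intro adjI kfld_add[OF S] kfld_mult[OF S] ab \<beta>2)
    finally show "w \<in> adj S d" .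
  qed
  ultimately show ?thesis using that[of d] K by (simp add: S_def)
qed

text \<open>An isomorphism fixing the constants is determined by the images \<open>u\<close> and
  \<open>w\<close> of the two coordinate functions; shifting \<open>w\<close> by half the linear
  term of its equation gives \<open>v\<close>.\<close>

lemma function_field_parameters:
  assumes iso: "is_function_field_of C F E"
  obtains u v where "transc u" "v ^ 2 = ev (weierstrass_cubic E) u" "emb ` F = adj (kf u) v"
proof -
  from iso obtain \<phi> where \<phi>: "\<phi> \<in> ring_iso (weierstrass_field E) (C\<lparr>carrier := F\<rparr>)"
    and \<phi>c: "\<And>c. \<phi> (constant_fun c) = constant_fun c"
    unfolding is_function_field_of_def by blast
  note hom = ring_iso_memE[OF \<phi>]
  define \<Phi> where "\<Phi> = emb \<circ> \<phi>"
  have car: "w \<in> carrier (weierstrass_field E)" for w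
    by (simp add: weierstrass_field_def curve_field_def)
  have \<Phi>_add: "\<Phi> (a + c, b + d) = \<Phi> (a, b) + \<Phi> (c, d)" for a b c d
    using arg_cong[OF hom(3)[OF car car, of "(a, b)" "(c, d)"], of emb]
    by (simp add: \<Phi>_def weierstrass_field_def) (simp add: curve_field_def)
  have \<Phi>_mult: "\<Phi> (a * c + b * d * to_fract [:wa6 E, wa4 E, wa2 E, 1:],
        a * d + b * c - b * d * to_fract [:wa3 E, wa1 E:]) = \<Phi> (a, b) * \<Phi> (c, d)" for a b c d
    using arg_cong[OF hom(2)[OF car car, of "(a, b)" "(c, d)"], of emb]
    by (simp add: \<Phi>_def weierstrass_field_def) (simp add: curve_field_def)
  have \<Phi>_const: "\<Phi> (to_fract [:c:], 0) = const_ac c" for c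
    using \<phi>c[of c] emb_simps(5)[of c] by (simp add: \<Phi>_def constant_fun_def)
  have \<Phi>_1: "\<Phi> (1, 0) = 1"
    using \<Phi>_const[of 1] by (simp flip: one_pCons)
  have hom1: "coeff_hom (\<lambda>a. \<Phi> (a, 0))"
  proof
    show "\<Phi> (1, 0) = 1" by (rule \<Phi>_1)
    show "\<Phi> (a + b, 0) = \<Phi> (a, 0) + \<Phi> (b, 0)" for a b
      using \<Phi>_add[of a b 0 0] by simp
    show "\<Phi> (a * b, 0) = \<Phi> (a, 0) * \<Phi> (b, 0)" for a b
      using \<Phi>_mult[of a b 0 0] by simp
  qed
  interpret \<Phi>: coeff_hom "\<lambda>a. \<Phi> (a, 0)" by (rule hom1)
  define u where "u = \<Phi> (to_fract [:0, 1:], 0)"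
  define w where "w = \<Phi> (0, 1)"
  have ev_u: "\<Phi> (to_fract p, 0) = ev p u" for p
  proof (induction p)
    case 0
    show ?case using \<Phi>.zero by simp
  next
    case (pCons a p)
    have "pCons a p = [:a:] + [:0, 1:] * p" by simp
    hence "to_fract (pCons a p) = to_fract [:a:] + to_fract [:0, 1:] * to_fract p"
      by (simp only: to_fract_add to_fract_mult)
    hence "\<Phi> (to_fract (pCons a p), 0) = \<Phi> (to_fract [:a:], 0) + u * \<Phi> (to_fract p, 0)"
      by (simp only: \<Phi>.add \<Phi>.mult u_def)
    thus ?case using pCons.IH \<Phi>_const[of a] by simp
  qed
  have \<Phi>_eq: "\<Phi> (a, b) = \<Phi> (a, 0) + \<Phi> (b, 0) * w" for a b
    using \<Phi>_add[of a 0 0 b] \<Phi>_mult[of b 0 0 1] by (simp add: w_def)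
  have "\<Phi> (0, 0) = 0" using \<Phi>.zero .
  have inj: "inj \<Phi>"
    unfolding \<Phi>_def using inj_emb hom(5)
    by (intro inj_compose) (auto simp: bij_betw_def weierstrass_field_def curve_field_def)
  have "transc u"
    unfolding transc_def
  proof (intro allI impI)
    fix p assume "ev p u = 0"
    hence "\<Phi> (to_fract p, 0) = \<Phi> (0, 0)" using ev_u \<Phi>.zero by simp
    hence "(to_fract p, 0::'k poly fract) = (0, 0)" using inj by (rule injD[rotated])
    thus "p = 0" by simp
  qed
  define r where "r = ev [:wa3 E, wa1 E:] u"
  have w2: "w ^ 2 + r * w = ev [:wa6 E, wa4 E, wa2 E, 1:] u"
  proof -
    have "w * w = \<Phi> (to_fract [:wa6 E, wa4 E, wa2 E, 1:], - to_fract [:wa3 E, wa1 E:])"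
      using \<Phi>_mult[of 0 0 1 1] by (simp add: w_def)
    also have "\<dots> = ev [:wa6 E, wa4 E, wa2 E, 1:] u - r * w"
      unfolding \<Phi>_eq[of _ "- _"] \<Phi>.minus ev_u r_def by (simp add: algebra_simps)
    finally show ?thesis by (simp add: power2_eq_square)
  qed
  define v where "v = w + r / 2"
  have "(w + h) ^ 2 = (w ^ 2 + (2 * h) * w) + h ^ 2" for h
    by (simp add: algebra_simps power2_eq_square)
  from this[of "r / 2"] have "v ^ 2 = (w ^ 2 + r * w) + (r / 2) ^ 2"
    unfolding times_divide_eq_right nonzero_mult_div_cancel_left[OF two_neq_0] v_def .
  also have "\<dots> = ev ([:wa6 E, wa4 E, wa2 E, 1:] + smult (1 / 4) ([:wa3 E, wa1 E:] ^ 2)) u"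
    unfolding w2 by (simp add: r_def power_divide)
  also have "[:wa6 E, wa4 E, wa2 E, 1:] + smult (1 / 4) ([:wa3 E, wa1 E:] ^ 2) = weierstrass_cubic E"
    by (simp add: weierstrass_cubic_def wb2_def wb4_def wb6_def power2_eq_square field_simps)
  finally have v2: "v ^ 2 = ev (weierstrass_cubic E) u" .
  have "range \<Phi> = adj (kf u) v"
  proof -
    have kf: "range (\<lambda>a. \<Phi> (a, 0)) = kf u"
      by (rule kf_range[OF hom1 ev_u])
    have r: "r / 2 \<in> kf u" unfolding r_def by (intro kfld_divide[OF kfld_kf] kfld_numeral[OF kfld_kf] ev_in_kf)
    show ?thesis
    proof safe
      fix a b
      have ab: "\<Phi> (a, 0) \<in> kf u" "\<Phi> (b, 0) \<in> kf u" using kf by auto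
      have "\<Phi> (a, b) = (\<Phi> (a, 0) - \<Phi> (b, 0) * (r / 2)) + \<Phi> (b, 0) * v"
        unfolding \<Phi>_eq[of a b] by (simp add: v_def algebra_simps)
      also have "\<dots> \<in> adj (kf u) v"
        by (intro adjI kfld_diff[OF kfld_kf] kfld_mult[OF kfld_kf] ab r)
      finally show "\<Phi> (a, b) \<in> adj (kf u) v" .
    next
      fix z assume "z \<in> adj (kf u) v"
      then obtain a b where ab: "a \<in> kf u" "b \<in> kf u" "z = a + b * v" by (auto simp: adj_def)
      have "a + b * (r / 2) \<in> range (\<lambda>a. \<Phi> (a, 0))"
        unfolding kf by (intro kfld_add[OF kfld_kf] kfld_mult[OF kfld_kf] ab r)
      then obtain a' where a': "a + b * (r / 2) = \<Phi> (a', 0)" by (rule rangeE)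
      have "b \<in> range (\<lambda>a. \<Phi> (a, 0))" unfolding kf by (rule ab)
      then obtain b' where b': "b = \<Phi> (b', 0)" by (rule rangeE)
      have "z = (a + b * (r / 2)) + b * w" by (simp add: ab v_def algebra_simps)
      also have "\<dots> = \<Phi> (a', b')" by (subst \<Phi>_eq) (simp only: a'[symmetric] b'[symmetric])
      finally show "z \<in> range \<Phi>" by (rule range_eqI)
    qed
  qed
  moreover have "\<phi> ` UNIV = F"
    using hom(5) by (simp add: bij_betw_def weierstrass_field_def curve_field_def)
  hence "range \<Phi> = emb ` F" by (auto simp: \<Phi>_def simp flip: image_comp)
  ultimately have "emb ` F = adj (kf u) v" by simp
  thus ?thesis by (rule that[OF \<open>transc u\<close> v2])
qed

end

text \<open>Ensures that the index is 2 and not 1. As \<open>w\<close> is not in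
  \<open>k(z)\<close>, the \<open>w\<close>-part vanishes and \<open>z\<close> would lie in
  \<open>k(z^2)\<close>; comparing degrees then equates an odd with an even number.\<close>

lemma (in flipped_coordinates) z_notin_adj:
  assumes y: "y \<notin> kf x" and U: "U \<in> kf (z ^ 2)" and V: "V \<in> kf (z ^ 2)"
    and z: "z = U + V * (\<iota> c * w)" and c: "c \<noteq> 0"
  shows False
proof -
  note F = kfld_intros[OF kfld_kf[of z]]
  have "kf (z ^ 2) \<subseteq> kf z" by (intro kf_subset[OF kfld_kf] F in_kf)
  hence UV: "U \<in> kf z" "V \<in> kf z" using U V by auto
  have wz: "w \<notin> kf z"
  proof
    assume "w \<in> kf z"
    have "y \<in> kf z" by (subst y_eq) (intro F in_kf \<open>w \<in> kf z\<close>)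
    thus False using y kf_subset[OF kfld_kf z_in_kf] by blast
  qed
  have "V = 0"
  proof (rule ccontr)
    assume "V \<noteq> 0"
    hence "w = (z - U) / (V * \<iota> c)" using z c by (simp add: field_simps)
    also have "\<dots> \<in> kf z" by (intro F in_kf UV)
    finally show False using wz by simp
  qed
  hence "z \<in> kf (z ^ 2)" using z U by simp
  then obtain p q where pq: "z = ev p (z ^ 2) / ev q (z ^ 2)" "ev q (z ^ 2) \<noteq> 0" by (rule kf_cases)
  define P Q where "P = pcompose p [:0, 0, 1:]" and "Q = pcompose q [:0, 0, 1:]"
  have "z * ev q (z ^ 2) = ev p (z ^ 2)" using pq by (metis nonzero_eq_divide_eq)
  hence "ev (pCons 0 Q) z = ev P z"
    by (simp add: P_def Q_def ev_pcompose power2_eq_square)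
  hence eq: "pCons 0 Q = P" using transc_eq_iff[OF transc_z] by blast
  have "ev Q z \<noteq> 0" using pq(2) by (simp add: Q_def ev_pcompose power2_eq_square)
  hence "Q \<noteq> 0" by auto
  hence "degree P = Suc (degree Q)" using eq by (metis degree_pCons_eq)
  hence "degree p * 2 = Suc (degree q * 2)"
    by (simp add: P_def Q_def degree_pcompose)
  thus False by presburger
qed

section \<open>Realising the quotients as elliptic subfields of degree 2\<close>

context curve_embedding
begin

lemma elliptic_involutionI:
  assumes deg: "degree f \<ge> 5" "degree f \<le> 6" and F: "degree2_subfield C F"
    and E: "elliptic_curve E" and iso: "is_function_field_of C F E"
  obtains d u v where "elliptic_involution const_ac (emb ` F) d f x y (weierstrass_cubic E) u v"
proof -
  obtain d where d: "d ^ 2 \<in> emb ` F" "d \<notin> emb ` F" "adj (emb ` F) d = adj (kf x) y"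
    using degree2_imp_adj[OF F] .
  obtain u v where uv: "transc u" "v ^ 2 = ev (weierstrass_cubic E) u" "emb ` F = adj (kf u) v"
    using function_field_parameters[OF iso] .
  have kF: "kfld (emb ` F)"
    using F subfield_imp_kfld unfolding degree2_subfield_def by blast
  interpret involution const_ac "emb ` F" d
    using kF d(1,2) by unfold_locales
  have disc: "quartic_disc (weierstrass_cubic E) \<noteq> 0"
    using E by (simp add: weierstrass_cubic_invariants elliptic_curve_def)
  have Kd: "K = adj (kf x) y" unfolding K_def by (rule d(3))
  have "elliptic_involution const_ac (emb ` F) d f x y (weierstrass_cubic E) u v"
    by (intro elliptic_involution.intro involution_axioms elliptic_involution_axioms.intro
          transc_x f(1) deg y2 Kd uv weierstrass_cubic_invariants(3) disc)
  thus ?thesis by (rule that)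
qed

lemma subfieldI_kfld:
  assumes S: "kfld S" "S \<subseteq> adj (kf x) y"
  shows "subfield (emb -` S) C"
proof -
  interpret C: field C by (rule field_C)
  show ?thesis
  proof (rule C.subfieldI')
    show "subring (emb -` S) C"
    proof (rule C.subringI)
      fix h assume h: "h \<in> emb -` S"
      have "emb (\<ominus>\<^bsub>C\<^esub> h) + emb h = emb (\<ominus>\<^bsub>C\<^esub> h \<oplus>\<^bsub>C\<^esub> h)" by (simp only: emb_simps)
      also have "\<dots> = 0" using C.l_neg[of h] by (simp del: emb_simps(3))
      finally have "emb (\<ominus>\<^bsub>C\<^esub> h) = - emb h" by (simp add: eq_neg_iff_add_eq_0)
      thus "\<ominus>\<^bsub>C\<^esub> h \<in> emb -` S" using h kfld_uminus[OF S(1)] by simp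
    qed (use kfld_1[OF S(1)] kfld_mult[OF S(1)] kfld_add[OF S(1)] in auto)
    fix k assume "k \<in> emb -` S - {\<zero>\<^bsub>C\<^esub>}"
    thus "inv\<^bsub>C\<^esub> k \<in> emb -` S"
      using emb_inv[of k] kfld_inverse[OF S(1)] by simp
  qed
qed

text \<open>The basis is \<open>1, z\<close>: the zero space is extended first by the unit, giving
  the subfield itself, and then by \<open>z\<close>.\<close>

lemma degree2_subfieldI:
  assumes S: "kfld S" "S \<subseteq> adj (kf x) y" and z: "z \<notin> S" "adj S z = adj (kf x) y"
  shows "degree2_subfield C (emb -` S)"
  unfolding degree2_subfield_def
proof (intro conjI)
  interpret C: field C by (rule field_C)
  show "subfield (emb -` S) C" by (rule subfieldI_kfld[OF S])
  show "range constant_fun \<subseteq> emb -` S" using kfld_const[OF S(1)] by auto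
  have "z \<in> range emb" unfolding range_emb z(2)[symmetric] by (rule in_adj[OF S(1)])
  then obtain z' where z': "z = emb z'" by (rule rangeE)
  let ?F = "emb -` S"
  have 1: "C.line_extension ?F \<one>\<^bsub>C\<^esub> {\<zero>\<^bsub>C\<^esub>} = ?F"
    by (auto simp: C.line_extension_mem_iff)
  have 2: "C.line_extension ?F z' ?F = carrier C"
  proof (intro equalityI subsetI)
    fix w assume "w \<in> carrier C"
    have "emb w \<in> adj S z" unfolding z(2) range_emb[symmetric] by (rule rangeI)
    then obtain a b where ab: "a \<in> S" "b \<in> S" "emb w = a + b * z" by (auto simp: adj_def)
    have "a \<in> range emb" "b \<in> range emb" using ab S(2) unfolding range_emb by auto
    then obtain a' b' where ab': "a = emb a'" "b = emb b'" by (auto elim!: rangeE)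
    have "emb w = emb (b' \<otimes>\<^bsub>C\<^esub> z' \<oplus>\<^bsub>C\<^esub> a')" using ab(3) by (simp add: ab' z' del: emb_eq_iff)
    hence "w = b' \<otimes>\<^bsub>C\<^esub> z' \<oplus>\<^bsub>C\<^esub> a'" unfolding emb_eq_iff .
    moreover have "a' \<in> ?F" "b' \<in> ?F" using ab ab' by auto
    ultimately show "w \<in> C.line_extension ?F z' ?F"
      unfolding C.line_extension_mem_iff by blast
  qed simp
  have "C.dimension (Suc 0) ?F (C.line_extension ?F \<one>\<^bsub>C\<^esub> {\<zero>\<^bsub>C\<^esub>})"
    by (intro C.Suc_dim C.zero_dim) auto
  hence "C.dimension (Suc 0) ?F ?F" unfolding 1 .
  hence "C.dimension (Suc (Suc 0)) ?F (C.line_extension ?F z' ?F)"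
    using z(1) by (intro C.Suc_dim) (auto simp: z')
  thus "C.dimension 2 ?F (carrier C)" unfolding 2 by (simp add: numeral_2_eq_2)
qed

lemma is_function_field_ofI:
  assumes u: "transc u" and v: "v \<notin> kf u"
    and E: "wa1 E = 0" "wa3 E = 0" "v ^ 2 = ev [:wa6 E, wa4 E, wa2 E, 1:] u"
    and S: "adj (kf u) v \<subseteq> adj (kf x) y"
  shows "is_function_field_of C (emb -` adj (kf u) v) E"
proof -
  interpret R: coeff_hom "rat_ev u" by (rule coeff_hom_rat_ev[OF u])
  note Rp = rat_ev_to_fract[OF u]
  have range_R: "range (rat_ev u) = kf u" by (rule kf_range[OF coeff_hom_rat_ev[OF u] Rp])
  define \<Phi> where "\<Phi> w = rat_ev u (fst w) + rat_ev u (snd w) * v" for w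
  have R0: "a = 0" if "rat_ev u a = 0" for a
  proof -
    obtain p q where a: "a = Fract p q" "q \<noteq> 0" by (cases a) auto
    have "ev p u / ev q u = 0" using that unfolding a(1) rat_ev_Fract[OF u a(2)] .
    hence "p = 0" using transc_eq_0_iff[OF u] a(2) by simp
    thus ?thesis using a by (simp add: fract_collapse)
  qed
  have inj: "inj \<Phi>"
  proof (rule injI)
    fix w w' assume eq: "\<Phi> w = \<Phi> w'"
    define a b where "a = fst w - fst w'" and "b = snd w - snd w'"
    have eq': "rat_ev u a + rat_ev u b * v = 0"
      using eq by (simp add: \<Phi>_def a_def b_def algebra_simps)
    have "b = 0"
    proof (rule ccontr)
      assume "b \<noteq> 0"
      hence "rat_ev u b \<noteq> 0" using R0 by blast
      hence "v = - rat_ev u a / rat_ev u b" using eq' by (simp add: field_simps eq_neg_iff_add_eq_0)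
      also have "\<dots> \<in> kf u" using range_R by (intro kfld_intros[OF kfld_kf]) auto
      finally show False using v by simp
    qed
    moreover from this have "a = 0" using eq' by (intro R0) simp
    ultimately show "w = w'" by (simp add: a_def b_def prod_eq_iff)
  qed
  have range_\<Phi>: "range \<Phi> = adj (kf u) v"
  proof safe
    show "\<Phi> (a, b) \<in> adj (kf u) v" for a b
      unfolding \<Phi>_def range_R[symmetric] by (intro adjI rangeI)
  next
    fix w assume "w \<in> adj (kf u) v"
    then obtain a b where "w = \<Phi> (a, b)"
      unfolding adj_def range_R[symmetric] by (auto simp: \<Phi>_def)
    thus "w \<in> range \<Phi>" by (rule range_eqI)
  qed
  \<comment> \<open>The map is built in the ambient field, where the ring laws are ordinary field
    arithmetic, and then pulled back along the injective \<open>emb\<close>.\<close>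
  define \<phi> where "\<phi> = inv_into UNIV emb \<circ> \<Phi>"
  have emb_\<phi>: "emb (\<phi> w) = \<Phi> w" for w
  proof -
    have "\<Phi> w \<in> range emb" unfolding range_emb using S range_\<Phi> by blast
    thus ?thesis by (simp add: \<phi>_def f_inv_into_f)
  qed
  have \<phi>I: "\<phi> w = w'" if "\<Phi> w = emb w'" for w w'
    using that emb_\<phi>[of w] by simp
  have v2: "rat_ev u (to_fract [:wa6 E, wa4 E, wa2 E, 1:]) = v * v"
    unfolding Rp E(3)[symmetric] by (rule power2_eq_square)
  have E13: "to_fract [:wa3 E, wa1 E:] = 0" by (simp add: E)
  show ?thesis
    unfolding is_function_field_of_def
  proof (rule bexI[of _ \<phi>], intro allI)
    show "\<phi> (constant_fun c) = constant_fun c" for c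
      by (rule \<phi>I) (simp add: \<Phi>_def constant_fun_def Rp flip: emb_simps(5))
    show "\<phi> \<in> ring_iso (weierstrass_field E) (C\<lparr>carrier := emb -` adj (kf u) v\<rparr>)"
    proof (rule ring_iso_memI)
      fix w assume "w \<in> carrier (weierstrass_field E)"
      show "\<phi> w \<in> carrier (C\<lparr>carrier := emb -` adj (kf u) v\<rparr>)"
        using range_\<Phi> by (auto simp: emb_\<phi>)
      fix w' assume "w' \<in> carrier (weierstrass_field E)"
      have "\<Phi> (w \<otimes>\<^bsub>weierstrass_field E\<^esub> w') = \<Phi> w * \<Phi> w'"
        by (simp add: \<Phi>_def weierstrass_field_def curve_field_def E13 v2 algebra_simps)
      hence "\<phi> (w \<otimes>\<^bsub>weierstrass_field E\<^esub> w') = \<phi> w \<otimes>\<^bsub>C\<^esub> \<phi> w'"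
        by (intro \<phi>I) (simp add: emb_\<phi>)
      thus "\<phi> (w \<otimes>\<^bsub>weierstrass_field E\<^esub> w') = \<phi> w \<otimes>\<^bsub>C\<lparr>carrier := emb -` adj (kf u) v\<rparr>\<^esub> \<phi> w'"
        by simp
      have "\<Phi> (w \<oplus>\<^bsub>weierstrass_field E\<^esub> w') = \<Phi> w + \<Phi> w'"
        by (simp add: \<Phi>_def weierstrass_field_def curve_field_def algebra_simps)
      hence "\<phi> (w \<oplus>\<^bsub>weierstrass_field E\<^esub> w') = \<phi> w \<oplus>\<^bsub>C\<^esub> \<phi> w'"
        by (intro \<phi>I) (simp add: emb_\<phi>)
      thus "\<phi> (w \<oplus>\<^bsub>weierstrass_field E\<^esub> w') = \<phi> w \<oplus>\<^bsub>C\<lparr>carrier := emb -` adj (kf u) v\<rparr>\<^esub> \<phi> w'"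
        by simp
    next
      have "\<Phi> (\<one>\<^bsub>weierstrass_field E\<^esub>) = 1"
        by (simp add: \<Phi>_def weierstrass_field_def curve_field_def)
      hence "\<phi> (\<one>\<^bsub>weierstrass_field E\<^esub>) = \<one>\<^bsub>C\<^esub>"
        by (intro \<phi>I) simp
      thus "\<phi> (\<one>\<^bsub>weierstrass_field E\<^esub>) = \<one>\<^bsub>C\<lparr>carrier := emb -` adj (kf u) v\<rparr>\<^esub>"
        by simp
    next
      have "\<phi> ` UNIV = emb -` adj (kf u) v"
      proof (intro equalityI subsetI)
        fix w assume "w \<in> \<phi> ` UNIV"
        then obtain w' where "w = \<phi> w'" by blast
        thus "w \<in> emb -` adj (kf u) v" by (simp add: emb_\<phi> flip: range_\<Phi>)
      next
        fix w assume "w \<in> emb -` adj (kf u) v"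
        hence "emb w \<in> range \<Phi>" by (simp add: range_\<Phi>)
        then obtain w' where "emb w = \<Phi> w'" by (rule rangeE)
        hence "\<phi> w' = w" by (intro \<phi>I) simp
        thus "w \<in> \<phi> ` UNIV" by blast
      qed
      moreover have "inj \<phi>"
        using inj emb_\<phi> by (metis injD injI)
      ultimately show "bij_betw \<phi> (carrier (weierstrass_field E)) (carrier (C\<lparr>carrier := emb -` adj (kf u) v\<rparr>))"
        by (simp add: bij_betw_def weierstrass_field_def curve_field_def)
    qed
  qed
qed

text \<open>The converse direction: the value is attained by the subfield
  \<open>k(z^2, w)\<close>.\<close>

lemma quotient_j_invariant:
  assumes fl: "flipped_coordinates const_ac x \<gamma> \<epsilon>"
    and w2: "flipped_coordinates.w const_ac x y \<gamma> \<epsilon> ^ 2 = ev [:a, b, c, d:] (flipped_coordinates.z const_ac x \<gamma> ^ 2)"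
    and h: "d \<noteq> 0" "quartic_disc [:a, b, c, d:] \<noteq> 0"
  shows "quartic_j [:a, b, c, d:] \<in> degree2_elliptic_j_invariants C"
proof -
  interpret flipped_coordinates const_ac x y \<gamma> \<epsilon> by (rule fl)
  \<comment> \<open>Multiplying \<open>w^2 = h(z^2)\<close> by \<open>d^2\<close> makes the cubic
    monic in \<open>d z^2\<close>; this leaves \<open>I\<close> and \<open>J\<close>
    unchanged.\<close>
  define E where "E = Weierstrass 0 c 0 (d * b) (d ^ 2 * a)"
  have cubic: "weierstrass_cubic E = [:d ^ 2 * a, d * b, c, 1:]"
    by (simp add: E_def weierstrass_cubic_def wb2_def wb4_def wb6_def)
  have I: "quartic_I (weierstrass_cubic E) = quartic_I [:a, b, c, d:]"
    and J: "quartic_J (weierstrass_cubic E) = quartic_J [:a, b, c, d:]"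
    unfolding cubic by (simp_all add: quartic_I_def quartic_J_def eval_nat_numeral)
  have disc: "quartic_disc (weierstrass_cubic E) = quartic_disc [:a, b, c, d:]"
    by (simp add: quartic_disc_def I J)
  have j: "j_invariant E = quartic_j [:a, b, c, d:]"
    unfolding quartic_j_weierstrass_cubic[symmetric] quartic_j_def I disc ..
  have ell: "elliptic_curve E"
    using h(2) unfolding disc[symmetric] weierstrass_cubic_invariants(2) elliptic_curve_def by auto
  define u where "u = const_ac d * z ^ 2"
  define v where "v = const_ac d * w"
  have d0: "const_ac d \<noteq> 0" using h(1) by simp
  have zu: "z ^ 2 \<in> kf u"
  proof -
    have "z ^ 2 = u / const_ac d" using d0 by (simp add: u_def)
    also have "\<dots> \<in> kf u" by (intro kfld_intros[OF kfld_kf] in_kf)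
    finally show ?thesis .
  qed
  have uz: "u \<in> kf (z ^ 2)"
    unfolding u_def by (intro kfld_mult[OF kfld_kf] kfld_const[OF kfld_kf] in_kf)
  have kf_u: "kf u = kf (z ^ 2)" by (rule kf_eqI[OF uz zu])
  have tu: "transc u" by (rule transc_in_kf[OF transc_z2 zu])
  have v2: "v ^ 2 = ev [:d ^ 2 * a, d * b, c, 1:] u"
    unfolding v_def u_def power_mult_distrib w2
    by (simp add: algebra_simps power2_eq_square)
  define S where "S = adj (kf u) v"
  have S: "kfld S"
    unfolding S_def by (rule kfld_adj[OF kfld_kf]) (simp only: v2 ev_in_kf)
  have K: "kfld (adj (kf x) y)" by (rule kfld_adj[OF kfld_kf]) (simp only: y2 ev_in_kf)
  have zK: "z \<in> adj (kf x) y" using subset_adj[OF kfld_kf] z_in_kf by blast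
  have wK: "w \<in> adj (kf x) y"
    unfolding w_def by (intro kfld_intros[OF K] zK in_adj[OF kfld_kf])
  have SK: "S \<subseteq> adj (kf x) y"
    unfolding S_def u_def v_def
    by (intro adj_subset[OF K] kf_subset[OF K] kfld_intros[OF K] zK wK)
  have z2S: "z ^ 2 \<in> S" unfolding S_def using subset_adj[OF kfld_kf] zu by blast
  have wS: "w \<in> S"
  proof -
    have "w = v / const_ac d" using d0 by (simp add: v_def)
    also have "\<dots> \<in> S"
      by (intro kfld_divide[OF S] kfld_const[OF S]) (simp add: S_def in_adj[OF kfld_kf])
    finally show ?thesis .
  qed
  have T: "kfld (adj S z)" by (rule kfld_adj[OF S z2S])
  have gen: "adj S z = adj (kf x) y"
  proof
    show "adj S z \<subseteq> adj (kf x) y" by (rule adj_subset[OF K SK zK])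
    show "adj (kf x) y \<subseteq> adj S z"
      by (rule adj_kf_subset[OF T in_adj[OF S]]) (use subset_adj[OF S] wS in blast)
  qed
  have zS: "z \<notin> S"
  proof
    assume "z \<in> S"
    then obtain U V where UV: "U \<in> kf (z ^ 2)" "V \<in> kf (z ^ 2)" "z = U + V * (const_ac d * w)"
      unfolding S_def kf_u v_def adj_def by blast
    show False by (rule z_notin_adj[OF y_notin UV h(1)])
  qed
  have vu: "v \<notin> kf u"
  proof
    assume "v \<in> kf u"
    have "quartic_disc [:d ^ 2 * a, d * b, c, 1:] \<noteq> 0" using h(2) disc cubic by simp
    hence "rsquarefree [:d ^ 2 * a, d * b, c, 1:]" by (intro rsquarefree_cubic) auto
    thus False using sqrt_not_in_kf[OF tu _ _ v2] \<open>v \<in> kf u\<close> by simp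
  qed
  have "is_function_field_of C (emb -` S) E"
    unfolding S_def
    by (rule is_function_field_ofI[OF tu vu]) (use v2 SK in \<open>simp_all add: E_def S_def\<close>)
  moreover have "degree2_subfield C (emb -` S)"
    by (rule degree2_subfieldI[OF S SK zS gen])
  ultimately show ?thesis
    unfolding degree2_elliptic_j_invariants_def j[symmetric] using ell by blast
qed

end

section \<open>The sets of j-invariants of the two families\<close>

lemma ex_curve_embedding:
  fixes f :: "'k::{alg_closed_field,field_char_0} poly"
  assumes "rsquarefree f" "degree f > 0"
  obtains y where "curve_embedding f y"
proof -
  obtain y :: "'k poly fract alg_closure" where "y ^ 2 = to_ac (to_fract f)"
    using nth_root_exists[of 2 "to_ac (to_fract f)"] by auto
  thus ?thesis using assms by (intro that[of y] curve_embedding.intro)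
qed

lemma quintic_j_invariants:
  fixes t :: "'k::{alg_closed_field,field_char_0}"
  assumes t: "t \<notin> {0, 1 / 4, 9 / 100}"
  shows "degree2_elliptic_j_invariants (curve_field 0 (quintic t)) = {j_quintic \<beta> | \<beta>. \<beta> ^ 2 = t}"
proof -
  have f: "rsquarefree (quintic t)" "degree (quintic t) > 0"
    using t rsquarefree_quintic[of t] by (auto simp: degree_quintic)
  obtain y where "curve_embedding (quintic t) y"
    using ex_curve_embedding[OF f] .
  then interpret curve_embedding "quintic t" y .
  show ?thesis
  proof safe
    fix j assume "j \<in> degree2_elliptic_j_invariants C"
    then obtain F E where FE: "j = j_invariant E" "degree2_subfield C F" "elliptic_curve E"
      "is_function_field_of C F E"
      unfolding degree2_elliptic_j_invariants_def by blast
    obtain d u v where "elliptic_involution const_ac (emb ` F) d (quintic t) x y (weierstrass_cubic E) u v"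
      using elliptic_involutionI[OF _ _ FE(2-4)] by (auto simp: degree_quintic)
    then interpret elliptic_involution const_ac "emb ` F" d "quintic t" x y "weierstrass_cubic E" u v .
    obtain \<beta> where "\<beta> ^ 2 = t" "quartic_j (weierstrass_cubic E) = j_quintic \<beta>"
      using quintic_j[OF refl t] .
    thus "\<exists>\<beta>. j = j_quintic \<beta> \<and> \<beta> ^ 2 = t"
      by (auto simp: FE(1) quartic_j_weierstrass_cubic)
  next
    fix \<beta> assume \<beta>: "t = \<beta> ^ 2"
    have \<beta>0: "\<beta> \<noteq> 0" using t \<beta> by auto
    obtain \<gamma> where \<gamma>: "\<gamma> ^ 2 = \<beta>" using nth_root_exists[of 2 \<beta>] by auto
    obtain \<epsilon> where \<epsilon>: "\<epsilon> ^ 2 = \<gamma> ^ 3" using nth_root_exists[of 2 "\<gamma> ^ 3"] by auto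
    have \<gamma>0: "\<gamma> \<noteq> 0" using \<gamma> \<beta>0 by auto
    have \<gamma>4: "\<gamma> ^ 4 = t" unfolding \<beta> \<gamma>[symmetric] by (simp flip: power_mult)
    have fl: "flipped_coordinates const_ac x \<gamma> \<epsilon>"
      using transc_x \<gamma>0 \<epsilon> by unfold_locales
    have nz: "2 * \<beta> + 1 \<noteq> 0" "2 * \<beta> - 1 \<noteq> 0"
    proof -
      have "(2 * \<beta> + 1) * (2 * \<beta> - 1) = 4 * t - 1"
        unfolding \<beta> by (simp add: algebra_simps power2_eq_square)
      also have "\<dots> \<noteq> 0" using t by (auto simp: field_simps)
      finally show "2 * \<beta> + 1 \<noteq> 0" "2 * \<beta> - 1 \<noteq> 0" by auto
    qed
    have "quartic_j (quintic_quotient \<beta>) \<in> degree2_elliptic_j_invariants C"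
      unfolding quintic_quotient_def
    proof (rule quotient_j_invariant[OF fl])
      show "flipped_coordinates.w const_ac x y \<gamma> \<epsilon> ^ 2
          = ev [:2 * \<beta> + 1, 10 * \<beta> - 3, 3 - 10 * \<beta>, - (2 * \<beta> + 1):] (flipped_coordinates.z const_ac x \<gamma> ^ 2)"
        using flipped_coordinates.w2_quintic[OF fl, of y] y2
        unfolding \<gamma>4 \<gamma> quintic_quotient_def by blast
      show "quartic_disc [:2 * \<beta> + 1, 10 * \<beta> - 3, 3 - 10 * \<beta>, - (2 * \<beta> + 1):] \<noteq> 0"
        unfolding quintic_quotient_def[symmetric] quintic_quotient_invariants using \<beta>0 nz by simp
      show "- (2 * \<beta> + 1) \<noteq> 0" using nz(1) by (simp only: neg_equal_0_iff_equal not_False_eq_True)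
    qed
    thus "j_quintic \<beta> \<in> degree2_elliptic_j_invariants (curve_field 0 (quintic (\<beta> ^ 2)))"
      unfolding quartic_j_quintic_quotient[OF \<beta>0] \<beta> .
  qed
qed

lemma sextic_j_invariants:
  fixes t :: "'k::{alg_closed_field,field_char_0}"
  assumes t: "t \<notin> {0, 1 / 4, - (1 / 50)}"
  shows "degree2_elliptic_j_invariants (curve_field 0 (sextic t)) = {j_sextic \<delta> | \<delta>. \<delta> ^ 2 = t}"
proof -
  have f: "rsquarefree (sextic t)" "degree (sextic t) > 0"
    using t rsquarefree_sextic[of t] by (auto simp: degree_sextic)
  obtain y where "curve_embedding (sextic t) y"
    using ex_curve_embedding[OF f] .
  then interpret curve_embedding "sextic t" y .
  show ?thesis
  proof safe
    fix j assume "j \<in> degree2_elliptic_j_invariants C"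
    then obtain F E where FE: "j = j_invariant E" "degree2_subfield C F" "elliptic_curve E"
      "is_function_field_of C F E"
      unfolding degree2_elliptic_j_invariants_def by blast
    obtain d u v where "elliptic_involution const_ac (emb ` F) d (sextic t) x y (weierstrass_cubic E) u v"
      using elliptic_involutionI[OF _ _ FE(2-4)] by (auto simp: degree_sextic)
    then interpret elliptic_involution const_ac "emb ` F" d "sextic t" x y "weierstrass_cubic E" u v .
    obtain \<delta> where "\<delta> ^ 2 = t" "quartic_j (weierstrass_cubic E) = j_sextic \<delta>"
      using sextic_j[OF refl t] .
    thus "\<exists>\<delta>. j = j_sextic \<delta> \<and> \<delta> ^ 2 = t"
      by (auto simp: FE(1) quartic_j_weierstrass_cubic)
  next
    fix \<delta> assume \<delta>: "t = \<delta> ^ 2"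
    have \<delta>0: "\<delta> \<noteq> 0" using t \<delta> by auto
    \<comment> \<open>A \<open>\<gamma>\<close> is chosen for each square root
      \<open>\<delta>\<close> separately, so \<open>k(z^2, w)\<close> alone realises both values and
      the reversed cubic does not enter here.\<close>
    obtain \<gamma> where \<gamma>: "\<gamma> ^ 3 = \<delta>" using nth_root_exists[of 3 \<delta>] by auto
    obtain \<epsilon> where \<epsilon>: "\<epsilon> ^ 2 = \<gamma> ^ 3" using nth_root_exists[of 2 "\<gamma> ^ 3"] by auto
    have \<gamma>0: "\<gamma> \<noteq> 0" using \<gamma> \<delta>0 by auto
    have \<gamma>6: "\<gamma> ^ 6 = t" unfolding \<delta> \<gamma>[symmetric] by (simp flip: power_mult)
    have fl: "flipped_coordinates const_ac x \<gamma> \<epsilon>"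
      using transc_x \<gamma>0 \<epsilon> by unfold_locales
    have nz: "2 * \<delta> + 1 \<noteq> 0" "2 * \<delta> - 1 \<noteq> 0"
    proof -
      have "(2 * \<delta> + 1) * (2 * \<delta> - 1) = 4 * t - 1"
        unfolding \<delta> by (simp add: algebra_simps power2_eq_square)
      also have "\<dots> \<noteq> 0" using t by (auto simp: field_simps)
      finally show "2 * \<delta> + 1 \<noteq> 0" "2 * \<delta> - 1 \<noteq> 0" by auto
    qed
    have "quartic_j (sextic_quotient \<delta>) \<in> degree2_elliptic_j_invariants C"
      unfolding sextic_quotient_def
    proof (rule quotient_j_invariant[OF fl])
      show "flipped_coordinates.w const_ac x y \<gamma> \<epsilon> ^ 2
          = ev [:2 * \<delta> + 1, 30 * \<delta> - 3, 30 * \<delta> + 3, 2 * \<delta> - 1:] (flipped_coordinates.z const_ac x \<gamma> ^ 2)"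
        using flipped_coordinates.w2_sextic[OF fl, of y] y2
        unfolding \<gamma>6 \<gamma> sextic_quotient_def by blast
      show "quartic_disc [:2 * \<delta> + 1, 30 * \<delta> - 3, 30 * \<delta> + 3, 2 * \<delta> - 1:] \<noteq> 0"
        unfolding sextic_quotient_def[symmetric] sextic_quotient_invariants using \<delta>0 nz by simp
    qed (fact nz(2))
    thus "j_sextic \<delta> \<in> degree2_elliptic_j_invariants (curve_field 0 (sextic (\<delta> ^ 2)))"
      unfolding quartic_j_sextic_quotient[OF \<delta>0] \<delta> .
  qed
qed

lemma image_square_roots:
  fixes b :: "'a::idom"
  shows "{f c | c. c ^ 2 = b ^ 2} = {f b, f (- b)}"
  by (auto simp: power2_eq_iff)

theorem lemma7:
  fixes t :: "'k::{alg_closed_field, field_char_0}"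
  shows
    "(t \<notin> {0, 1 / 4, 9 / 100} \<longrightarrow>
       degree2_elliptic_j_invariants (curve_field 0 (quintic t)) =
         {j. j ^ 2 - 128 * ((2000 * t ^ 2 + 1440 * t + 27) / (4 * t - 1) ^ 2) * j
             + 4096 * ((100 * t - 9) ^ 3 / (4 * t - 1) ^ 3) = 0}) \<and>
     (t \<notin> {0, 1 / 4, - (1 / 50)} \<longrightarrow>
       degree2_elliptic_j_invariants (curve_field 0 (sextic t)) =
         {j. j ^ 2 - 13824 * t * ((500 * t ^ 2 + 965 * t + 92) / (4 * t - 1) ^ 3) * j
             + 47775744 * t * ((25 * t - 4) ^ 3 / (4 * t - 1) ^ 4) = 0})"
proof -
  \<comment> \<open>Either square root of \<open>t\<close> will do: the two sets of j-values and the
    quadratics are symmetric in \<open>b\<close> and \<open>- b\<close>.\<close>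
  obtain b where b: "b ^ 2 = t" using nth_root_exists[of 2 t] by auto
  have N: "4 * b ^ 2 - 1 \<noteq> 0" if "t \<noteq> 1 / 4"
    using that by (auto simp: b field_simps)
  show ?thesis
  proof (intro conjI impI)
    assume t: "t \<notin> {0, 1 / 4, 9 / 100}"
    hence N': "4 * b ^ 2 - 1 \<noteq> 0" by (intro N) simp
    show "degree2_elliptic_j_invariants (curve_field 0 (quintic t)) =
         {j. j ^ 2 - 128 * ((2000 * t ^ 2 + 1440 * t + 27) / (4 * t - 1) ^ 2) * j
             + 4096 * ((100 * t - 9) ^ 3 / (4 * t - 1) ^ 3) = 0}"
      unfolding quintic_j_invariants[OF t]
      unfolding b[symmetric] image_square_roots quintic_quadratic_factorization[OF N'] by auto
  next
    assume t: "t \<notin> {0, 1 / 4, - (1 / 50)}"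
    hence N': "4 * b ^ 2 - 1 \<noteq> 0" by (intro N) simp
    show "degree2_elliptic_j_invariants (curve_field 0 (sextic t)) =
         {j. j ^ 2 - 13824 * t * ((500 * t ^ 2 + 965 * t + 92) / (4 * t - 1) ^ 3) * j
             + 47775744 * t * ((25 * t - 4) ^ 3 / (4 * t - 1) ^ 4) = 0}"
      unfolding sextic_j_invariants[OF t]
      unfolding b[symmetric] image_square_roots sextic_quadratic_factorization[OF N'] by auto
  qed
qed

end
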